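(* Let $f:\mathbb{R}^d\to\mathbb{R}$ be $\mathcal C^1$, bounded from below, subanalytic, with globally $L_f$-Lipschitz gradient. Let $(\sigma_k)_{k\ge 0}$ be a (deterministic) sequence of reals with $\sigma_{k+1}\le\sigma_k$ for all $k$ and $\sigma_k\to\epsilon>0$, and set $I_\epsilon=[\epsilon,\sigma_0]$. Let $(g_\sigma)_{\sigma>0}$ be a family of functions $g_\sigma:\mathbb{R}^d\to\mathbb{R}$ such that $(x,\sigma)\mapsto g_\sigma(x)$ is jointly $\mathcal C^2$ and subanalytic on $\mathbb{R}^d\times(0,\infty)$, $\nabla g_\sigma$ is $L_g$-Lipschitz for all $\sigma\in I_\epsilon$, and there are positive constants $c_0,C_0,M_g$ such that for all $x\in\mathbb{R}^d$ and $\sigma\in I_\epsilon$, $$g_\sigma(x)\ge c_0\|x\|^2-C_0,\qquad |\partial_\sigma g_\sigma(x)|\le M_g(1+\|x\|^2).$$ Put $D_\sigma=\mathrm{Id}-\nabla g_\sigma$, and assume that at least one of the following holds: (a) there exists $\rho<1$ such that $\nabla g_\sigma$ is $\rho$-Lipschitz for every $\sigma\in I_\epsilon$; or (b) $D_\sigma$ is the exact MMSE denoiser (with $g_\sigma=-\sigma^2\log p_\sigma$) associated with a compactly supported prior $P_X$ on $\mathbb{R}^d$ whose support is not contained in an affine hyperplane. Let $\phi_\sigma=\bigl(\tfrac12\|\cdot\|^2-g_\sigma\bigr)^*-\tfrac12\|\cdot\|^2$, so that $D_\sigma=\operatorname{prox}_{\phi_\sigma}$. Let $\gamma>0$ with $\gamma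 L_f<1$, and let $(\tau_k)_{k\ge0}$ be a (deterministic) sequence of nonnegative reals with $\sum_k\tau_k^2<\infty$. Let $x_0\in\mathbb{R}^d$, let $Z_{k+1}\sim\mathcal N(0,I_d)$ for $k\ge0$, and define $$x_{k+1}=D_{\sigma_k}\bigl(x_k-\gamma\nabla f(x_k)+\tau_kZ_{k+1}\bigr),\qquad k\ge0 .$$ Let $F_\sigma=f+\gamma^{-1}\phi_\sigma$. Then, almost surely, $\|\nabla F_\epsilon(x_k)\|\to0$, $\|x_{k+1}-x_k\|\to0$, and every cluster point of $(x_k)$ is a critical point of $F_\epsilon$. In particular, $\operatorname{dist}(x_k,\operatorname{crit}F_\epsilon)\to0$. Moreover, almost surely, $$\min_{1\le k\le K}\|\nabla F_{\sigma_k}(x_k)\|^2=\mathcal O(K^{-1}),\qquad K\ge1 .$$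
   Context: $\nabla$ denotes the gradient with respect to $x$; $h^*(x)=\sup_{z}\{\langle x,z\rangle-h(z)\}$ is the Fenchel conjugate; $D_\sigma=\operatorname{prox}_{\phi_\sigma}$ means that $D_\sigma(z)$ minimizes $x\mapsto\frac12\|x-z\|^2+\phi_\sigma(x)$. MMSE denoiser: let $X\sim P_X$ and $Z\sim\mathcal N(0,I_d)$ be independent and let $p_\sigma$ be the density of $X+\sigma Z$. The MMSE denoiser is $D_\sigma(z)=\mathbb{E}[X\mid X+\sigma Z=z]$, and by Tweedie's formula $D_\sigma=\mathrm{Id}-\nabla g_\sigma$ with $g_\sigma=-\sigma^2\log p_\sigma$. The potential $\phi_\sigma$ may take the value $+\infty$; gradients of $F_\sigma$ are taken at points of $U=\operatorname{int}(\operatorname{dom}\phi_\sigma)$, where $U=\mathbb{R}^d$ in case (a) and $U=\operatorname{int}(\operatorname{conv}(\operatorname{supp}P_X))$ in case (b). In case (b) the iterates $x_k$ with $k\ge1$ lie in $U$, and statements about $\nabla F_\sigma(x_k)$ concern $k\ge1$. $\operatorname{crit}F_\epsilon=\{x\in U:\nabla F_\epsilon(x)=0\}$ and $\operatorname{dist}$ is Euclidean distance to a set. *)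

theory Defs
  imports "HOL-Probability.Probability"
begin

text \<open>Only meaningful where \<^term>\<open>f\<close> is differentiable; the gradient is then unique.\<close>

definition grad :: "('a::euclidean_space \<Rightarrow> real) \<Rightarrow> 'a \<Rightarrow> 'a" where
  "grad f x = (THE v. GDERIV f x :> v)"

definition C1_on :: "'a::euclidean_space set \<Rightarrow> ('a \<Rightarrow> real) \<Rightarrow> bool" where
  "C1_on S f \<longleftrightarrow> (\<exists>G. (\<forall>x\<in>S. GDERIV f x :> G x) \<and> continuous_on S G)"

definition C2_on :: "'a::euclidean_space set \<Rightarrow> ('a \<Rightarrow> real) \<Rightarrow> bool" where
  "C2_on S f \<longleftrightarrow>
    (\<exists>G (H :: 'a \<Rightarrow> 'a \<Rightarrow>\<^sub>L 'a).
      (\<forall>x\<in>S. GDERIV f x :> G x) \<and>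
      (\<forall>x\<in>S. (G has_derivative blinfun_apply (H x)) (at x)) \<and>
      continuous_on S H)"

text \<open>
  The definition of a subanalytic subset of a Euclidean space \<open>E\<close> quantifies existentially over
  the number \<open>m\<close> of variables that are projected away, so \<open>m\<close> cannot be a type.
  The space \<open>E \<times> \<real>\<^sup>m\<close> is modelled by the pairs \<open>(x, y)\<close> where \<open>y\<close> is a real sequence that vanishes
  from index \<open>m\<close> on. The case \<open>m = 0\<close> is \<open>E\<close> itself.
\<close>

definition space_ext :: "nat \<Rightarrow> ('a::euclidean_space \<times> (nat \<Rightarrow> real)) set" where
  "space_ext m = {(x, y). \<forall>i\<ge>m. y i = 0}"

definition nbhd_ext ::
  "nat \<Rightarrow> 'a::euclidean_space \<times> (nat \<Rightarrow> real) \<Rightarrow> real \<Rightarrow> ('a \<times> (nat \<Rightarrow> real)) set" where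
  "nbhd_ext m p r =
    {(x, y) \<in> space_ext m. dist x (fst p) < r \<and> (\<forall>i<m. \<bar>y i - snd p i\<bar> < r)}"

definition bounded_ext :: "nat \<Rightarrow> ('a::euclidean_space \<times> (nat \<Rightarrow> real)) set \<Rightarrow> bool" where
  "bounded_ext m B \<longleftrightarrow>
    B \<subseteq> space_ext m \<and> (\<exists>C. \<forall>(x, y)\<in>B. norm x \<le> C \<and> (\<forall>i<m. \<bar>y i\<bar> \<le> C))"

definition multi_indices :: "nat \<Rightarrow> (('a::euclidean_space \<Rightarrow> nat) \<times> (nat \<Rightarrow> nat)) set" where
  "multi_indices m = {(\<alpha>, \<beta>). (\<forall>e. e \<notin> Basis \<longrightarrow> \<alpha> e = 0) \<and> (\<forall>i\<ge>m. \<beta> i = 0)}"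

definition monomial_at ::
  "nat \<Rightarrow> 'a::euclidean_space \<times> (nat \<Rightarrow> real) \<Rightarrow> ('a \<Rightarrow> nat) \<times> (nat \<Rightarrow> nat) \<Rightarrow>
    'a \<times> (nat \<Rightarrow> real) \<Rightarrow> real" where
  "monomial_at m p \<nu> z =
    (\<Prod>e\<in>Basis. ((fst z - fst p) \<bullet> e) ^ fst \<nu> e) * (\<Prod>i<m. (snd z i - snd p i) ^ snd \<nu> i)"

text \<open>Real analyticity at \<open>p\<close>: the function is the sum of a power series centred at \<open>p\<close> on a
  neighbourhood of \<open>p\<close>.\<close>

definition real_analytic_at ::
  "nat \<Rightarrow> ('a::euclidean_space \<times> (nat \<Rightarrow> real) \<Rightarrow> real) \<Rightarrow> 'a \<times> (nat \<Rightarrow> real) \<Rightarrow> bool" where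
  "real_analytic_at m h p \<longleftrightarrow>
    (\<exists>r>0. \<exists>c. \<forall>z\<in>nbhd_ext m p r.
      ((\<lambda>\<nu>. c \<nu> * monomial_at m p \<nu> z) has_sum h z) (multi_indices m))"

definition semianalytic :: "nat \<Rightarrow> ('a::euclidean_space \<times> (nat \<Rightarrow> real)) set \<Rightarrow> bool" where
  "semianalytic m B \<longleftrightarrow>
    B \<subseteq> space_ext m \<and>
    (\<forall>p\<in>space_ext m. \<exists>r>0. \<exists>(k::nat) (l::nat) u v.
      (\<forall>i<k. \<forall>j<l. \<forall>z\<in>nbhd_ext m p r.
        real_analytic_at m (u i j) z \<and> real_analytic_at m (v i j) z) \<and>
      B \<inter> nbhd_ext m p r =
        (\<Union>i<k. {z \<in> nbhd_ext m p r. \<forall>j<l. u i j z = 0 \<and> v i j z > 0}))"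

text \<open>Subanalyticity in an open set \<open>\<Omega>\<close>, regarded as a real analytic manifold: the local condition
  is imposed at the points of \<open>\<Omega>\<close> only, not at its boundary.\<close>

definition subanalytic_in :: "'a::euclidean_space set \<Rightarrow> 'a set \<Rightarrow> bool" where
  "subanalytic_in \<Omega> A \<longleftrightarrow>
    A \<subseteq> \<Omega> \<and>
    (\<forall>a\<in>\<Omega>. \<exists>V. open V \<and> a \<in> V \<and>
      (\<exists>m B. bounded_ext m B \<and> semianalytic m B \<and> A \<inter> V = fst ` B))"

definition subanalytic_on :: "'a::euclidean_space set \<Rightarrow> ('a \<Rightarrow> real) \<Rightarrow> bool" where
  "subanalytic_on \<Omega> h \<longleftrightarrow> subanalytic_in (\<Omega> \<times> UNIV) {(x, h x) | x. x \<in> \<Omega>}"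

definition denoiser :: "(real \<Rightarrow> 'a::euclidean_space \<Rightarrow> real) \<Rightarrow> real \<Rightarrow> 'a \<Rightarrow> 'a" where
  "denoiser g \<sigma> z = z - grad (g \<sigma>) z"

definition fenchel_conjugate :: "('a::euclidean_space \<Rightarrow> real) \<Rightarrow> 'a \<Rightarrow> ereal" where
  "fenchel_conjugate h x = (SUP z. ereal (x \<bullet> z - h z))"

definition potential :: "(real \<Rightarrow> 'a::euclidean_space \<Rightarrow> real) \<Rightarrow> real \<Rightarrow> 'a \<Rightarrow> ereal" where
  "potential g \<sigma> x =
    fenchel_conjugate (\<lambda>z. (norm z)\<^sup>2 / 2 - g \<sigma> z) x - ereal ((norm x)\<^sup>2 / 2)"

definition objective ::
  "('a::euclidean_space \<Rightarrow> real) \<Rightarrow> (real \<Rightarrow> 'a \<Rightarrow> real) \<Rightarrow> real \<Rightarrow> real \<Rightarrow> 'a \<Rightarrow> ereal" where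
  "objective f g \<gamma> \<sigma> x = ereal (f x) + ereal (1 / \<gamma>) * potential g \<sigma> x"

definition int_dom :: "('a::euclidean_space \<Rightarrow> ereal) \<Rightarrow> 'a set" where
  "int_dom h = interior {x. h x < \<infinity>}"

text \<open>Differentiability and gradient of an extended-real-valued function, at points of the interior
  of its domain, are those of its real-valued version.\<close>

definition finite_part :: "('a \<Rightarrow> ereal) \<Rightarrow> 'a \<Rightarrow> real" where
  "finite_part h x = real_of_ereal (h x)"

definition crit :: "('a::euclidean_space \<Rightarrow> ereal) \<Rightarrow> 'a set" where
  "crit h = {x \<in> int_dom h. GDERIV (finite_part h) x :> 0}"

definition std_gaussian_density :: "'a::euclidean_space \<Rightarrow> real" where
  "std_gaussian_density x = (\<Prod>e\<in>Basis. std_normal_density (x \<bullet> e))"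

definition std_gaussian :: "'a::euclidean_space measure" where
  "std_gaussian = density lborel (\<lambda>x. ennreal (std_gaussian_density x))"

definition measure_support :: "'a::euclidean_space measure \<Rightarrow> 'a set" where
  "measure_support P = {x. \<forall>V. open V \<longrightarrow> x \<in> V \<longrightarrow> emeasure P V > 0}"

definition nondegenerate_compact_prior :: "'a::euclidean_space measure \<Rightarrow> bool" where
  "nondegenerate_compact_prior P \<longleftrightarrow>
    prob_space P \<and> sets P = sets borel \<and> compact (measure_support P) \<and>
    \<not> (\<exists>a b. a \<noteq> 0 \<and> measure_support P \<subseteq> {x. a \<bullet> x = b})"

text \<open>The independent pair \<open>(X, Z)\<close> is realised by the two coordinates of a product space.\<close>

definition joint_space :: "'a::euclidean_space measure \<Rightarrow> ('a \<times> 'a) measure" where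
  "joint_space P = P \<Otimes>\<^sub>M std_gaussian"

definition observation :: "real \<Rightarrow> 'a::euclidean_space \<times> 'a \<Rightarrow> 'a" where
  "observation \<sigma> w = fst w + \<sigma> *\<^sub>R snd w"

text \<open>\<^term>\<open>D\<close> is a version of \<open>z \<mapsto> E[X | X + \<sigma>Z = z]\<close>, expressed coordinatewise.\<close>

definition is_mmse_denoiser ::
  "'a::euclidean_space measure \<Rightarrow> real \<Rightarrow> ('a \<Rightarrow> 'a) \<Rightarrow> bool" where
  "is_mmse_denoiser P \<sigma> D \<longleftrightarrow>
    D \<in> borel_measurable borel \<and>
    (\<forall>e\<in>Basis. AE w in joint_space P.
      real_cond_exp (joint_space P)
        (vimage_algebra (space (joint_space P)) (observation \<sigma>) borel)
        (\<lambda>w. fst w \<bullet> e) w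
      = D (observation \<sigma> w) \<bullet> e)"

text \<open>Continuity selects the canonical version of the density, which is everywhere positive.\<close>

definition is_noisy_density ::
  "'a::euclidean_space measure \<Rightarrow> real \<Rightarrow> ('a \<Rightarrow> real) \<Rightarrow> bool" where
  "is_noisy_density P \<sigma> p \<longleftrightarrow>
    distributed (joint_space P) lborel (observation \<sigma>) (\<lambda>x. ennreal (p x)) \<and>
    continuous_on UNIV p \<and> (\<forall>x. p x > 0)"

definition exact_mmse_case ::
  "'a::euclidean_space measure \<Rightarrow> real set \<Rightarrow> (real \<Rightarrow> 'a \<Rightarrow> real) \<Rightarrow> bool" where
  "exact_mmse_case P S g \<longleftrightarrow>
    nondegenerate_compact_prior P \<and>
    (\<forall>\<sigma>\<in>S. is_mmse_denoiser P \<sigma> (denoiser g \<sigma>) \<and>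
      (\<exists>p. is_noisy_density P \<sigma> p \<and> (\<forall>x. g \<sigma> x = - \<sigma>\<^sup>2 * ln (p x))))"

end

(*
  With h = |.|^2/2 - g_sigma, the denoiser is D = grad h, and phi_sigma = h^* - |.|^2/2. If h is
  strongly convex on bounded sets (uniformly in sigma), D is injective with open range, h^* is
  differentiable there with gradient D^{-1}, and one iteration is a noisy proximal gradient step:
  gamma f + phi_{sigma_k} decreases by a multiple of |x_{k+1} - x_k|^2 up to a multiple of the squared
  noise, which is almost surely summable. Changing sigma costs a factor 1 + O(sigma_k - sigma_{k+1})
  in the contractive case. In the MMSE case it costs nothing: up to constants h is a log-Laplace
  transform s^{-1} log E exp(s u(X)) with s = 1/sigma^2, hence nondecreasing in s, so phi_sigma (up to
  constants) decreases and the range of D grows along the run. A Robbins-Siegmund argument bounds the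
  iterates and makes |x_{k+1} - x_k|^2 summable. The points y_k with x_{k+1} = D_{sigma_k}(y_k) then stay
  bounded, so that D_sigma^{-1}(x_{k+1}) - y_k = O(sigma_k - sigma), which transfers the prox optimality
  condition to the gradients of F_{sigma_{k+1}} and F_epsilon.
*)
theory Submission
  imports Defs
begin

section \<open>Strongly convex functions and their conjugates\<close>

text \<open>In the MMSE case the denoiser is bounded, the potential is not finite everywhere, and
  the inverse denoiser blows up at the boundary of its domain. Bounded iterates alone thus give no
  control of their preimages; the control comes from the forward step, which expresses
  \<open>y k\<close> explicitly through \<open>x k\<close>. For the same reason strong convexity is
  only assumed on balls, and statements about the potential are made on
  \<open>range (denoiser g \<sigma>)\<close>, which is open by invariance of domain. The start
  \<open>x 0\<close> may lie outside this range, so the energy starts at \<open>x 1\<close>. Two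
  gaps between noise levels occur: \<open>s k - s (Suc k)\<close> is summable by telescoping and
  gives the rate along \<open>s k\<close>, whereas \<open>s k - \<epsilon>\<close> is only known to
  tend to zero and gives the limit at level \<open>\<epsilon>\<close>. Randomness enters only
  through the almost sure summability of the squared noise; each sample path is then treated
  deterministically.\<close>

lemma grad_eq:
  assumes "GDERIV f x :> v"
  shows "grad f x = v"
  unfolding grad_def
proof (rule the_equality)
  fix w assume "GDERIV f x :> w"
  then have "(\<lambda>h. h \<bullet> w) = (\<lambda>h. h \<bullet> v)"
    using assms unfolding gderiv_def by (rule has_derivative_unique)
  then have "(w - v) \<bullet> w = (w - v) \<bullet> v" by meson
  then have "(w - v) \<bullet> (w - v) = 0" by (simp add: inner_diff_right)
  then show "w = v" by simp
qed fact

section \<open>Derivatives along lines, minimisers and the descent lemma\<close>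

lemma GDERIV_imp_along_line:
  assumes "GDERIV f (z + t *\<^sub>R u) :> v"
  shows "((\<lambda>r. f (z + r *\<^sub>R u)) has_real_derivative (v \<bullet> u)) (at t)"
proof -
  have 1: "((\<lambda>r. z + r *\<^sub>R u) has_derivative (\<lambda>r. r *\<^sub>R u)) (at t)"
    by (auto intro!: derivative_eq_intros)
  have "((\<lambda>r. f (z + r *\<^sub>R u)) has_derivative (\<lambda>r. (r *\<^sub>R u) \<bullet> v)) (at t)"
    using has_derivative_compose[OF 1 assms[unfolded gderiv_def]] .
  then show ?thesis
    by (auto simp: has_field_derivative_def inner_commute mult.commute elim!: has_derivative_eq_rhs)
qed

lemma GDERIV_imp_continuous:
  assumes "\<And>z. GDERIV f z :> D z"
  shows "continuous_on UNIV f"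
  using assms unfolding gderiv_def
  by (meson has_derivative_continuous continuous_at_imp_continuous_on)

lemma GDERIV_at_local_min:
  assumes "GDERIV f x :> v" "r > 0" "\<And>y. y \<in> ball x r \<Longrightarrow> f x \<le> f y"
  shows "v = 0"
proof -
  have "(\<lambda>h. h \<bullet> v) = (\<lambda>h. 0)"
    using differential_zero_maxmin[of x "ball x r" f "\<lambda>h. h \<bullet> v"] assms
    by (auto simp: gderiv_def)
  then have "v \<bullet> v = 0" by meson
  then show ?thesis by simp
qed

text \<open>Linear growth makes the values outside a large ball exceed the value at the origin, so a
  minimiser over that ball is global. Equations \<open>D' w = v\<close> are solved below by tilting
  a function by \<open>v\<close> and applying this.\<close>

lemma GDERIV_coercive_critical_point:
  fixes f :: "'a::euclidean_space \<Rightarrow> real"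
  assumes "\<And>z. GDERIV f z :> D z"
    and "c > 0" and "\<And>z. f z \<ge> c * norm z - C"
  obtains z where "D z = 0"
proof -
  define R where "R = (f 0 + C) / c"
  have "continuous_on (cball 0 (max R 0)) f"
    using GDERIV_imp_continuous[OF assms(1)] continuous_on_subset by blast
  then obtain z where z: "z \<in> cball 0 (max R 0)" "\<And>y. y \<in> cball 0 (max R 0) \<Longrightarrow> f z \<le> f y"
    using continuous_attains_inf[OF compact_cball, of 0 "max R 0" f] by (meson cball_eq_empty max.cobounded2 not_less)
  have "f z \<le> f y" for y
  proof (cases "y \<in> cball 0 (max R 0)")
    case False
    then have "norm y > R" by auto
    then have "c * norm y > f 0 + C"
      using assms(2) by (simp add: R_def field_simps)
    then have "f y > f 0" using assms(3)[of y] by simp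
    moreover have "f z \<le> f 0" using z(2)[of 0] by simp
    ultimately show ?thesis by simp
  qed (use z in auto)
  then have "D z = 0" using GDERIV_at_local_min[OF assms(1)[of z], of 1] by simp
  then show ?thesis using that by blast
qed

lemma GDERIV_half_norm_sq: "GDERIV (\<lambda>x. (norm x)\<^sup>2 / 2) x :> (x::'a::real_inner)"
  unfolding gderiv_def dot_square_norm[symmetric]
  by (auto intro!: derivative_eq_intros simp: inner_commute)

lemma GDERIV_Lipschitz_upper_bound:
  assumes "\<And>z. GDERIV f z :> D z" and "L-lipschitz_on UNIV D"
  shows "f y \<le> f x + D x \<bullet> (y - x) + L / 2 * (norm (y - x))\<^sup>2"
proof -
  define u where "u = y - x"
  \<comment> \<open>\<open>q\<close> is \<open>f\<close> on the segment minus the non-constant part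
    of the claimed quadratic bound; the Lipschitz condition makes it nonincreasing.\<close>
  define q where "q t = f (x + t *\<^sub>R u) - t * (D x \<bullet> u) - L / 2 * t\<^sup>2 * (norm u)\<^sup>2" for t
  have der: "(q has_real_derivative (D (x + t *\<^sub>R u) \<bullet> u - D x \<bullet> u - L * t * (norm u)\<^sup>2)) (at t)" for t
    unfolding q_def
    by (auto intro!: derivative_eq_intros GDERIV_imp_along_line assms(1))
  have "q 1 \<le> q 0"
  proof (rule DERIV_nonpos_imp_nonincreasing[of 0 1 q])
    fix t :: real assume t: "0 \<le> t" "t \<le> 1"
    have "(D (x + t *\<^sub>R u) - D x) \<bullet> u \<le> norm (D (x + t *\<^sub>R u) - D x) * norm u"
      by (rule norm_cauchy_schwarz)
    also have "\<dots> \<le> (L * norm (t *\<^sub>R u)) * norm u"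
      using lipschitz_onD[OF assms(2), of "x + t *\<^sub>R u" x]
      by (intro mult_right_mono) (auto simp: dist_norm)
    also have "\<dots> = L * t * (norm u)\<^sup>2" using t by (simp add: power2_eq_square)
    finally show "\<exists>y. DERIV q t :> y \<and> y \<le> 0"
      using der[of t] by (intro exI conjI) (auto simp: inner_diff_left)
  qed simp
  then show ?thesis by (simp add: q_def u_def)
qed

text \<open>The modulus may depend on the radius: in the MMSE case \<open>D\<close> is bounded,
  hence not strongly monotone with a single modulus on the whole space.\<close>

locale locally_strongly_convex =
  fixes h :: "'a::euclidean_space \<Rightarrow> real" and D :: "'a \<Rightarrow> 'a"
  assumes gderiv: "GDERIV h z :> D z"
    and continuous_D: "continuous_on UNIV D"
    and strongly_monotone:
      "\<exists>m>0. \<forall>z\<in>cball 0 R. \<forall>w\<in>cball 0 R. m * (norm (z - w))\<^sup>2 \<le> (D z - D w) \<bullet> (z - w)"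
begin

lemma monotone_D: "(D z - D w) \<bullet> (z - w) \<ge> 0"
proof -
  define R where "R = max (norm z) (norm w)"
  obtain m where "m > 0" "\<forall>z\<in>cball 0 R. \<forall>w\<in>cball 0 R. m * (norm (z - w))\<^sup>2 \<le> (D z - D w) \<bullet> (z - w)"
    using strongly_monotone by blast
  moreover have "z \<in> cball 0 R" "w \<in> cball 0 R" by (auto simp: R_def)
  ultimately have "m * (norm (z - w))\<^sup>2 \<le> (D z - D w) \<bullet> (z - w)" "0 \<le> m * (norm (z - w))\<^sup>2" by auto
  then show ?thesis by linarith
qed

lemma inj_D: "inj D"
proof (rule injI)
  fix z w assume eq: "D z = D w"
  define R where "R = max (norm z) (norm w)"
  obtain m where m: "m > 0" "\<forall>z\<in>cball 0 R. \<forall>w\<in>cball 0 R. m * (norm (z - w))\<^sup>2 \<le> (D z - D w) \<bullet> (z - w)"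
    using strongly_monotone by blast
  moreover have "z \<in> cball 0 R" "w \<in> cball 0 R" by (auto simp: R_def)
  ultimately have "m * (norm (z - w))\<^sup>2 \<le> 0" using eq by fastforce
  then show "z = w" using m(1) by (simp add: mult_le_0_iff)
qed

text \<open>Continuity and injectivity suffice, so no derivative of \<open>D\<close> has to be
  inverted. Openness is what gives the conjugate a full derivative at each point of the
  range.\<close>

lemma open_range_D: "open (range D)"
  using invariance_of_domain[OF continuous_D open_UNIV inj_D] .

lemma monotone_D_ray:
  assumes "s \<le> t"
  shows "D (z + s *\<^sub>R u) \<bullet> u \<le> D (z + t *\<^sub>R u) \<bullet> u"
proof (cases "s = t")
  case False
  then have "t - s > 0" using assms by simp
  moreover have "(t - s) * ((D (z + t *\<^sub>R u) - D (z + s *\<^sub>R u)) \<bullet> u) \<ge> 0"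
    using monotone_D[of "z + t *\<^sub>R u" "z + s *\<^sub>R u"]
    by (simp add: algebra_simps flip: scaleR_diff_left)
  ultimately show ?thesis by (simp add: zero_le_mult_iff inner_diff_left)
qed simp

lemma above_tangent: "h w \<ge> h z + D z \<bullet> (w - z)"
proof -
  have "\<exists>\<xi>>0. \<xi> < 1 \<and> h (z + 1 *\<^sub>R (w - z)) - h (z + 0 *\<^sub>R (w - z)) = (1 - 0) * (D (z + \<xi> *\<^sub>R (w - z)) \<bullet> (w - z))"
    by (rule MVT2) (auto intro: GDERIV_imp_along_line gderiv)
  then obtain \<xi> where "0 < \<xi>" "h w - h z = D (z + \<xi> *\<^sub>R (w - z)) \<bullet> (w - z)" by auto
  then show ?thesis using monotone_D_ray[of 0 \<xi> z "w - z"] by simp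
qed

text \<open>Only \<open>z\<close> is known to lie well inside the ball, \<open>w\<close> is
  arbitrary. Strong monotonicity is therefore applied to a point of the segment at distance at most
  1 from \<open>z\<close>, and monotonicity along the ray carries the gain on to \<open>w\<close>.
  This is the origin of the truncation \<open>min 1\<close>.\<close>

lemma inverse_modulus:
  assumes m: "\<And>v w. v \<in> cball 0 R \<Longrightarrow> w \<in> cball 0 R \<Longrightarrow> m * (norm (v - w))\<^sup>2 \<le> (D v - D w) \<bullet> (v - w)"
    and "m > 0" and "norm z + 1 \<le> R"
  shows "m * min 1 (norm (w - z)) \<le> norm (D w - D z)"
proof (cases "w = z")
  case False
  define t where "t = norm (w - z)"
  define r where "r = min 1 t"
  define u where "u = (1 / t) *\<^sub>R (w - z)"
  have t: "t > 0" "norm u = 1" "w = z + t *\<^sub>R u" using False by (auto simp: t_def u_def)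
  have r: "r > 0" "r \<le> t" "r \<le> 1" using t by (auto simp: r_def)
  have "norm (z + r *\<^sub>R u) \<le> norm z + r" using norm_triangle_ineq[of z "r *\<^sub>R u"] t r by simp
  then have "m * (norm (r *\<^sub>R u))\<^sup>2 \<le> (D (z + r *\<^sub>R u) - D z) \<bullet> (r *\<^sub>R u)"
    using m[of "z + r *\<^sub>R u" z] assms(3) r by simp
  then have "r * (m * r) \<le> r * ((D (z + r *\<^sub>R u) - D z) \<bullet> u)"
    using t by (simp add: power2_eq_square algebra_simps)
  then have "m * r \<le> (D (z + r *\<^sub>R u) - D z) \<bullet> u" using r by simp
  also have "\<dots> \<le> (D w - D z) \<bullet> u"
    using monotone_D_ray[OF r(2), of z u] t by (simp add: inner_diff_left)
  also have "\<dots> \<le> norm (D w - D z) * norm u" by (rule norm_cauchy_schwarz)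
  finally show ?thesis using t(2) by (simp add: r_def t_def)
qed simp

lemma inverse_modulus_ex:
  obtains m where "m > 0" "\<And>w. m * min 1 (norm (w - z)) \<le> norm (D w - D z)"
proof -
  obtain m where "m > 0" "\<forall>v\<in>cball 0 (norm z + 1). \<forall>w\<in>cball 0 (norm z + 1). m * (norm (v - w))\<^sup>2 \<le> (D v - D w) \<bullet> (v - w)"
    using strongly_monotone by blast
  then show ?thesis using that inverse_modulus[of "norm z + 1" m z] by auto
qed

text \<open>Since \<open>h\<close> is strongly convex near \<open>z\<close>, its tilt by \<open>D z\<close> grows at least linearly.\<close>

lemma tilted_coercive:
  obtains c C where "c > 0" "\<And>w. h w - D z \<bullet> w \<ge> c * norm w - C"
proof -
  obtain m where m: "m > 0" and
    mono: "\<forall>v\<in>cball 0 (norm z + 1). \<forall>w\<in>cball 0 (norm z + 1). m * (norm (v - w))\<^sup>2 \<le> (D v - D w) \<bullet> (v - w)"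
    using strongly_monotone by blast
  have grow: "h w - D z \<bullet> w \<ge> h z - D z \<bullet> z + m / 2 * (norm (w - z) - 1)" for w
  proof (cases "norm (w - z) \<le> 1")
    case True
    then have "m / 2 * (norm (w - z) - 1) \<le> 0" using m by (simp add: mult_le_0_iff)
    then show ?thesis using above_tangent[of z w] by (simp add: inner_diff_right)
  next
    case False
    define t where "t = norm (w - z)"
    define u where "u = (1 / t) *\<^sub>R (w - z)"
    have t: "t > 1" "norm u = 1" "w = z + t *\<^sub>R u" using False by (auto simp: t_def u_def)
    \<comment> \<open>Strong monotonicity over the half step to \<open>v\<close> raises the slope in
      direction \<open>u\<close> by \<open>m / 2\<close>; the tangent at \<open>v\<close> then keeps
      this extra slope over the remaining length \<open>t - 1/2\<close>.\<close>
    define v where "v = z + (1/2) *\<^sub>R u"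
    have v: "norm (v - z) = 1/2" "norm v \<le> norm z + 1"
      using t norm_triangle_ineq[of z "(1/2) *\<^sub>R u"] by (auto simp: v_def)
    have "m * (norm (v - z))\<^sup>2 \<le> (D v - D z) \<bullet> (v - z)"
      using mono v by simp
    then have vz: "m / 2 \<le> (D v - D z) \<bullet> u" using v by (simp add: v_def t power2_eq_square)
    have wv: "w - v = (t - 1/2) *\<^sub>R u" using t by (simp add: v_def algebra_simps)
    have "h w - h z \<ge> D v \<bullet> (w - v) + D z \<bullet> (v - z)"
      using above_tangent[of v w] above_tangent[of z v] by simp
    moreover have "D v \<bullet> (w - v) = D z \<bullet> (w - v) + (t - 1/2) * ((D v - D z) \<bullet> u)"
      by (simp add: wv algebra_simps)
    moreover have "(t - 1/2) * ((D v - D z) \<bullet> u) \<ge> (t - 1) * (m / 2)"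
      using t m vz by (intro mult_mono) auto
    ultimately show ?thesis by (simp add: t_def inner_diff_right algebra_simps)
  qed
  show ?thesis
  proof (rule that[of "m / 2" "- (h z - D z \<bullet> z) + m / 2 * (norm z + 1)"])
    fix w
    have "m / 2 * norm w \<le> m / 2 * (norm (w - z) + norm z)"
      using m norm_triangle_ineq[of "w - z" z] by (intro mult_left_mono) auto
    then show "h w - D z \<bullet> w \<ge> m / 2 * norm w - (- (h z - D z \<bullet> z) + m / 2 * (norm z + 1))"
      using grow[of w] by (simp add: field_simps)
  qed (use m in simp)
qed

text \<open>Tilting by \<open>D z\<close> leaves \<open>h\<close> coercive, hence also any
  \<open>h'\<close> above \<open>h\<close> up to a constant; a critical point of the tilted
  \<open>h'\<close> is a preimage of \<open>D z\<close> under \<open>D'\<close>. This makes the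
  ranges grow as the noise level falls in the MMSE case.\<close>

lemma range_D_subset:
  assumes "\<And>z. GDERIV h' z :> D' z" and "\<And>z. h' z \<ge> h z - b"
  shows "range D \<subseteq> range D'"
proof safe
  fix z
  obtain c C where c: "c > 0" "\<And>w. h w - D z \<bullet> w \<ge> c * norm w - C"
    using tilted_coercive by blast
  have "GDERIV (\<lambda>w. h' w - D z \<bullet> w) w :> D' w - D z" for w
    using assms(1)[of w] unfolding gderiv_def
    by (auto intro!: derivative_eq_intros simp: inner_diff_right inner_commute)
  moreover have "h' w - D z \<bullet> w \<ge> c * norm w - (C + b)" for w
    using c(2)[of w] assms(2)[of w] by simp
  ultimately obtain w where "D' w - D z = 0"
    using GDERIV_coercive_critical_point[of "\<lambda>w. h' w - D z \<bullet> w" "\<lambda>w. D' w - D z", OF _ c(1)]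
    by blast
  then have "D z = D' w" by simp
  then show "D z \<in> range D'" by blast
qed

lemma fenchel_conjugate_D: "fenchel_conjugate h (D z) = ereal (D z \<bullet> z - h z)"
  unfolding fenchel_conjugate_def
proof (rule antisym)
  show "(SUP w. ereal (D z \<bullet> w - h w)) \<le> ereal (D z \<bullet> z - h z)"
  proof (rule SUP_least)
    fix w show "ereal (D z \<bullet> w - h w) \<le> ereal (D z \<bullet> z - h z)"
      using above_tangent[of z w] by (simp add: inner_diff_right)
  qed
qed (rule SUP_upper, simp)

text \<open>For \<open>y = D w\<close> the two tangent inequalities between \<open>z\<close> and
  \<open>w\<close> place the linearisation error between 0 and the inner product of
  \<open>y - D z\<close> with \<open>w - z\<close>. It is of smaller order because \<open>w\<close>
  tends to \<open>z\<close> as \<open>y\<close> tends to \<open>D z\<close>.\<close>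

lemma GDERIV_fenchel_conjugate:
  "GDERIV (\<lambda>x. real_of_ereal (fenchel_conjugate h x)) (D z) :> z"
proof -
  define H where "H x = real_of_ereal (fenchel_conjugate h x)" for x
  have H: "H (D w) = D w \<bullet> w - h w" for w by (simp add: H_def fenchel_conjugate_D)
  obtain m where m: "m > 0" "\<And>w. m * min 1 (norm (w - z)) \<le> norm (D w - D z)"
    using inverse_modulus_ex by blast
  obtain r where r: "r > 0" "ball (D z) r \<subseteq> range D"
    using open_range_D by (meson open_contains_ball rangeI)
  have "\<exists>d>0. \<forall>y. norm (y - D z) < d \<longrightarrow>
          norm (H y - H (D z) - (y - D z) \<bullet> z) \<le> e * norm (y - D z)" if "e > 0" for e
  proof (intro exI conjI allI impI)
    \<comment> \<open>The bound \<open>r\<close> keeps \<open>y\<close> in the range; the other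
      bound turns the truncated estimate of \<open>inverse_modulus\<close> into
      \<open>norm (w - z) \<le> e\<close>.\<close>
    define d where "d = min r (m * min 1 e)"
    show "0 < d" using r m \<open>e > 0\<close> by (simp add: d_def)
    fix y assume y: "norm (y - D z) < d"
    then have "y \<in> ball (D z) r" by (simp add: d_def dist_norm norm_minus_commute)
    then obtain w where w: "y = D w" using r by blast
    have "m * min 1 (norm (w - z)) < m * min 1 e"
      using m(2)[of w] y w by (simp add: d_def)
    then have wz: "norm (w - z) \<le> e" using m(1) by auto
    have "norm (H y - H (D z) - (y - D z) \<bullet> z) = H y - H (D z) - (y - D z) \<bullet> z"
      using above_tangent[of w z] by (simp add: H w inner_diff_right inner_diff_left)
    also have "\<dots> \<le> (y - D z) \<bullet> (w - z)"
      using above_tangent[of z w] by (simp add: H w inner_diff_right inner_diff_left)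
    also have "\<dots> \<le> norm (y - D z) * norm (w - z)" by (rule norm_cauchy_schwarz)
    also have "\<dots> \<le> norm (y - D z) * e" using wz by (intro mult_left_mono) auto
    finally show "norm (H y - H (D z) - (y - D z) \<bullet> z) \<le> e * norm (y - D z)"
      by (simp add: mult.commute)
  qed
  then have "(H has_derivative (\<lambda>h. h \<bullet> z)) (at (D z))"
    unfolding has_derivative_at_alt by (auto intro: bounded_linear_inner_left)
  then show ?thesis unfolding gderiv_def H_def .
qed

end

section \<open>The proximal-gradient step\<close>

lemma robbins_siegmund_deterministic:
  fixes V a b e :: "nat \<Rightarrow> real"
  assumes V: "\<And>k. V k \<ge> 0" and a: "\<And>k. a k \<ge> 0" and b: "\<And>k. b k \<ge> 0" and e: "\<And>k. e k \<ge> 0"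
    and "summable a" "summable e"
    and step: "\<And>k. (1 - a k) * V (Suc k) + b k \<le> V k + e k"
  shows "summable b" and "\<exists>B. \<forall>k. V k \<le> B"
proof -
  \<comment> \<open>From \<open>N\<close> on the sum of \<open>a\<close> is at most 1/2, so by the
    Weierstrass product inequality the products \<open>P n\<close> of the factors
    \<open>1 - a j\<close> stay in the interval [1/2, 1]. Multiplying the recursion by
    \<open>P n\<close> makes it telescope at the cost of a factor 2. Before \<open>N\<close> a
    factor \<open>1 - a j\<close> may be negative.\<close>
  obtain N where N: "norm (sum a {m..<n}) < 1/2" if "m \<ge> N" for m n
    using summable_partial_sum_bound[OF \<open>summable a\<close>, of "1/2"]
    by (metis half_gt_zero_iff summable_Cauchy[THEN iffD1, OF \<open>summable a\<close>] zero_less_one)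
  have sum_small: "sum a {N..<n} \<le> 1/2" for n
    using N[of N n] by (simp add: sum_nonneg a)
  have a_le: "a n \<le> 1" if "n \<ge> N" for n
    using member_le_sum[of n "{N..<Suc n}" a] sum_small[of "Suc n"] that a by simp
  define P where "P n = (\<Prod>j\<in>{N..<n}. 1 - a j)" for n
  have P_ge: "P n \<ge> 1/2" for n
  proof -
    have "1 - sum a {N..<n} \<le> P n"
      unfolding P_def by (rule Weierstrass_prod_ineq) (use a a_le in auto)
    then show ?thesis using sum_small[of n] by simp
  qed
  have P_le: "P n \<le> 1" for n
    unfolding P_def by (rule prod_le_1) (use a a_le in auto)
  define E where "E = suminf e"
  have main: "P n * V n + 1/2 * sum b {N..<n} \<le> V N + sum e {N..<n}" if "n \<ge> N" for n
    using that
  proof (induction n rule: dec_induct)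
    case base then show ?case by (simp add: P_def)
  next
    case (step n)
    have "P (Suc n) = P n * (1 - a n)" using step(1) by (simp add: P_def)
    then have "P (Suc n) * V (Suc n) = P n * ((1 - a n) * V (Suc n))" by simp
    also have "\<dots> \<le> P n * (V n + e n - b n)"
      using P_ge[of n] assms(7)[of n] by (intro mult_left_mono) auto
    also have "\<dots> = P n * V n + P n * e n - P n * b n" by (simp add: algebra_simps)
    also have "\<dots> \<le> P n * V n + 1 * e n - 1/2 * b n"
      using P_ge[of n] P_le[of n] e[of n] b[of n]
      by (intro diff_mono add_left_mono mult_right_mono) auto
    finally have "P (Suc n) * V (Suc n) + 1/2 * b n \<le> P n * V n + e n" by simp
    moreover have "sum b {N..<Suc n} = sum b {N..<n} + b n" "sum e {N..<Suc n} = sum e {N..<n} + e n"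
      using step(1) by simp_all
    ultimately show ?case using step.IH by argo
  qed
  have E: "sum e {N..<n} \<le> E" for n
    unfolding E_def by (rule sum_le_suminf) (use assms e in auto)
  have sb: "sum b {N..<n} \<le> 2 * (V N + E)" if "n \<ge> N" for n
  proof -
    have "P n * V n \<ge> 0" using P_ge[of n] V[of n] by (intro mult_nonneg_nonneg) auto
    then show ?thesis using main[OF that] E[of n] by simp
  qed
  have Vb: "V n \<le> 2 * (V N + E)" if "n \<ge> N" for n
  proof -
    have "1/2 * V n \<le> P n * V n" using P_ge[of n] V[of n] by (intro mult_right_mono) auto
    moreover have "sum b {N..<n} \<ge> 0" by (simp add: sum_nonneg b)
    ultimately show ?thesis using main[OF that] E[of n] by simp
  qed
  have "summable (\<lambda>n. b (n + N))"
  proof (rule summableI_nonneg_bounded)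
    fix n
    have "(\<Sum>i<n. b (i + N)) = sum b {N..<N + n}"
      using sum.shift_bounds_nat_ivl[of b 0 N n] by (simp add: atLeast0LessThan add.commute)
    then show "(\<Sum>i<n. b (i + N)) \<le> 2 * (V N + E)" using sb[of "N + n"] by simp
  qed (rule b)
  then show "summable b" by (simp add: summable_iff_shift)
  have "V k \<le> max (2 * (V N + E)) (Max (V ` {..N}))" for k
    by (cases "k \<le> N") (use Vb[of k] in \<open>auto simp: le_max_iff_disj\<close>)
  then show "\<exists>B. \<forall>k. V k \<le> B" by blast
qed

text \<open>A minimum is at most the average. The shift by \<open>Suc\<close> leaves out index 0,
  where the gradient need not exist.\<close>

lemma Min_le_of_summable:
  fixes a :: "nat \<Rightarrow> real"
  assumes "summable (\<lambda>k. a (Suc k))" and "\<And>k. a k \<ge> 0"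
  shows "\<exists>C. \<forall>K\<ge>1. Min (a ` {1..K}) \<le> C / real K"
proof (intro exI allI impI)
  fix K :: nat assume K: "K \<ge> 1"
  have "real K * Min (a ` {1..K}) = (\<Sum>k=1..K. Min (a ` {1..K}))" by simp
  also have "\<dots> \<le> sum a {1..K}" by (intro sum_mono Min_le) auto
  also have "\<dots> = (\<Sum>k<K. a (Suc k))"
    by (metis One_nat_def sum.atLeast1_atMost_eq)
  also have "\<dots> \<le> (\<Sum>k. a (Suc k))" by (rule sum_le_suminf) (use assms in auto)
  finally show "Min (a ` {1..K}) \<le> (\<Sum>k. a (Suc k)) / real K"
    using K by (simp add: field_simps)
qed

lemma sum3_sq_le: "(a + b + c)\<^sup>2 \<le> 3 * (a\<^sup>2 + b\<^sup>2 + (c::real)\<^sup>2)"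
proof -
  have "0 \<le> (a - b)\<^sup>2 + (b - c)\<^sup>2 + (a - c)\<^sup>2" by simp
  then show ?thesis by (simp add: power2_eq_square algebra_simps)
qed

text \<open>A subsequence staying away from \<open>S\<close> would have a cluster point outside
  \<open>S\<close>. Nonemptiness is stated separately because \<open>infdist\<close> to the empty
  set is 0 by convention.\<close>

lemma infdist_tendsto_zero_of_cluster_points:
  fixes x :: "nat \<Rightarrow> 'a::euclidean_space"
  assumes bdd: "\<And>k. norm (x k) \<le> R"
    and cluster: "\<And>r y. strict_mono r \<Longrightarrow> (x \<circ> r) \<longlonglongrightarrow> y \<Longrightarrow> y \<in> S"
  shows "S \<noteq> {}" and "(\<lambda>k. infdist (x k) S) \<longlonglongrightarrow> 0"
proof -
  have sub: "\<exists>r y. strict_mono r \<and> ((x \<circ> q) \<circ> r) \<longlonglongrightarrow> y" for q :: "nat \<Rightarrow> nat"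
  proof -
    have "\<forall>n. (x \<circ> q) n \<in> cball 0 R" using bdd by simp
    then show ?thesis using compact_cball[of 0 R] unfolding compact_def by blast
  qed
  show "S \<noteq> {}" using sub[of id] cluster by (metis comp_id empty_iff)
  show "(\<lambda>k. infdist (x k) S) \<longlonglongrightarrow> 0"
  proof (rule ccontr)
    assume "\<not> ?thesis"
    then obtain e where e: "e > 0" "\<And>N. \<exists>k\<ge>N. infdist (x k) S \<ge> e"
      unfolding lim_sequentially dist_real_def
      by (metis abs_of_nonneg diff_zero infdist_nonneg linorder_not_less)
    define A where "A = {k. infdist (x k) S \<ge> e}"
    have "infinite A" unfolding infinite_nat_iff_unbounded_le A_def using e(2) by auto
    then obtain q :: "nat \<Rightarrow> nat" where q: "strict_mono q" "\<And>n. q n \<in> A"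
      using that[of "enumerate A"] strict_mono_enumerate enumerate_in_set by blast
    obtain r y where r: "strict_mono r" "((x \<circ> q) \<circ> r) \<longlonglongrightarrow> y" using sub by blast
    have "strict_mono (q \<circ> r)" using q r by (simp add: strict_mono_o)
    moreover have "(x \<circ> (q \<circ> r)) \<longlonglongrightarrow> y" using r(2) by (simp add: comp_assoc)
    ultimately have "y \<in> S" using cluster by blast
    then have "infdist y S = 0" by simp
    moreover have "(\<lambda>n. infdist ((x \<circ> (q \<circ> r)) n) S) \<longlonglongrightarrow> infdist y S"
      using \<open>(x \<circ> (q \<circ> r)) \<longlonglongrightarrow> y\<close> by (rule tendsto_infdist)
    moreover have "infdist ((x \<circ> (q \<circ> r)) n) S \<ge> e" for n
      using q(2)[of "r n"] by (simp add: A_def)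
    ultimately show False using e(1) LIMSEQ_le_const by fastforce
  qed
qed

text \<open>Where the potential is infinite this takes the default value 0, so inequalities for it
  are only stated on the range of the denoiser.\<close>

abbreviation pot :: "(real \<Rightarrow> 'a::euclidean_space \<Rightarrow> real) \<Rightarrow> real \<Rightarrow> 'a \<Rightarrow> real" where
  "pot g \<sigma> \<equiv> finite_part (potential g \<sigma>)"

section \<open>The potential on the range of the denoiser\<close>

locale proximal_denoiser =
  fixes g :: "real \<Rightarrow> 'a::euclidean_space \<Rightarrow> real" and \<sigma> :: real
  assumes lsc: "locally_strongly_convex (\<lambda>z. (norm z)\<^sup>2 / 2 - g \<sigma> z) (denoiser g \<sigma>)"
begin

sublocale locally_strongly_convex "\<lambda>z. (norm z)\<^sup>2 / 2 - g \<sigma> z" "denoiser g \<sigma>"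
  by (rule lsc)

text \<open>Equality in the Fenchel inequality with the square completed: \<open>g \<sigma>\<close>
  is the Moreau envelope of the potential, and \<open>denoiser g \<sigma> z\<close> attains it at
  \<open>z\<close>.\<close>

lemma potential_denoiser:
  "potential g \<sigma> (denoiser g \<sigma> z) = ereal (g \<sigma> z - (norm (denoiser g \<sigma> z - z))\<^sup>2 / 2)"
  unfolding potential_def fenchel_conjugate_D
  by (simp add: power2_norm_eq_inner inner_diff_left inner_diff_right inner_commute field_simps)

lemma pot_denoiser:
  "pot g \<sigma> (denoiser g \<sigma> z) = g \<sigma> z - (norm (denoiser g \<sigma> z - z))\<^sup>2 / 2"
  by (simp add: finite_part_def potential_denoiser)

text \<open>This is the tangent inequality at a preimage of \<open>x\<close>. The point
  \<open>z\<close> is free: choosing it as a preimage of \<open>x\<close> at another noise level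
  compares the two potentials.\<close>

lemma pot_ge:
  assumes "x \<in> range (denoiser g \<sigma>)"
  shows "pot g \<sigma> x \<ge> g \<sigma> z - (norm (x - z))\<^sup>2 / 2"
proof -
  obtain w where w: "x = denoiser g \<sigma> w" using assms by blast
  show ?thesis unfolding w pot_denoiser using above_tangent[of w z]
    by (simp add: power2_norm_eq_inner inner_diff_left inner_diff_right inner_commute field_simps)
qed

lemma pot_prox:
  assumes "x \<in> range (denoiser g \<sigma>)"
  shows "pot g \<sigma> (denoiser g \<sigma> z) + (norm (denoiser g \<sigma> z - z))\<^sup>2 / 2 \<le> pot g \<sigma> x + (norm (x - z))\<^sup>2 / 2"
  using pot_ge[OF assms, of z] by (simp add: pot_denoiser)

lemma range_subset_int_dom: "range (denoiser g \<sigma>) \<subseteq> int_dom (potential g \<sigma>)"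
  unfolding int_dom_def
  by (rule interior_maximal[OF _ open_range_D]) (auto simp: potential_denoiser)

lemma GDERIV_pot: "GDERIV (pot g \<sigma>) (denoiser g \<sigma> z) :> z - denoiser g \<sigma> z"
proof -
  let ?H = "\<lambda>x. real_of_ereal (fenchel_conjugate (\<lambda>z. (norm z)\<^sup>2 / 2 - g \<sigma> z) x)"
  have "GDERIV (\<lambda>x. ?H x - (norm x)\<^sup>2 / 2) (denoiser g \<sigma> z) :> z - denoiser g \<sigma> z"
    by (intro GDERIV_diff GDERIV_fenchel_conjugate GDERIV_half_norm_sq)
  moreover have "?H x - (norm x)\<^sup>2 / 2 = pot g \<sigma> x" if "x \<in> range (denoiser g \<sigma>)" for x
    using that by (auto simp: finite_part_def potential_def fenchel_conjugate_D)
  ultimately show ?thesis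
    unfolding gderiv_def
    using has_derivative_transform_within_open[OF _ open_range_D rangeI] by blast
qed

lemma objective_eq:
  assumes "x \<in> range (denoiser g \<sigma>)"
  shows "objective f g \<gamma> \<sigma> x = ereal (f x + 1 / \<gamma> * pot g \<sigma> x)"
  using assms by (auto simp: objective_def potential_denoiser pot_denoiser)

lemma GDERIV_objective:
  assumes "GDERIV f (denoiser g \<sigma> z) :> v"
  shows "GDERIV (finite_part (objective f g \<gamma> \<sigma>)) (denoiser g \<sigma> z) :>
    v + (1 / \<gamma>) *\<^sub>R (z - denoiser g \<sigma> z)"
proof -
  have "GDERIV (\<lambda>x. f x + 1 / \<gamma> * pot g \<sigma> x) (denoiser g \<sigma> z) :>
      v + (1 / \<gamma>) *\<^sub>R (z - denoiser g \<sigma> z)"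
    using has_derivative_add[OF assms[unfolded gderiv_def]
        has_derivative_mult_right[OF GDERIV_pot[of z, unfolded gderiv_def], of "1 / \<gamma>"]]
    unfolding gderiv_def by (simp add: inner_add_right)
  then show ?thesis
    unfolding gderiv_def
    by (rule has_derivative_transform_within_open[OF _ open_range_D rangeI])
      (auto simp: finite_part_def objective_eq)
qed

lemma range_subset_int_dom_objective: "range (denoiser g \<sigma>) \<subseteq> int_dom (objective f g \<gamma> \<sigma>)"
  unfolding int_dom_def
  by (rule interior_maximal[OF _ open_range_D]) (auto simp: objective_eq)

end

text \<open>The prox inequality is tested with the competitor \<open>x\<close> and added to the
  descent lemma for \<open>f\<close>, which leaves the coefficient
  \<open>(1 - \<gamma> * L) / 2\<close> on the squared step. Young's inequality spends half of it on
  the inner product of the noise with the step; hence the constants 1/4 and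
  \<open>1 / (1 - \<gamma> * L)\<close>.\<close>

lemma noisy_prox_gradient_descent:
  assumes "proximal_denoiser g \<sigma>"
    and "\<And>x. GDERIV f x :> Df x" "L-lipschitz_on UNIV Df" "\<gamma> > 0" "\<gamma> * L < 1"
    and x: "x \<in> range (denoiser g \<sigma>)"
    and x': "x' = denoiser g \<sigma> (x - \<gamma> *\<^sub>R Df x + \<xi>)"
  shows "\<gamma> * f x' + pot g \<sigma> x' + (1 - \<gamma> * L) / 4 * (norm (x' - x))\<^sup>2
    \<le> \<gamma> * f x + pot g \<sigma> x + 1 / (1 - \<gamma> * L) * (norm \<xi>)\<^sup>2"
proof -
  interpret proximal_denoiser g \<sigma> by fact
  define \<Delta> where "\<Delta> = x' - x"
  define \<beta> where "\<beta> = 1 - \<gamma> * L"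
  have \<beta>: "\<beta> > 0" using assms by (simp add: \<beta>_def)
  have "pot g \<sigma> x' + (norm (\<Delta> + (\<gamma> *\<^sub>R Df x - \<xi>)))\<^sup>2 / 2 \<le> pot g \<sigma> x + (norm (\<gamma> *\<^sub>R Df x - \<xi>))\<^sup>2 / 2"
    using pot_prox[OF x, of "x - \<gamma> *\<^sub>R Df x + \<xi>"] unfolding x'[symmetric] \<Delta>_def
    by (simp add: algebra_simps)
  then have p: "pot g \<sigma> x' + (norm \<Delta>)\<^sup>2 / 2 + \<gamma> * (Df x \<bullet> \<Delta>) \<le> pot g \<sigma> x + \<xi> \<bullet> \<Delta>"
    by (simp add: power2_norm_eq_inner inner_add_left inner_add_right inner_diff_left
        inner_diff_right inner_commute field_simps)
  have "\<gamma> * f x' \<le> \<gamma> * (f x + Df x \<bullet> \<Delta> + L / 2 * (norm \<Delta>)\<^sup>2)"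
    using GDERIV_Lipschitz_upper_bound[OF assms(2,3), of x' x] assms(4) unfolding \<Delta>_def by simp
  then have "\<gamma> * f x' + pot g \<sigma> x' + \<beta> / 2 * (norm \<Delta>)\<^sup>2 \<le> \<gamma> * f x + pot g \<sigma> x + \<xi> \<bullet> \<Delta>"
    using p by (simp add: \<beta>_def field_simps)
  moreover have "\<xi> \<bullet> \<Delta> \<le> \<beta> / 4 * (norm \<Delta>)\<^sup>2 + 1 / \<beta> * (norm \<xi>)\<^sup>2"
  proof -
    have "0 \<le> (norm (\<beta> *\<^sub>R \<Delta> - 2 *\<^sub>R \<xi>))\<^sup>2 / (4 * \<beta>)" using \<beta> by simp
    also have "\<dots> = \<beta> / 4 * (norm \<Delta>)\<^sup>2 + 1 / \<beta> * (norm \<xi>)\<^sup>2 - \<xi> \<bullet> \<Delta>"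
      using \<beta> by (simp add: power2_norm_eq_inner inner_diff_left inner_diff_right inner_commute
          field_simps)
    finally show ?thesis by simp
  qed
  ultimately show ?thesis unfolding \<beta>_def \<Delta>_def by (simp add: field_simps)
qed

section \<open>Annealed runs\<close>

text \<open>In the bounds on \<^term>\<open>pot g\<close>, \<open>c \<sigma>\<close> is a normalising constant that does not affect gradients.
  It is needed for the exact MMSE denoiser, where only the shifted potential is monotone in \<open>\<sigma>\<close>.\<close>

locale annealed_denoisers =
  fixes g :: "real \<Rightarrow> 'a::euclidean_space \<Rightarrow> real" and \<epsilon> \<sigma>\<^sub>0 :: real
    and c :: "real \<Rightarrow> real" and A :: real
  assumes gderiv_h: "\<sigma> \<in> {\<epsilon>..\<sigma>\<^sub>0} \<Longrightarrow> GDERIV (\<lambda>z. (norm z)\<^sup>2 / 2 - g \<sigma> z) z :> denoiser g \<sigma> z"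
    and continuous_denoiser: "\<sigma> \<in> {\<epsilon>..\<sigma>\<^sub>0} \<Longrightarrow> continuous_on UNIV (denoiser g \<sigma>)"
    and uniform_mono: "\<exists>m>0. \<forall>\<sigma>\<in>{\<epsilon>..\<sigma>\<^sub>0}. \<forall>z\<in>cball 0 R. \<forall>w\<in>cball 0 R.
      m * (norm (z - w))\<^sup>2 \<le> (denoiser g \<sigma> z - denoiser g \<sigma> w) \<bullet> (z - w)"
    and lipschitz_sigma: "\<exists>C\<ge>0. \<forall>\<sigma>\<in>{\<epsilon>..\<sigma>\<^sub>0}. \<forall>\<sigma>'\<in>{\<epsilon>..\<sigma>\<^sub>0}. \<forall>z\<in>cball 0 R.
      norm (denoiser g \<sigma> z - denoiser g \<sigma>' z) \<le> C * \<bar>\<sigma> - \<sigma>'\<bar>"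
    and range_mono: "\<epsilon> \<le> \<sigma>' \<Longrightarrow> \<sigma>' \<le> \<sigma> \<Longrightarrow> \<sigma> \<le> \<sigma>\<^sub>0 \<Longrightarrow> range (denoiser g \<sigma>) \<subseteq> range (denoiser g \<sigma>')"
    and A_nonneg: "A \<ge> 0"
    and pot_nonneg: "\<sigma> \<in> {\<epsilon>..\<sigma>\<^sub>0} \<Longrightarrow> x \<in> range (denoiser g \<sigma>) \<Longrightarrow> 0 \<le> pot g \<sigma> x + c \<sigma>"
    and pot_change: "\<epsilon> \<le> \<sigma>' \<Longrightarrow> \<sigma>' \<le> \<sigma> \<Longrightarrow> \<sigma> \<le> \<sigma>\<^sub>0 \<Longrightarrow> x \<in> range (denoiser g \<sigma>) \<Longrightarrow>
      (1 - A * (\<sigma> - \<sigma>')) * (pot g \<sigma>' x + c \<sigma>') \<le> pot g \<sigma> x + c \<sigma>"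
    and pot_bounded: "\<exists>R. \<forall>\<sigma>\<in>{\<epsilon>..\<sigma>\<^sub>0}. \<forall>x\<in>range (denoiser g \<sigma>). pot g \<sigma> x + c \<sigma> \<le> B \<longrightarrow> norm x \<le> R"
begin

lemma proximal: "\<sigma> \<in> {\<epsilon>..\<sigma>\<^sub>0} \<Longrightarrow> proximal_denoiser g \<sigma>"
  using gderiv_h continuous_denoiser uniform_mono
  by unfold_locales meson+

end

text \<open>A single sample path: \<open>\<xi>\<close> is the realised scaled noise and everything
  in this locale is deterministic.\<close>

locale annealed_run = annealed_denoisers g \<epsilon> \<sigma>\<^sub>0 c A
  for g :: "real \<Rightarrow> 'a::euclidean_space \<Rightarrow> real" and \<epsilon> \<sigma>\<^sub>0 c A +
  fixes f :: "'a \<Rightarrow> real" and Df :: "'a \<Rightarrow> 'a" and s :: "nat \<Rightarrow> real" and \<gamma> L :: real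
    and x \<xi> :: "nat \<Rightarrow> 'a"
  assumes gderiv_f: "GDERIV f v :> Df v"
    and lipschitz_Df: "L-lipschitz_on UNIV Df"
    and f_bdd: "bdd_below (range f)"
    and s_dec: "s (Suc k) \<le> s k" and s_lim: "s \<longlonglongrightarrow> \<epsilon>" and s_0: "s 0 = \<sigma>\<^sub>0"
    and gamma_pos: "\<gamma> > 0" and gamma_L: "\<gamma> * L < 1"
    and noise: "summable (\<lambda>k. (norm (\<xi> k))\<^sup>2)"
    and iter: "x (Suc k) = denoiser g (s k) (x k - \<gamma> *\<^sub>R Df (x k) + \<xi> k)"
begin

definition y :: "nat \<Rightarrow> 'a" where "y k = x k - \<gamma> *\<^sub>R Df (x k) + \<xi> k"

lemma x_Suc: "x (Suc k) = denoiser g (s k) (y k)"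
  by (simp add: iter y_def)

lemma s_decseq: "decseq s"
  by (simp add: decseq_Suc_iff s_dec)

lemma s_mem [simp]: "s k \<in> {\<epsilon>..\<sigma>\<^sub>0}"
  using decseq_ge[OF s_decseq s_lim, of k] s_decseq s_0 by (auto simp: decseq_def)

lemma s_ge [simp]: "\<epsilon> \<le> s k" and s_le [simp]: "s k \<le> \<sigma>\<^sub>0"
  using s_mem[of k] by auto

lemma eps_mem [simp]: "\<epsilon> \<in> {\<epsilon>..\<sigma>\<^sub>0}"
  using s_mem[of 0] by (auto simp: s_0)

text \<open>This is where the monotonicity of the noise levels enters: an iterate produced at level
  \<open>s k\<close> keeps a finite potential at each smaller level, in particular at
  \<open>s (Suc k)\<close> and \<open>\<epsilon>\<close>.\<close>

lemma x_Suc_mem: "\<epsilon> \<le> \<sigma> \<Longrightarrow> \<sigma> \<le> s k \<Longrightarrow> x (Suc k) \<in> range (denoiser g \<sigma>)"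
  using range_mono[of \<sigma> "s k"] s_mem[of k] by (auto simp: x_Suc)

lemma summable_s_diff: "summable (\<lambda>k. s k - s (Suc k))"
  using telescope_summable'[OF s_lim] .

lemma L_nonneg: "L \<ge> 0"
  using lipschitz_Df lipschitz_on_def by blast

lemma energy:
  shows "summable (\<lambda>k. (norm (x (Suc k) - x k))\<^sup>2)" and "\<exists>R. \<forall>k. norm (x k) \<le> R"
proof -
  define \<beta> where "\<beta> = 1 - \<gamma> * L"
  have \<beta>: "\<beta> > 0" using gamma_L by (simp add: \<beta>_def)
  define m where "m = Inf (range f)"
  have m: "f v \<ge> m" for v using f_bdd by (simp add: m_def cINF_lower)
  \<comment> \<open>The energy of \<open>x (Suc k)\<close> is measured at the level at which the
    next step is taken. The shift skips \<open>x 0\<close>, which need not lie in any range.\<close>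
  define V where "V k = \<gamma> * (f (x (Suc k)) - m) + (pot g (s (Suc k)) (x (Suc k)) + c (s (Suc k)))" for k
  define a where "a k = A * (s (Suc k) - s (Suc (Suc k)))" for k
  have mem: "x (Suc k) \<in> range (denoiser g (s (Suc k)))" "x (Suc k) \<in> range (denoiser g (s k))" for k
    using x_Suc_mem[of _ k] s_mem[of "Suc k"] s_mem[of k] s_dec[of k] by auto
  have V_ge: "V k \<ge> pot g (s (Suc k)) (x (Suc k)) + c (s (Suc k))" for k
    using m gamma_pos by (simp add: V_def)
  have a_nonneg: "a k \<ge> 0" for k
    using A_nonneg s_dec by (simp add: a_def)
  have step: "(1 - a k) * V (Suc k) + \<beta> / 4 * (norm (x (Suc (Suc k)) - x (Suc k)))\<^sup>2
      \<le> V k + 1 / \<beta> * (norm (\<xi> (Suc k)))\<^sup>2" for k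
  proof -
    let ?x = "x (Suc k)" and ?x' = "x (Suc (Suc k))" and ?s = "s (Suc k)" and ?s' = "s (Suc (Suc k))"
    have d: "\<gamma> * f ?x' + pot g ?s ?x' + \<beta> / 4 * (norm (?x' - ?x))\<^sup>2
        \<le> \<gamma> * f ?x + pot g ?s ?x + 1 / \<beta> * (norm (\<xi> (Suc k)))\<^sup>2"
      unfolding \<beta>_def
      by (rule noisy_prox_gradient_descent[OF proximal gderiv_f lipschitz_Df gamma_pos gamma_L])
        (use mem in \<open>auto simp: iter\<close>)
    have ch: "(1 - a k) * (pot g ?s' ?x' + c ?s') \<le> pot g ?s ?x' + c ?s"
      unfolding a_def using pot_change[OF _ s_dec _ mem(2)[of "Suc k"]] s_mem[of "Suc (Suc k)"] s_mem[of "Suc k"]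
      by auto
    \<comment> \<open>Only the potential pays for the change of level; subtracting the infimum
      \<open>m\<close> makes the \<open>f\<close> term nonnegative, so the common factor
      \<open>1 - a k\<close> can only lower it.\<close>
    have "(1 - a k) * (\<gamma> * (f ?x' - m)) \<le> 1 * (\<gamma> * (f ?x' - m))"
      using m[of ?x'] gamma_pos a_nonneg by (intro mult_right_mono) auto
    then have "(1 - a k) * V (Suc k) \<le> \<gamma> * (f ?x' - m) + (pot g ?s ?x' + c ?s)"
      using ch by (simp add: V_def distrib_left)
    then show ?thesis using d by (simp add: V_def algebra_simps)
  qed
  have rs: "summable (\<lambda>k. \<beta> / 4 * (norm (x (Suc (Suc k)) - x (Suc k)))\<^sup>2)" "\<exists>B. \<forall>k. V k \<le> B"
  proof (atomize (full), rule conjI)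
    have "V k \<ge> 0" for k
      using V_ge[of k] pot_nonneg[OF s_mem mem(1)[of k]] by simp
    moreover have "summable a"
      unfolding a_def using summable_s_diff by (intro summable_mult) (simp add: summable_iff_shift[of "\<lambda>k. s k - s (Suc k)" 1, simplified])
    moreover have "summable (\<lambda>k. 1 / \<beta> * (norm (\<xi> (Suc k)))\<^sup>2)"
      using noise by (intro summable_mult) (simp add: summable_Suc_iff[of "\<lambda>k. (norm (\<xi> k))\<^sup>2"])
    ultimately show "summable (\<lambda>k. \<beta> / 4 * (norm (x (Suc (Suc k)) - x (Suc k)))\<^sup>2)" "\<exists>B. \<forall>k. V k \<le> B"
      using robbins_siegmund_deterministic[of V a, OF _ a_nonneg _ _ _ _ step] \<beta> by auto
  qed
  then have "summable (\<lambda>k. (norm (x (Suc (Suc k)) - x (Suc k)))\<^sup>2)"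
    using \<beta> by (simp add: summable_cmult_iff)
  then show "summable (\<lambda>k. (norm (x (Suc k) - x k))\<^sup>2)"
    using summable_Suc_iff[of "\<lambda>k. (norm (x (Suc k) - x k))\<^sup>2"] by simp
  obtain B where B: "V k \<le> B" for k using rs by blast
  obtain R where R: "\<And>\<sigma> x. \<sigma> \<in> {\<epsilon>..\<sigma>\<^sub>0} \<Longrightarrow> x \<in> range (denoiser g \<sigma>) \<Longrightarrow> pot g \<sigma> x + c \<sigma> \<le> B \<Longrightarrow> norm x \<le> R"
    using pot_bounded[of B] by blast
  have "norm (x (Suc k)) \<le> R" for k
    using R[OF s_mem mem(1)[of k]] V_ge[of k] B[of k] by simp
  then have "norm (x k) \<le> max R (norm (x 0))" for k
    by (cases k) (auto simp: le_max_iff_disj)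
  then show "\<exists>R. \<forall>k. norm (x k) \<le> R" by blast
qed

lemma increments_tendsto_0: "(\<lambda>k. norm (x (Suc k) - x k)) \<longlonglongrightarrow> 0"
  using tendsto_real_sqrt[OF summable_LIMSEQ_zero[OF energy(1)]] by simp

lemma noise_tendsto_0: "(\<lambda>k. norm (\<xi> k)) \<longlonglongrightarrow> 0"
  using tendsto_real_sqrt[OF summable_LIMSEQ_zero[OF noise]] by simp

lemma y_bounded: "\<exists>R. \<forall>k. norm (y k) \<le> R"
proof -
  obtain R where R: "\<And>k. norm (x k) \<le> R" using energy(2) by blast
  obtain S where S: "\<And>k. norm (\<xi> k) \<le> S"
    using convergent_imp_Bseq[OF convergentI[OF noise_tendsto_0]] 
    by (metis BseqE real_norm_def abs_norm_cancel)
  have "norm (y k) \<le> R + \<gamma> * (norm (Df 0) + L * R) + S" for k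
  proof -
    have "norm (Df (x k)) \<le> norm (Df 0) + norm (Df (x k) - Df 0)"
      using norm_triangle_ineq[of "Df 0" "Df (x k) - Df 0"] by simp
    also have "norm (Df (x k) - Df 0) \<le> L * norm (x k)"
      using lipschitz_onD[OF lipschitz_Df, of "x k" 0] by (simp add: dist_norm)
    also have "L * norm (x k) \<le> L * R" using R L_nonneg by (rule mult_left_mono)
    finally have "norm (\<gamma> *\<^sub>R Df (x k)) \<le> \<gamma> * (norm (Df 0) + L * R)"
      using gamma_pos by simp
    moreover have "norm (y k) \<le> norm (x k) + norm (\<gamma> *\<^sub>R Df (x k)) + norm (\<xi> k)"
      unfolding y_def by (metis norm_triangle_ineq4 norm_triangle_le add_right_mono)
    ultimately show ?thesis using R[of k] S[of k] by linarith
  qed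
  then show ?thesis by blast
qed

text \<open>Since \<open>z\<close> at level \<open>\<sigma>\<close> and \<open>y k\<close> at level
  \<open>s k\<close> have the same image, the images of \<open>z\<close> and \<open>y k\<close> at
  level \<open>\<sigma>\<close> differ by the change of the denoiser at \<open>y k\<close> alone. So
  only \<open>y k\<close> must lie in a fixed ball; \<open>z\<close> is not known to be bounded yet,
  which \<open>inverse_modulus\<close> tolerates through its truncation.\<close>

lemma inverse_change:
  obtains C where "C \<ge> 0"
    and "\<And>\<sigma> k z. \<epsilon> \<le> \<sigma> \<Longrightarrow> \<sigma> \<le> s k \<Longrightarrow> denoiser g \<sigma> z = x (Suc k) \<Longrightarrow> min 1 (norm (z - y k)) \<le> C * (s k - \<sigma>)"
proof -
  obtain R where R: "\<And>k. norm (y k) \<le> R" using y_bounded by blast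
  obtain m where m: "m > 0" "\<forall>\<sigma>\<in>{\<epsilon>..\<sigma>\<^sub>0}. \<forall>z\<in>cball 0 (R + 1). \<forall>w\<in>cball 0 (R + 1).
      m * (norm (z - w))\<^sup>2 \<le> (denoiser g \<sigma> z - denoiser g \<sigma> w) \<bullet> (z - w)"
    using uniform_mono by blast
  obtain C where C: "C \<ge> 0" "\<forall>\<sigma>\<in>{\<epsilon>..\<sigma>\<^sub>0}. \<forall>\<sigma>'\<in>{\<epsilon>..\<sigma>\<^sub>0}. \<forall>z\<in>cball 0 R.
      norm (denoiser g \<sigma> z - denoiser g \<sigma>' z) \<le> C * \<bar>\<sigma> - \<sigma>'\<bar>"
    using lipschitz_sigma by blast
  show ?thesis
  proof (rule that[of "C / m"])
    fix \<sigma> k z assume \<sigma>: "\<epsilon> \<le> \<sigma>" "\<sigma> \<le> s k" and z: "denoiser g \<sigma> z = x (Suc k)"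
    have mem: "\<sigma> \<in> {\<epsilon>..\<sigma>\<^sub>0}" using \<sigma> order_trans[OF _ s_le] by auto
    interpret proximal_denoiser g \<sigma> using proximal[OF mem] .
    have "m * min 1 (norm (z - y k)) \<le> norm (denoiser g \<sigma> z - denoiser g \<sigma> (y k))"
      by (rule inverse_modulus[of "R + 1"]) (use m mem R[of k] in auto)
    also have "\<dots> = norm (denoiser g (s k) (y k) - denoiser g \<sigma> (y k))" by (simp add: z x_Suc)
    also have "\<dots> \<le> C * \<bar>s k - \<sigma>\<bar>" using C(2) mem s_mem[of k] R[of k] by simp
    finally show "min 1 (norm (z - y k)) \<le> C / m * (s k - \<sigma>)"
      using \<sigma> m(1) by (simp add: field_simps)
  qed (use C m in auto)
qed

lemma gradient_bound:
  assumes "\<epsilon> \<le> \<sigma>" "\<sigma> \<le> s k" and z: "denoiser g \<sigma> z = x (Suc k)"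
  shows "GDERIV (finite_part (objective f g \<gamma> \<sigma>)) (x (Suc k)) :> Df (x (Suc k)) + (1 / \<gamma>) *\<^sub>R (z - x (Suc k))"
    and "norm (Df (x (Suc k)) + (1 / \<gamma>) *\<^sub>R (z - x (Suc k)))
      \<le> (L + 1 / \<gamma>) * norm (x (Suc k) - x k) + 1 / \<gamma> * norm (\<xi> k) + 1 / \<gamma> * norm (z - y k)"
proof -
  have mem: "\<sigma> \<in> {\<epsilon>..\<sigma>\<^sub>0}" using assms order_trans[OF _ s_le] by auto
  interpret proximal_denoiser g \<sigma> using proximal[OF mem] .
  show "GDERIV (finite_part (objective f g \<gamma> \<sigma>)) (x (Suc k)) :> Df (x (Suc k)) + (1 / \<gamma>) *\<^sub>R (z - x (Suc k))"
    using GDERIV_objective[of f z "Df (x (Suc k))" \<gamma>] gderiv_f by (simp add: z)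
  \<comment> \<open>Replacing \<open>z\<close> by \<open>y k\<close> and inserting the definition of
    \<open>y k\<close> gives the prox optimality condition; the displacement \<open>z - y k\<close>
    is the error due to the change of level.\<close>
  have "Df (x (Suc k)) + (1 / \<gamma>) *\<^sub>R (z - x (Suc k)) = (Df (x (Suc k)) - Df (x k))
      - (1 / \<gamma>) *\<^sub>R (x (Suc k) - x k) + (1 / \<gamma>) *\<^sub>R \<xi> k + (1 / \<gamma>) *\<^sub>R (z - y k)"
    using gamma_pos by (simp add: y_def algebra_simps)
  also have "norm \<dots> \<le> norm (Df (x (Suc k)) - Df (x k)) + norm ((1 / \<gamma>) *\<^sub>R (x (Suc k) - x k))
      + norm ((1 / \<gamma>) *\<^sub>R \<xi> k) + norm ((1 / \<gamma>) *\<^sub>R (z - y k))"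
    by (meson norm_triangle_le norm_triangle_ineq4 add_right_mono order_trans norm_triangle_ineq)
  also have "\<dots> \<le> L * norm (x (Suc k) - x k) + norm ((1 / \<gamma>) *\<^sub>R (x (Suc k) - x k))
      + norm ((1 / \<gamma>) *\<^sub>R \<xi> k) + norm ((1 / \<gamma>) *\<^sub>R (z - y k))"
    using lipschitz_onD[OF lipschitz_Df, of "x (Suc k)" "x k"] by (simp add: dist_norm)
  finally show "norm (Df (x (Suc k)) + (1 / \<gamma>) *\<^sub>R (z - x (Suc k)))
      \<le> (L + 1 / \<gamma>) * norm (x (Suc k) - x k) + 1 / \<gamma> * norm (\<xi> k) + 1 / \<gamma> * norm (z - y k)"
    using gamma_pos by (simp add: distrib_right)
qed

text \<open>Guarantees that the gradients in the final statement are genuine and not arbitrary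
  values of the description operator in \<open>grad\<close>.\<close>

lemma iterate_regular:
  assumes "\<epsilon> \<le> \<sigma>" "\<sigma> \<le> s k"
  shows "x (Suc k) \<in> int_dom (potential g \<sigma>)"
    and "finite_part (objective f g \<gamma> \<sigma>) differentiable (at (x (Suc k)))"
proof -
  have mem: "\<sigma> \<in> {\<epsilon>..\<sigma>\<^sub>0}" using assms order_trans[OF _ s_le] by auto
  interpret proximal_denoiser g \<sigma> using proximal[OF mem] .
  have x: "x (Suc k) \<in> range (denoiser g \<sigma>)" using x_Suc_mem[OF assms] .
  then show "x (Suc k) \<in> int_dom (potential g \<sigma>)" using range_subset_int_dom by blast
  obtain z where "denoiser g \<sigma> z = x (Suc k)" using x by force
  then show "finite_part (objective f g \<gamma> \<sigma>) differentiable (at (x (Suc k)))"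
    using gradient_bound(1)[OF assms] by (auto simp: gderiv_def differentiable_def)
qed

section \<open>Decay of the objective gradients along the run\<close>

definition grad_at :: "real \<Rightarrow> nat \<Rightarrow> 'a" where
  "grad_at \<sigma> k = grad (finite_part (objective f g \<gamma> \<sigma>)) (x k)"

text \<open>The smallness condition rules out the value 1 of the truncated norm in
  \<open>inverse_change\<close>, so the bound there becomes a bound on the displacement
  itself.\<close>

lemma grad_at_bound:
  obtains C where "C \<ge> 0" and "\<And>\<sigma> k. \<epsilon> \<le> \<sigma> \<Longrightarrow> \<sigma> \<le> s k \<Longrightarrow> C * (s k - \<sigma>) < 1 \<Longrightarrow>
    norm (grad_at \<sigma> (Suc k)) \<le> (L + 1 / \<gamma>) * norm (x (Suc k) - x k) + 1 / \<gamma> * norm (\<xi> k) + 1 / \<gamma> * (C * (s k - \<sigma>))"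
proof -
  obtain C where C: "C \<ge> 0"
    "\<And>\<sigma> k z. \<epsilon> \<le> \<sigma> \<Longrightarrow> \<sigma> \<le> s k \<Longrightarrow> denoiser g \<sigma> z = x (Suc k) \<Longrightarrow> min 1 (norm (z - y k)) \<le> C * (s k - \<sigma>)"
    using inverse_change by blast
  show ?thesis
  proof (rule that[OF C(1)])
    fix \<sigma> k assume \<sigma>: "\<epsilon> \<le> \<sigma>" "\<sigma> \<le> s k" and small: "C * (s k - \<sigma>) < 1"
    obtain z where z: "denoiser g \<sigma> z = x (Suc k)" using x_Suc_mem[OF \<sigma>] by force
    have "min 1 (norm (z - y k)) \<le> C * (s k - \<sigma>)" using C(2)[OF \<sigma> z] .
    then have "norm (z - y k) \<le> C * (s k - \<sigma>)" using small by (simp add: min_def split: if_splits)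
    then have "1 / \<gamma> * norm (z - y k) \<le> 1 / \<gamma> * (C * (s k - \<sigma>))"
      using gamma_pos by (intro mult_left_mono) auto
    then show "norm (grad_at \<sigma> (Suc k)) \<le> (L + 1 / \<gamma>) * norm (x (Suc k) - x k) + 1 / \<gamma> * norm (\<xi> k) + 1 / \<gamma> * (C * (s k - \<sigma>))"
      using gradient_bound(2)[OF \<sigma> z] grad_eq[OF gradient_bound(1)[OF \<sigma> z]]
      by (simp add: grad_at_def)
  qed
qed

lemma gradient_tendsto_0: "(\<lambda>k. norm (grad_at \<epsilon> k)) \<longlonglongrightarrow> 0"
proof -
  obtain C where C: "C \<ge> 0" "\<And>\<sigma> k. \<epsilon> \<le> \<sigma> \<Longrightarrow> \<sigma> \<le> s k \<Longrightarrow> C * (s k - \<sigma>) < 1 \<Longrightarrow>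
    norm (grad_at \<sigma> (Suc k)) \<le> (L + 1 / \<gamma>) * norm (x (Suc k) - x k) + 1 / \<gamma> * norm (\<xi> k) + 1 / \<gamma> * (C * (s k - \<sigma>))"
    using grad_at_bound by blast
  have lim: "(\<lambda>k. C * (s k - \<epsilon>)) \<longlonglongrightarrow> 0"
    using tendsto_mult_left[OF tendsto_diff[OF s_lim tendsto_const[of \<epsilon>]], of C] by simp
  have "eventually (\<lambda>k. C * (s k - \<epsilon>) < 1) sequentially"
    using order_tendstoD(2)[OF lim, of 1] by simp
  then have ev: "eventually (\<lambda>k. norm (grad_at \<epsilon> (Suc k)) \<le>
      (L + 1 / \<gamma>) * norm (x (Suc k) - x k) + 1 / \<gamma> * norm (\<xi> k) + 1 / \<gamma> * (C * (s k - \<epsilon>))) sequentially"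
    by eventually_elim (use C(2)[of \<epsilon>] s_mem in auto)
  have "(\<lambda>k. (L + 1 / \<gamma>) * norm (x (Suc k) - x k) + 1 / \<gamma> * norm (\<xi> k) + 1 / \<gamma> * (C * (s k - \<epsilon>))) \<longlonglongrightarrow>
      (L + 1 / \<gamma>) * 0 + 1 / \<gamma> * 0 + 1 / \<gamma> * 0"
    by (intro tendsto_intros increments_tendsto_0 noise_tendsto_0 lim)
  then have "(\<lambda>k. norm (grad_at \<epsilon> (Suc k))) \<longlonglongrightarrow> 0"
    using tendsto_sandwich[OF _ ev tendsto_const[of 0]] by simp
  then show ?thesis by (rule LIMSEQ_imp_Suc)
qed

text \<open>At level \<open>s (Suc k)\<close> all three error terms have summable squares: the steps
  by the energy estimate, the noise by assumption, and the level gap because it is summable and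
  eventually below 1.\<close>

lemma gradient_rate: "\<exists>C. \<forall>K\<ge>1. Min ((\<lambda>k. (norm (grad_at (s k) k))\<^sup>2) ` {1..K}) \<le> C / real K"
proof (rule Min_le_of_summable)
  obtain C where C: "C \<ge> 0" "\<And>\<sigma> k. \<epsilon> \<le> \<sigma> \<Longrightarrow> \<sigma> \<le> s k \<Longrightarrow> C * (s k - \<sigma>) < 1 \<Longrightarrow>
    norm (grad_at \<sigma> (Suc k)) \<le> (L + 1 / \<gamma>) * norm (x (Suc k) - x k) + 1 / \<gamma> * norm (\<xi> k) + 1 / \<gamma> * (C * (s k - \<sigma>))"
    using grad_at_bound by blast
  define \<delta> where "\<delta> k = C * (s k - s (Suc k))" for k
  have sum_\<delta>: "summable \<delta>" unfolding \<delta>_def using summable_s_diff by (rule summable_mult)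
  have \<delta>_nonneg: "\<delta> k \<ge> 0" for k using C(1) s_dec by (simp add: \<delta>_def)
  have ev: "eventually (\<lambda>k. \<delta> k < 1) sequentially"
    using order_tendstoD(2)[OF summable_LIMSEQ_zero[OF sum_\<delta>], of 1] by simp
  have "summable (\<lambda>k. (\<delta> k)\<^sup>2)"
  proof (rule summable_comparison_test_ev[OF _ sum_\<delta>])
    show "eventually (\<lambda>k. norm ((\<delta> k)\<^sup>2) \<le> \<delta> k) sequentially"
      using ev by eventually_elim (use \<delta>_nonneg in \<open>auto simp: power2_eq_square intro: mult_left_le\<close>)
  qed
  then have sm: "summable (\<lambda>k. 3 * ((L + 1 / \<gamma>)\<^sup>2 * (norm (x (Suc k) - x k))\<^sup>2 + (1 / \<gamma>)\<^sup>2 * (norm (\<xi> k))\<^sup>2 + (1 / \<gamma>)\<^sup>2 * (\<delta> k)\<^sup>2))"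
    by (intro summable_mult summable_add energy(1) noise)
  show "summable (\<lambda>k. (norm (grad_at (s (Suc k)) (Suc k)))\<^sup>2)"
  proof (rule summable_comparison_test_ev[OF _ sm])
    show "eventually (\<lambda>k. norm ((norm (grad_at (s (Suc k)) (Suc k)))\<^sup>2) \<le>
      3 * ((L + 1 / \<gamma>)\<^sup>2 * (norm (x (Suc k) - x k))\<^sup>2 + (1 / \<gamma>)\<^sup>2 * (norm (\<xi> k))\<^sup>2 + (1 / \<gamma>)\<^sup>2 * (\<delta> k)\<^sup>2)) sequentially"
      using ev
    proof eventually_elim
      case (elim k)
      have "norm (grad_at (s (Suc k)) (Suc k)) \<le> (L + 1 / \<gamma>) * norm (x (Suc k) - x k) + 1 / \<gamma> * norm (\<xi> k) + 1 / \<gamma> * \<delta> k"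
        unfolding \<delta>_def by (rule C(2)) (use elim s_mem[of "Suc k"] s_dec[of k] in \<open>auto simp: \<delta>_def\<close>)
      then have "(norm (grad_at (s (Suc k)) (Suc k)))\<^sup>2 \<le>
          ((L + 1 / \<gamma>) * norm (x (Suc k) - x k) + 1 / \<gamma> * norm (\<xi> k) + 1 / \<gamma> * \<delta> k)\<^sup>2"
        by (intro power_mono) auto
      also have "\<dots> \<le> 3 * (((L + 1 / \<gamma>) * norm (x (Suc k) - x k))\<^sup>2 + (1 / \<gamma> * norm (\<xi> k))\<^sup>2 + (1 / \<gamma> * \<delta> k)\<^sup>2)"
        by (rule sum3_sq_le)
      finally show ?case by (simp add: power_mult_distrib power_divide)
    qed
  qed
qed simp

text \<open>If \<open>x (r n) \<longlonglongrightarrow> v\<close>, the denoiser inputs \<open>y (r n - 1)\<close> converge to \<open>v - \<gamma> *\<^sub>R Df v\<close>, so that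
  \<open>v\<close> is a fixed point of the noiseless iteration at level \<open>\<epsilon>\<close>.\<close>

lemma cluster_point_critical:
  assumes r: "strict_mono r" and lim: "(\<lambda>n. x (r n)) \<longlonglongrightarrow> v"
  shows "v \<in> crit (objective f g \<gamma> \<epsilon>)"
proof -
  interpret proximal_denoiser g \<epsilon> using proximal[OF eps_mem] .
  \<comment> \<open>The argument \<open>Suc n\<close> ensures that the index is positive, so the
    subtraction on naturals is exact and \<open>x (r (Suc n))\<close> is the output of a
    step.\<close>
  define q where "q n = r (Suc n) - 1" for n
  have q: "r (Suc n) = Suc (q n)" for n
    using strict_mono_imp_increasing[OF r, of "Suc n"] by (simp add: q_def)
  have "strict_mono q"
    unfolding strict_mono_Suc_iff
  proof
    fix n
    have "r (Suc n) < r (Suc (Suc n))" using r by (simp add: strict_mono_Suc_iff)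
    then show "q n < q (Suc n)" by (simp only: q Suc_less_eq)
  qed
  then have fq: "filterlim q sequentially sequentially" by (rule filterlim_subseq)
  have xS: "(\<lambda>n. x (Suc (q n))) \<longlonglongrightarrow> v"
    using LIMSEQ_Suc[OF lim] by (simp add: q)
  have "(\<lambda>k. x (Suc k) - x k) \<longlonglongrightarrow> 0" "\<xi> \<longlonglongrightarrow> 0"
    using increments_tendsto_0 noise_tendsto_0 by (auto simp: tendsto_norm_zero_iff)
  then have xd: "(\<lambda>n. x (Suc (q n)) - x (q n)) \<longlonglongrightarrow> 0" and \<xi>q: "(\<lambda>n. \<xi> (q n)) \<longlonglongrightarrow> 0"
    using filterlim_compose[OF _ fq] by auto
  then have xq: "(\<lambda>n. x (q n)) \<longlonglongrightarrow> v"
    using tendsto_diff[OF xS xd] by simp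
  have "isCont Df v"
    using lipschitz_on_continuous_on[OF lipschitz_Df] by (simp add: continuous_on_eq_continuous_at)
  then have "(\<lambda>n. Df (x (q n))) \<longlonglongrightarrow> Df v" using xq isCont_tendsto_compose by blast
  then have "(\<lambda>n. y (q n)) \<longlonglongrightarrow> v - \<gamma> *\<^sub>R Df v + 0"
    unfolding y_def by (intro tendsto_intros xq \<xi>q)
  moreover define w where "w = v - \<gamma> *\<^sub>R Df v"
  ultimately have yq: "(\<lambda>n. y (q n)) \<longlonglongrightarrow> w" by simp
  have "isCont (denoiser g \<epsilon>) w"
    using continuous_D by (simp add: continuous_on_eq_continuous_at)
  then have dq: "(\<lambda>n. denoiser g \<epsilon> (y (q n))) \<longlonglongrightarrow> denoiser g \<epsilon> w"
    using yq isCont_tendsto_compose by blast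
  obtain R where R: "\<And>k. norm (y k) \<le> R" using y_bounded by blast
  obtain C where C: "C \<ge> 0" "\<forall>\<sigma>\<in>{\<epsilon>..\<sigma>\<^sub>0}. \<forall>\<sigma>'\<in>{\<epsilon>..\<sigma>\<^sub>0}. \<forall>z\<in>cball 0 R.
      norm (denoiser g \<sigma> z - denoiser g \<sigma>' z) \<le> C * \<bar>\<sigma> - \<sigma>'\<bar>"
    using lipschitz_sigma by blast
  have "(\<lambda>k. C * \<bar>s k - \<epsilon>\<bar>) \<longlonglongrightarrow> C * \<bar>\<epsilon> - \<epsilon>\<bar>"
    by (intro tendsto_intros s_lim)
  then have lim0: "(\<lambda>k. C * \<bar>s k - \<epsilon>\<bar>) \<longlonglongrightarrow> 0" by simp
  have "norm (denoiser g (s k) (y k) - denoiser g \<epsilon> (y k)) \<le> C * \<bar>s k - \<epsilon>\<bar>" for k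
    by (rule C(2)[rule_format, OF s_mem eps_mem]) (use R in simp)
  then have "(\<lambda>k. denoiser g (s k) (y k) - denoiser g \<epsilon> (y k)) \<longlonglongrightarrow> 0"
    by (rule Lim_null_comparison[OF always_eventually[OF allI] lim0])
  then have "(\<lambda>n. x (Suc (q n)) - denoiser g \<epsilon> (y (q n))) \<longlonglongrightarrow> 0"
    using filterlim_compose[OF _ fq] by (auto simp: x_Suc)
  then have "(\<lambda>n. (x (Suc (q n)) - denoiser g \<epsilon> (y (q n))) + denoiser g \<epsilon> (y (q n))) \<longlonglongrightarrow> 0 + denoiser g \<epsilon> w"
    using dq by (rule tendsto_add)
  \<comment> \<open>The limit is itself an output of the denoiser at level
    \<open>\<epsilon>\<close>. Hence it lies in the open range and cannot be on the boundary of the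
    domain, where a gradient might not exist.\<close>
  then have v: "v = denoiser g \<epsilon> w"
    using LIMSEQ_unique[OF xS] by simp
  have "GDERIV (finite_part (objective f g \<gamma> \<epsilon>)) v :> Df v + (1 / \<gamma>) *\<^sub>R (w - v)"
    using GDERIV_objective[of f w "Df v" \<gamma>] gderiv_f v by simp
  then have "GDERIV (finite_part (objective f g \<gamma> \<epsilon>)) v :> 0"
    using gamma_pos by (simp add: w_def)
  moreover have "v \<in> int_dom (objective f g \<gamma> \<epsilon>)"
    using range_subset_int_dom_objective[of f \<gamma>] v by blast
  ultimately show ?thesis by (simp add: crit_def)
qed

lemma crit_nonempty_infdist:
  "crit (objective f g \<gamma> \<epsilon>) \<noteq> {}" "(\<lambda>k. infdist (x k) (crit (objective f g \<gamma> \<epsilon>))) \<longlonglongrightarrow> 0"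
proof -
  obtain R where R: "\<And>k. norm (x k) \<le> R" using energy(2) by blast
  show "crit (objective f g \<gamma> \<epsilon>) \<noteq> {}" "(\<lambda>k. infdist (x k) (crit (objective f g \<gamma> \<epsilon>))) \<longlonglongrightarrow> 0"
    using infdist_tendsto_zero_of_cluster_points[of x R] R cluster_point_critical
    unfolding comp_def by blast+
qed

end

section \<open>Families of denoisers: the contractive case\<close>

text \<open>The first component of the joint gradient is the gradient in \<open>x\<close>, the
  second the derivative in \<open>\<sigma>\<close>. The second derivative is bounded on the compact
  convex set of a ball times the level interval, so the mean value inequality gives a Lipschitz
  constant in \<open>\<sigma>\<close> uniform on the ball.\<close>

lemma C2_family:
  fixes g :: "real \<Rightarrow> 'a::euclidean_space \<Rightarrow> real"
  assumes C2: "C2_on (UNIV \<times> {0<..}) (\<lambda>(x, \<sigma>). g \<sigma> x)"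
  shows C2_family_GDERIV: "\<sigma> > 0 \<Longrightarrow> GDERIV (g \<sigma>) z :> grad (g \<sigma>) z"
    and C2_family_continuous_grad: "\<sigma> > 0 \<Longrightarrow> continuous_on UNIV (grad (g \<sigma>))"
    and C2_family_DERIV: "\<sigma> > 0 \<Longrightarrow> ((\<lambda>t. g t z) has_real_derivative deriv (\<lambda>t. g t z) \<sigma>) (at \<sigma>)"
    and C2_family_lipschitz: "\<epsilon> > 0 \<Longrightarrow> \<exists>C\<ge>0. \<forall>\<sigma>\<in>{\<epsilon>..\<sigma>\<^sub>0}. \<forall>\<sigma>'\<in>{\<epsilon>..\<sigma>\<^sub>0}. \<forall>z\<in>cball 0 R.
      norm (grad (g \<sigma>) z - grad (g \<sigma>') z) \<le> C * \<bar>\<sigma> - \<sigma>'\<bar>"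
proof -
  obtain G and H :: "'a \<times> real \<Rightarrow> ('a \<times> real) \<Rightarrow>\<^sub>L ('a \<times> real)"
    where GH: "\<forall>p\<in>UNIV \<times> {0<..}. GDERIV (\<lambda>(x, \<sigma>). g \<sigma> x) p :> G p"
        "\<forall>p\<in>UNIV \<times> {0<..}. (G has_derivative blinfun_apply (H p)) (at p)"
      and cont_H: "continuous_on (UNIV \<times> {0<..}) H"
    using C2 unfolding C2_on_def by blast
  have G: "GDERIV (\<lambda>(x, \<sigma>). g \<sigma> x) (z, \<sigma>) :> G (z, \<sigma>)"
    and H: "(G has_derivative blinfun_apply (H (z, \<sigma>))) (at (z, \<sigma>))" if "\<sigma> > 0" for z \<sigma>
    using GH that by auto
  have GD: "GDERIV (g \<sigma>) z :> fst (G (z, \<sigma>))" if "\<sigma> > 0" for z \<sigma>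
  proof -
    have "((\<lambda>x. (x, \<sigma>)) has_derivative (\<lambda>h. (h, 0))) (at z)"
      by (auto intro!: derivative_eq_intros)
    from has_derivative_compose[OF this G[OF that, unfolded gderiv_def]]
    show ?thesis by (simp add: gderiv_def inner_prod_def)
  qed
  then have gr: "grad (g \<sigma>) = (\<lambda>z. fst (G (z, \<sigma>)))" if "\<sigma> > 0" for \<sigma>
    using that grad_eq by blast
  show "GDERIV (g \<sigma>) z :> grad (g \<sigma>) z" if "\<sigma> > 0" for z \<sigma>
    using GD[OF that] gr[OF that] by simp
  show "continuous_on UNIV (grad (g \<sigma>))" if "\<sigma> > 0"
  proof -
    have "continuous_on (UNIV \<times> {0<..}) G"
      using H by (auto intro!: continuous_at_imp_continuous_on has_derivative_continuous)
    then have "continuous_on UNIV (\<lambda>z. G (z, \<sigma>))"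
      by (rule continuous_on_compose2) (use that in \<open>auto intro!: continuous_intros\<close>)
    then show ?thesis unfolding gr[OF that] by (rule continuous_on_fst)
  qed
  show "((\<lambda>t. g t z) has_real_derivative deriv (\<lambda>t. g t z) \<sigma>) (at \<sigma>)" if "\<sigma> > 0"
  proof -
    have "((\<lambda>t. (z, t)) has_derivative (\<lambda>h. (0, h))) (at \<sigma>)"
      by (auto intro!: derivative_eq_intros)
    from has_derivative_compose[OF this G[OF that, unfolded gderiv_def]]
    have "((\<lambda>t. g t z) has_real_derivative snd (G (z, \<sigma>))) (at \<sigma>)"
      by (simp add: has_field_derivative_def inner_prod_def mult_commute_abs)
    then show ?thesis using DERIV_imp_deriv by force
  qed
  show "\<exists>C\<ge>0. \<forall>\<sigma>\<in>{\<epsilon>..\<sigma>\<^sub>0}. \<forall>\<sigma>'\<in>{\<epsilon>..\<sigma>\<^sub>0}. \<forall>z\<in>cball 0 R.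
      norm (grad (g \<sigma>) z - grad (g \<sigma>') z) \<le> C * \<bar>\<sigma> - \<sigma>'\<bar>" if "\<epsilon> > 0"
  proof -
    let ?S = "cball (0::'a) R \<times> {\<epsilon>..\<sigma>\<^sub>0}"
    have sub: "?S \<subseteq> UNIV \<times> {0<..}" using that by auto
    have "compact (H ` ?S)"
      by (intro compact_continuous_image compact_Times compact_cball compact_Icc
          continuous_on_subset[OF cont_H sub])
    then obtain C where C: "C > 0" "\<And>p. p \<in> ?S \<Longrightarrow> norm (H p) \<le> C"
      using compact_imp_bounded bounded_pos by (metis imageI)
    have "norm (grad (g \<sigma>) z - grad (g \<sigma>') z) \<le> C * \<bar>\<sigma> - \<sigma>'\<bar>"
      if s: "\<sigma> \<in> {\<epsilon>..\<sigma>\<^sub>0}" "\<sigma>' \<in> {\<epsilon>..\<sigma>\<^sub>0}" "z \<in> cball 0 R" for \<sigma> \<sigma>' z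
    proof -
      have pos: "\<sigma> > 0" "\<sigma>' > 0" using s \<open>\<epsilon> > 0\<close> by auto
      have "norm (G (z, \<sigma>) - G (z, \<sigma>')) \<le> C * norm ((z, \<sigma>) - (z, \<sigma>'))"
      proof (rule differentiable_bound[where S = ?S and f' = "\<lambda>p. blinfun_apply (H p)"])
        show "convex ?S" by (intro convex_Times convex_cball convex_real_interval)
        fix p assume p: "p \<in> ?S"
        then show "(G has_derivative blinfun_apply (H p)) (at p within ?S)"
          using H[of "snd p" "fst p"] \<open>\<epsilon> > 0\<close> by (auto intro: has_derivative_at_withinI)
        show "onorm (blinfun_apply (H p)) \<le> C" using C(2)[OF p] by (simp add: norm_blinfun.rep_eq)
      qed (use s in auto)
      moreover have "norm (fst (G (z, \<sigma>) - G (z, \<sigma>'))) \<le> norm (G (z, \<sigma>) - G (z, \<sigma>'))"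
        using norm_fst_le[of "fst (G (z, \<sigma>) - G (z, \<sigma>'))" "snd (G (z, \<sigma>) - G (z, \<sigma>'))"]
        unfolding prod.collapse .
      ultimately show ?thesis by (simp add: gr pos)
    qed
    then show ?thesis using C(1) by (intro exI[of _ C]) auto
  qed
qed

lemma denoiser_GDERIV:
  assumes "GDERIV (g \<sigma>) z :> grad (g \<sigma>) z"
  shows "GDERIV (\<lambda>z. (norm z)\<^sup>2 / 2 - g \<sigma> z) z :> denoiser g \<sigma> z"
  unfolding denoiser_def by (intro GDERIV_diff GDERIV_half_norm_sq assms)

text \<open>The derivative of \<open>g\<close> in \<open>\<sigma>\<close> and the potential both
  have quadratic size, so a change of level costs only a relative error. All ranges are the whole
  space by Banach's fixed point theorem.\<close>

lemma annealed_denoisers_of_contractive: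
  fixes g :: "real \<Rightarrow> 'a::euclidean_space \<Rightarrow> real"
  assumes C2: "C2_on (UNIV \<times> {0<..}) (\<lambda>(x, \<sigma>). g \<sigma> x)"
    and eps: "0 < \<epsilon>" "\<epsilon> \<le> \<sigma>\<^sub>0"
    and pos: "c\<^sub>0 > 0" "M > 0"
    and coercive: "\<And>x \<sigma>. \<sigma> \<in> {\<epsilon>..\<sigma>\<^sub>0} \<Longrightarrow> g \<sigma> x \<ge> c\<^sub>0 * (norm x)\<^sup>2 - C\<^sub>0"
    and deriv_bound: "\<And>x \<sigma>. \<sigma> \<in> {\<epsilon>..\<sigma>\<^sub>0} \<Longrightarrow> \<bar>deriv (\<lambda>t. g t x) \<sigma>\<bar> \<le> M * (1 + (norm x)\<^sup>2)"
    and rho: "\<rho> < 1" "\<And>\<sigma>. \<sigma> \<in> {\<epsilon>..\<sigma>\<^sub>0} \<Longrightarrow> \<rho>-lipschitz_on UNIV (grad (g \<sigma>))"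
  shows "\<exists>c A. annealed_denoisers g \<epsilon> \<sigma>\<^sub>0 c A"
proof -
  let ?D = "denoiser g"
  have p: "\<sigma> > 0" if "\<sigma> \<in> {\<epsilon>..\<sigma>\<^sub>0}" for \<sigma> using that eps by auto
  have rho0: "\<rho> \<ge> 0" using rho(2)[of \<epsilon>] eps lipschitz_on_def by auto
  have lip: "norm (grad (g \<sigma>) z - grad (g \<sigma>) w) \<le> \<rho> * norm (z - w)" if "\<sigma> \<in> {\<epsilon>..\<sigma>\<^sub>0}" for \<sigma> z w
    using lipschitz_onD[OF rho(2)[OF that], of z w] by (simp add: dist_norm)
  have gd: "GDERIV (\<lambda>z. (norm z)\<^sup>2 / 2 - g \<sigma> z) z :> ?D \<sigma> z" if "\<sigma> \<in> {\<epsilon>..\<sigma>\<^sub>0}" for \<sigma> z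
    by (rule denoiser_GDERIV C2_family_GDERIV[OF C2 p[OF that]])+
  have cont: "continuous_on UNIV (?D \<sigma>)" if "\<sigma> \<in> {\<epsilon>..\<sigma>\<^sub>0}" for \<sigma>
    unfolding denoiser_def by (intro continuous_intros C2_family_continuous_grad[OF C2 p[OF that]])
  have mono: "(1 - \<rho>) * (norm (z - w))\<^sup>2 \<le> (?D \<sigma> z - ?D \<sigma> w) \<bullet> (z - w)"
    if "\<sigma> \<in> {\<epsilon>..\<sigma>\<^sub>0}" for \<sigma> z w
  proof -
    have "(grad (g \<sigma>) z - grad (g \<sigma>) w) \<bullet> (z - w) \<le> norm (grad (g \<sigma>) z - grad (g \<sigma>) w) * norm (z - w)"
      by (rule norm_cauchy_schwarz)
    also have "\<dots> \<le> \<rho> * norm (z - w) * norm (z - w)"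
      using lip[OF that] by (intro mult_right_mono) auto
    finally have "(grad (g \<sigma>) z - grad (g \<sigma>) w) \<bullet> (z - w) \<le> \<rho> * (norm (z - w))\<^sup>2"
      by (simp add: power2_eq_square)
    moreover have "(?D \<sigma> z - ?D \<sigma> w) \<bullet> (z - w) =
        (norm (z - w))\<^sup>2 - (grad (g \<sigma>) z - grad (g \<sigma>) w) \<bullet> (z - w)"
      by (simp add: denoiser_def power2_norm_eq_inner algebra_simps)
    ultimately show ?thesis by (simp add: algebra_simps)
  qed
  have umono: "\<exists>m>0. \<forall>\<sigma>\<in>{\<epsilon>..\<sigma>\<^sub>0}. \<forall>z\<in>cball 0 R. \<forall>w\<in>cball 0 R.
      m * (norm (z - w))\<^sup>2 \<le> (?D \<sigma> z - ?D \<sigma> w) \<bullet> (z - w)" for R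
    using rho(1) mono by (intro exI[of _ "1 - \<rho>"]) auto
  have surj: "range (?D \<sigma>) = UNIV" if s: "\<sigma> \<in> {\<epsilon>..\<sigma>\<^sub>0}" for \<sigma>
  proof -
    have "\<exists>z. ?D \<sigma> z = x" for x
    proof -
      have "\<exists>!z. x + grad (g \<sigma>) z = z"
        by (rule banach_fix_type[OF rho0 rho(1)]) (use lip[OF s] in \<open>auto simp: dist_norm\<close>)
      then obtain z where "x + grad (g \<sigma>) z = z" by blast
      then have "?D \<sigma> z = x" by (simp add: denoiser_def algebra_simps)
      then show ?thesis ..
    qed
    then show ?thesis by (metis surj_def)
  qed
  have lsig: "\<exists>C\<ge>0. \<forall>\<sigma>\<in>{\<epsilon>..\<sigma>\<^sub>0}. \<forall>\<sigma>'\<in>{\<epsilon>..\<sigma>\<^sub>0}. \<forall>z\<in>cball 0 R.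
      norm (?D \<sigma> z - ?D \<sigma>' z) \<le> C * \<bar>\<sigma> - \<sigma>'\<bar>" for R
  proof -
    have "norm (?D \<sigma> z - ?D \<sigma>' z) = norm (grad (g \<sigma>) z - grad (g \<sigma>') z)" for \<sigma> \<sigma>' z
      by (simp add: denoiser_def norm_minus_commute)
    then show ?thesis using C2_family_lipschitz[OF C2 eps(1), of \<sigma>\<^sub>0 R] by simp
  qed
  have prox: "proximal_denoiser g \<sigma>" if s: "\<sigma> \<in> {\<epsilon>..\<sigma>\<^sub>0}" for \<sigma>
    by unfold_locales (use gd[OF s] cont[OF s] umono s in \<open>meson\<close>)+
  \<comment> \<open>Taking \<open>z = x\<close> in \<open>pot_ge\<close> bounds the potential below
    by \<open>g \<sigma> x\<close>. The shift exceeds \<open>C\<^sub>0\<close> by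
    \<open>c\<^sub>0\<close> so that the bound has the form \<open>1 + (norm x)\<^sup>2\<close> of
    the derivative hypothesis.\<close>
  have low: "c\<^sub>0 * (1 + (norm x)\<^sup>2) \<le> pot g \<sigma> x + (C\<^sub>0 + c\<^sub>0)" if s: "\<sigma> \<in> {\<epsilon>..\<sigma>\<^sub>0}" for \<sigma> x
    using proximal_denoiser.pot_ge[OF prox[OF s], of x x] surj[OF s] coercive[OF s, of x]
    by (simp add: algebra_simps)
  obtain N where N: "N \<ge> 0" "\<And>\<sigma>. \<sigma> \<in> {\<epsilon>..\<sigma>\<^sub>0} \<Longrightarrow> norm (?D \<sigma> 0) \<le> N"
  proof -
    obtain C where C: "C \<ge> 0" "\<forall>\<sigma>\<in>{\<epsilon>..\<sigma>\<^sub>0}. \<forall>\<sigma>'\<in>{\<epsilon>..\<sigma>\<^sub>0}. \<forall>z\<in>cball 0 0.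
      norm (?D \<sigma> z - ?D \<sigma>' z) \<le> C * \<bar>\<sigma> - \<sigma>'\<bar>"
      using lsig[of 0] by blast
    have "norm (?D \<sigma> 0) \<le> C * (\<sigma>\<^sub>0 - \<epsilon>) + norm (?D \<epsilon> 0)" if s: "\<sigma> \<in> {\<epsilon>..\<sigma>\<^sub>0}" for \<sigma>
    proof -
      have "norm (?D \<sigma> 0 - ?D \<epsilon> 0) \<le> C * \<bar>\<sigma> - \<epsilon>\<bar>"
        by (rule C(2)[rule_format]) (use s eps in auto)
      also have "\<dots> \<le> C * (\<sigma>\<^sub>0 - \<epsilon>)" using C(1) s by (intro mult_left_mono) auto
      finally show ?thesis using norm_triangle_sub[of "?D \<sigma> 0" "?D \<epsilon> 0"] by simp
    qed
    then show ?thesis using that[of "C * (\<sigma>\<^sub>0 - \<epsilon>) + norm (?D \<epsilon> 0)"] C(1) eps by simp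
  qed
  \<comment> \<open>Comes from squaring
    \<open>(1 - \<rho>) * norm z \<le> norm (?D \<sigma> z) + N\<close>, which is strong
    monotonicity tested at \<open>z\<close> and 0.\<close>
  define K where "K = 1 + 2 * (1 + N\<^sup>2) / (1 - \<rho>)\<^sup>2"
  have K: "1 + (norm z)\<^sup>2 \<le> K * (1 + (norm (?D \<sigma> z))\<^sup>2)" if s: "\<sigma> \<in> {\<epsilon>..\<sigma>\<^sub>0}" for \<sigma> z
  proof -
    let ?x = "?D \<sigma> z"
    have q: "(1 - \<rho>)\<^sup>2 > 0" using rho(1) by simp
    have "(1 - \<rho>) * norm z \<le> norm (?x - ?D \<sigma> 0)"
    proof (cases "z = 0")
      case False
      have "(1 - \<rho>) * (norm z)\<^sup>2 \<le> norm (?x - ?D \<sigma> 0) * norm z"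
        using order_trans[OF mono[OF s, of z 0] norm_cauchy_schwarz] by simp
      then show ?thesis using False by (simp add: power2_eq_square)
    qed simp
    also have "\<dots> \<le> norm ?x + N" using N(2)[OF s] norm_triangle_ineq4[of ?x "?D \<sigma> 0"] by simp
    finally have "((1 - \<rho>) * norm z)\<^sup>2 \<le> (norm ?x + N)\<^sup>2"
      using rho(1) by (intro power_mono) auto
    also have "\<dots> \<le> 2 * ((norm ?x)\<^sup>2 + N\<^sup>2)"
      using sum_squares_bound[of "norm ?x" N] by (simp add: power2_sum)
    also have "\<dots> \<le> 2 * (1 + N\<^sup>2) * (1 + (norm ?x)\<^sup>2)"
      by (simp add: algebra_simps)
    finally have "(norm z)\<^sup>2 \<le> 2 * (1 + N\<^sup>2) * (1 + (norm ?x)\<^sup>2) / (1 - \<rho>)\<^sup>2"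
      using q by (simp add: pos_le_divide_eq power_mult_distrib mult.commute)
    then show ?thesis by (simp add: K_def distrib_right add_increasing)
  qed
  have K_ge: "K \<ge> 0" unfolding K_def by (intro add_nonneg_nonneg divide_nonneg_nonneg) auto
  \<comment> \<open>\<open>M\<close> bounds the change of \<open>g\<close> at the preimage,
    \<open>K\<close> passes from the preimage to \<open>x\<close>, and \<open>1 / c\<^sub>0\<close>
    passes from \<open>x\<close> to the shifted potential.\<close>
  define A where "A = M * K / c\<^sub>0"
  have change: "(1 - A * (\<sigma> - \<sigma>')) * (pot g \<sigma>' x + (C\<^sub>0 + c\<^sub>0)) \<le> pot g \<sigma> x + (C\<^sub>0 + c\<^sub>0)"
    if s: "\<epsilon> \<le> \<sigma>'" "\<sigma>' \<le> \<sigma>" "\<sigma> \<le> \<sigma>\<^sub>0" for \<sigma> \<sigma>' x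
  proof -
    have mem: "\<sigma> \<in> {\<epsilon>..\<sigma>\<^sub>0}" "\<sigma>' \<in> {\<epsilon>..\<sigma>\<^sub>0}" using s by auto
    \<comment> \<open>With the preimage taken at the smaller level, the potential there is exact and
      the one at \<open>\<sigma>\<close> is bounded below with the same \<open>z\<close>; the
      quadratic terms cancel.\<close>
    obtain z where z: "x = ?D \<sigma>' z" using surj[OF mem(2)] by blast
    have "g \<sigma>' z - g \<sigma> z \<le> M * (1 + (norm z)\<^sup>2) * (\<sigma> - \<sigma>')"
    proof (cases "\<sigma>' = \<sigma>")
      case False
      then have "\<sigma>' < \<sigma>" using s by simp
      then obtain \<xi> where \<xi>: "\<sigma>' < \<xi>" "\<xi> < \<sigma>" "g \<sigma> z - g \<sigma>' z = (\<sigma> - \<sigma>') * deriv (\<lambda>t. g t z) \<xi>"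
        using MVT2[of \<sigma>' \<sigma> "\<lambda>t. g t z" "\<lambda>t. deriv (\<lambda>t. g t z) t"] C2_family_DERIV[OF C2] s eps
        by (metis order_less_le_trans order_trans)
      have "\<bar>deriv (\<lambda>t. g t z) \<xi>\<bar> \<le> M * (1 + (norm z)\<^sup>2)"
        by (rule deriv_bound) (use \<xi> s in auto)
      then have "(\<sigma> - \<sigma>') * (- deriv (\<lambda>t. g t z) \<xi>) \<le> (\<sigma> - \<sigma>') * (M * (1 + (norm z)\<^sup>2))"
        using s by (intro mult_left_mono) auto
      then show ?thesis using \<xi>(3) by (simp add: algebra_simps)
    qed simp
    moreover have "pot g \<sigma>' x = g \<sigma>' z - (norm (x - z))\<^sup>2 / 2"
      unfolding z by (rule proximal_denoiser.pot_denoiser[OF prox[OF mem(2)]])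
    moreover have "pot g \<sigma> x \<ge> g \<sigma> z - (norm (x - z))\<^sup>2 / 2"
      using proximal_denoiser.pot_ge[OF prox[OF mem(1)]] surj[OF mem(1)] by blast
    ultimately have "pot g \<sigma>' x - pot g \<sigma> x \<le> M * (1 + (norm z)\<^sup>2) * (\<sigma> - \<sigma>')" by linarith
    also have "\<dots> \<le> M * (K * (1 + (norm x)\<^sup>2)) * (\<sigma> - \<sigma>')"
      using K[OF mem(2), of z] pos s unfolding z by (intro mult_right_mono mult_left_mono) auto
    also have "\<dots> = A * (\<sigma> - \<sigma>') * (c\<^sub>0 * (1 + (norm x)\<^sup>2))"
      using pos by (simp add: A_def)
    also have "\<dots> \<le> A * (\<sigma> - \<sigma>') * (pot g \<sigma>' x + (C\<^sub>0 + c\<^sub>0))"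
      using low[OF mem(2), of x] pos s K_ge by (intro mult_left_mono) (auto simp: A_def)
    finally show ?thesis by (simp add: algebra_simps)
  qed
  have bnd: "\<exists>R. \<forall>\<sigma>\<in>{\<epsilon>..\<sigma>\<^sub>0}. \<forall>x\<in>range (?D \<sigma>). pot g \<sigma> x + (C\<^sub>0 + c\<^sub>0) \<le> B \<longrightarrow> norm x \<le> R" for B
  proof (intro exI ballI impI)
    fix \<sigma> x assume "\<sigma> \<in> {\<epsilon>..\<sigma>\<^sub>0}" "pot g \<sigma> x + (C\<^sub>0 + c\<^sub>0) \<le> B"
    then have "c\<^sub>0 * (1 + (norm x)\<^sup>2) \<le> B" using low[of \<sigma> x] by linarith
    then have "1 + (norm x)\<^sup>2 \<le> B / c\<^sub>0" using pos by (simp add: field_simps)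
    moreover have "norm x \<le> 1 + (norm x)\<^sup>2"
      using sum_squares_bound[of "norm x" 1, simplified] norm_ge_zero[of x] by linarith
    ultimately show "norm x \<le> B / c\<^sub>0" by linarith
  qed
  have "annealed_denoisers g \<epsilon> \<sigma>\<^sub>0 (\<lambda>_. C\<^sub>0 + c\<^sub>0) A"
  proof
    show "0 \<le> pot g \<sigma> x + (C\<^sub>0 + c\<^sub>0)" if "\<sigma> \<in> {\<epsilon>..\<sigma>\<^sub>0}" for \<sigma> x
    proof -
      have "0 \<le> c\<^sub>0 * (1 + (norm x)\<^sup>2)" using pos by (intro mult_nonneg_nonneg) auto
      then show ?thesis using low[OF that, of x] by linarith
    qed
    show "0 \<le> A" using K_ge pos by (simp add: A_def)
    show "range (?D \<sigma>) \<subseteq> range (?D \<sigma>')" if "\<epsilon> \<le> \<sigma>'" "\<sigma>' \<le> \<sigma>" "\<sigma> \<le> \<sigma>\<^sub>0" for \<sigma> \<sigma>'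
      using surj[of \<sigma>'] that by auto
    show "(1 - A * (\<sigma> - \<sigma>')) * (pot g \<sigma>' x + (C\<^sub>0 + c\<^sub>0)) \<le> pot g \<sigma> x + (C\<^sub>0 + c\<^sub>0)"
      if "\<epsilon> \<le> \<sigma>'" "\<sigma>' \<le> \<sigma>" "\<sigma> \<le> \<sigma>\<^sub>0" for \<sigma> \<sigma>' x
      using change[OF that] .
  qed (fact gd cont umono lsig bnd)+
  then show ?thesis by blast
qed

section \<open>Exponential tilting of a bounded prior\<close>

text \<open>The Lagrange remainder of second order is \<open>exp t / 2 * b\<^sup>2\<close> with
  \<open>t\<close> no smaller than \<open>- \<beta>\<close>.\<close>

lemma exp_ge_quadratic:
  fixes b :: real
  assumes "\<bar>b\<bar> \<le> \<beta>"
  shows "exp b \<ge> 1 + b + exp (- \<beta>) / 2 * b\<^sup>2"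
proof -
  obtain t where t: "\<bar>t\<bar> \<le> \<bar>b\<bar>" "exp b = (\<Sum>m<2. b ^ m / fact m) + exp t / fact 2 * b ^ 2"
    using Maclaurin_exp_le[of b 2] by blast
  have "exp (- \<beta>) \<le> exp t" using t(1) assms by simp
  then have "exp (- \<beta>) / 2 * b\<^sup>2 \<le> exp t / 2 * b\<^sup>2" by (intro mult_right_mono) auto
  then show ?thesis using t(2) by (simp add: numeral_2_eq_2)
qed

lemma ln_one_plus_ge: "ln (1 + t) \<ge> t / (1 + t)" if "t \<ge> 0" for t :: real
proof -
  have "ln (1 / (1 + t)) \<le> 1 / (1 + t) - 1" using that by (intro ln_le_minus_one) simp
  then show ?thesis using that by (simp add: ln_div field_simps)
qed

text \<open>Bernoulli's inequality for the real power \<open>r\<close> of \<open>exp w\<close>; it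
  replaces Jensen's inequality in the comparison of power means.\<close>

lemma exp_mult_ge_tangent:
  fixes r w :: real
  assumes "r \<ge> 1"
  shows "exp (r * w) \<ge> 1 + r * (exp w - 1)"
proof -
  have "exp w * exp ((r - 1) * w) \<ge> exp w * (1 + (r - 1) * w)"
    by (intro mult_left_mono exp_ge_add_one_self) auto
  moreover have "exp w * exp ((r - 1) * w) = exp (r * w)"
    by (simp add: algebra_simps flip: exp_add)
  moreover have "(r - 1) * (exp w * w) \<ge> (r - 1) * (exp w - 1)"
  proof -
    have "exp w * (1 - w) \<le> exp w * exp (- w)"
      using exp_ge_add_one_self[of "- w"] by (intro mult_left_mono) auto
    then have "exp w * w \<ge> exp w - 1" by (simp add: algebra_simps flip: exp_add)
    then show ?thesis using assms by (intro mult_left_mono) auto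
  qed
  ultimately show ?thesis by (simp add: algebra_simps)
qed

lemma (in prob_space) integrable_AE_bounded:
  fixes \<phi> :: "'a \<Rightarrow> real"
  assumes "AE x in M. \<bar>\<phi> x\<bar> \<le> B" and "\<phi> \<in> borel_measurable M"
  shows "integrable M \<phi>"
  using integrable_const_bound[of \<phi> B] assms by simp

section \<open>Log-partition functions of a bounded nondegenerate prior\<close>

locale bounded_prior = prob_space P for P :: "'a::euclidean_space measure" +
  fixes R :: real
  assumes sets_P [measurable_cong]: "sets P = sets borel"
    and bounded: "AE x in P. norm x \<le> R"
    and nondegenerate: "a \<noteq> 0 \<Longrightarrow> \<not> (AE x in P. a \<bullet> x = b)"
begin

lemma R_nonneg: "R \<ge> 0"
proof (rule ccontr)
  assume "\<not> R \<ge> 0"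
  have "AE x in P. False"
    using bounded
  proof eventually_elim
    case (elim x) then show ?case using norm_ge_zero[of x] \<open>\<not> R \<ge> 0\<close> by linarith
  qed
  then show False by simp
qed

lemma space_P: "space P = UNIV"
  using sets_eq_imp_space_eq[OF sets_P] by simp

text \<open>For \<open>s = 1 / \<sigma>\<^sup>2\<close> this is the Gaussian likelihood of
  \<open>x\<close> given the observation \<open>z\<close>, up to a factor that does not depend on
  \<open>x\<close>.\<close>

definition tilt :: "real \<Rightarrow> 'a \<Rightarrow> 'a \<Rightarrow> real" where
  "tilt s z x = exp (s * (z \<bullet> x - (norm x)\<^sup>2 / 2))"

definition partition :: "real \<Rightarrow> 'a \<Rightarrow> real" where
  "partition s z = (\<integral>x. tilt s z x \<partial>P)"

text \<open>Up to an additive constant this is the function whose gradient is the denoiser. Being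
  the logarithm of a power mean with exponent \<open>s\<close>, it is monotone in
  \<open>s\<close>.\<close>

definition log_partition :: "real \<Rightarrow> 'a \<Rightarrow> real" where
  "log_partition s z = ln (partition s z) / s"

text \<open>The posterior law of the signal given the observation \<open>z\<close>.\<close>

definition tilted :: "real \<Rightarrow> 'a \<Rightarrow> 'a measure" where
  "tilted s z = density P (\<lambda>x. ennreal (tilt s z x / partition s z))"

lemma tilt_measurable [measurable]: "tilt s z \<in> borel_measurable borel"
  unfolding tilt_def by measurable

definition exponent_bound :: "real \<Rightarrow> real" where
  "exponent_bound \<rho> = \<rho> * R + R\<^sup>2 / 2"

lemma tilt_bounds:
  assumes "s \<ge> 0" "norm z \<le> \<rho>"
  shows "AE x in P. exp (- (s * exponent_bound \<rho>)) \<le> tilt s z x \<and> tilt s z x \<le> exp (s * exponent_bound \<rho>)"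
  using bounded
proof eventually_elim
  case (elim x)
  have "\<bar>z \<bullet> x\<bar> \<le> norm z * norm x" by (rule Cauchy_Schwarz_ineq2)
  also have "\<dots> \<le> \<rho> * R" using elim assms norm_ge_zero order_trans by (intro mult_mono) blast+
  finally have "\<bar>z \<bullet> x\<bar> \<le> \<rho> * R" .
  moreover have "(norm x)\<^sup>2 \<le> R\<^sup>2" using elim by (intro power_mono) auto
  moreover have "(norm x)\<^sup>2 \<ge> 0" by simp
  ultimately have "\<bar>z \<bullet> x - (norm x)\<^sup>2 / 2\<bar> \<le> exponent_bound \<rho>"
    unfolding exponent_bound_def by linarith
  then have "s * \<bar>z \<bullet> x - (norm x)\<^sup>2 / 2\<bar> \<le> s * exponent_bound \<rho>"
    using assms(1) by (rule mult_left_mono)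
  then have "\<bar>s * (z \<bullet> x - (norm x)\<^sup>2 / 2)\<bar> \<le> s * exponent_bound \<rho>"
    using assms(1) by (simp add: abs_mult)
  then show ?case unfolding tilt_def by auto
qed

lemma integrable_tilt: "s \<ge> 0 \<Longrightarrow> integrable P (tilt s z)"
proof -
  assume s: "s \<ge> 0"
  show ?thesis
  proof (rule integrable_AE_bounded)
    show "AE x in P. \<bar>tilt s z x\<bar> \<le> exp (s * exponent_bound (norm z))"
      using tilt_bounds[OF s order_refl, of z] by eventually_elim (simp add: tilt_def)
  qed measurable
qed

lemma partition_bounds:
  assumes "s \<ge> 0" "norm z \<le> \<rho>"
  shows "exp (- (s * exponent_bound \<rho>)) \<le> partition s z" "partition s z \<le> exp (s * exponent_bound \<rho>)"
proof -
  show "exp (- (s * exponent_bound \<rho>)) \<le> partition s z"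
    unfolding partition_def
    by (rule integral_ge_const[OF integrable_tilt[OF assms(1)]])
      (use tilt_bounds[OF assms] in eventually_elim, simp)
  show "partition s z \<le> exp (s * exponent_bound \<rho>)"
    unfolding partition_def
    by (rule integral_le_const[OF integrable_tilt[OF assms(1)]])
      (use tilt_bounds[OF assms] in eventually_elim, simp)
qed

lemma partition_pos: "s \<ge> 0 \<Longrightarrow> partition s z > 0"
  using partition_bounds(1)[of s z "norm z"] by (meson exp_gt_zero less_le_trans order_refl)

lemma sets_tilted [measurable_cong]: "sets (tilted s z) = sets borel"
  by (simp add: tilted_def sets_P)

lemma integral_tilted:
  fixes \<phi> :: "'a \<Rightarrow> real"
  assumes "s \<ge> 0" and [measurable]: "\<phi> \<in> borel_measurable borel"
  shows "(\<integral>x. \<phi> x \<partial>tilted s z) = (\<integral>x. tilt s z x * \<phi> x \<partial>P) / partition s z"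
proof -
  have "(\<integral>x. \<phi> x \<partial>tilted s z) = (\<integral>x. (tilt s z x / partition s z) *\<^sub>R \<phi> x \<partial>P)"
    unfolding tilted_def
  proof (rule integral_density)
    show "AE x in P. 0 \<le> tilt s z x / partition s z"
      using partition_pos[OF assms(1), of z] by (simp add: tilt_def)
  qed measurable
  then show ?thesis by (simp add: algebra_simps)
qed

lemma AE_tilted: "AE x in P. \<phi> x \<Longrightarrow> AE x in tilted s z. \<phi> x"
  unfolding tilted_def by (subst AE_density) (auto elim: AE_mp)

lemma prob_space_tilted:
  assumes "s \<ge> 0"
  shows "prob_space (tilted s z)"
proof
  have "emeasure (tilted s z) (space (tilted s z)) = (\<integral>\<^sup>+x. ennreal (tilt s z x / partition s z) \<partial>P)"
    unfolding tilted_def by (subst emeasure_density) (auto simp: space_P)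
  also have "\<dots> = ennreal (\<integral>x. tilt s z x / partition s z \<partial>P)"
    using partition_pos[OF assms, of z]
    by (intro nn_integral_eq_integral integrable_divide integrable_tilt[OF assms]) (auto simp: tilt_def)
  also have "(\<integral>x. tilt s z x / partition s z \<partial>P) = 1"
    using partition_pos[OF assms, of z] by (simp add: partition_def)
  finally show "emeasure (tilted s z) (space (tilted s z)) = 1" by simp
qed

lemma partition_add:
  assumes "s \<ge> 0"
  shows "partition s (z + w) = partition s z * (\<integral>x. exp (s * (w \<bullet> x)) \<partial>tilted s z)"
proof -
  have "tilt s (z + w) x = tilt s z x * exp (s * (w \<bullet> x))" for x
    by (simp add: tilt_def algebra_simps flip: exp_add)
  then show ?thesis
    using partition_pos[OF assms, of z] by (subst integral_tilted) (auto simp: assms partition_def)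
qed

definition tilted_mean :: "real \<Rightarrow> 'a \<Rightarrow> 'a \<Rightarrow> real" where
  "tilted_mean s z w = (\<integral>x. w \<bullet> x \<partial>tilted s z)"

lemma AE_inner_le: "AE x in P. \<bar>w \<bullet> x\<bar> \<le> norm w * R"
  using bounded
proof eventually_elim
  case (elim x)
  have "\<bar>w \<bullet> x\<bar> \<le> norm w * norm x" by (rule Cauchy_Schwarz_ineq2)
  also have "\<dots> \<le> norm w * R" using elim by (intro mult_left_mono) auto
  finally show ?case .
qed

lemma tilted_mean_le:
  assumes "s \<ge> 0"
  shows "\<bar>tilted_mean s z w\<bar> \<le> norm w * R"
proof -
  interpret Q: prob_space "tilted s z" by (rule prob_space_tilted[OF assms])
  have int: "integrable (tilted s z) (\<lambda>x. w \<bullet> x)"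
    by (rule Q.integrable_AE_bounded[OF AE_tilted[OF AE_inner_le]]) measurable
  have "tilted_mean s z w \<le> norm w * R" unfolding tilted_mean_def
    by (rule Q.integral_le_const[OF int AE_tilted]) (use AE_inner_le[of w] in eventually_elim, simp)
  moreover have "- (norm w * R) \<le> tilted_mean s z w" unfolding tilted_mean_def
    by (rule Q.integral_ge_const[OF int AE_tilted]) (use AE_inner_le[of w] in eventually_elim, simp)
  ultimately show ?thesis by simp
qed

definition tilted_var :: "real \<Rightarrow> 'a \<Rightarrow> 'a \<Rightarrow> real" where
  "tilted_var s z w = (\<integral>x. (w \<bullet> x - tilted_mean s z w)\<^sup>2 \<partial>tilted s z)"

lemma AE_centred_le:
  assumes "s \<ge> 0"
  shows "AE x in P. \<bar>w \<bullet> x - tilted_mean s z w\<bar> \<le> 2 * (norm w * R)"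
  using AE_inner_le[of w]
proof eventually_elim
  case (elim x)
  then show ?case using tilted_mean_le[OF assms, of z w] by linarith
qed

lemma tilted_var_bounds:
  assumes "s \<ge> 0"
  shows "0 \<le> tilted_var s z w" "tilted_var s z w \<le> (2 * (norm w * R))\<^sup>2"
    "integrable (tilted s z) (\<lambda>x. (w \<bullet> x - tilted_mean s z w)\<^sup>2)"
proof -
  interpret Q: prob_space "tilted s z" by (rule prob_space_tilted[OF assms])
  have b: "AE x in tilted s z. (w \<bullet> x - tilted_mean s z w)\<^sup>2 \<le> (2 * (norm w * R))\<^sup>2"
  proof (rule AE_tilted)
    show "AE x in P. (w \<bullet> x - tilted_mean s z w)\<^sup>2 \<le> (2 * (norm w * R))\<^sup>2"
      using AE_centred_le[OF assms, of w z] by eventually_elim (metis abs_ge_zero power2_abs power_mono)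
  qed
  show int: "integrable (tilted s z) (\<lambda>x. (w \<bullet> x - tilted_mean s z w)\<^sup>2)"
    by (rule Q.integrable_AE_bounded[of _ "(2 * (norm w * R))\<^sup>2"]) (use b in auto)
  show "0 \<le> tilted_var s z w" unfolding tilted_var_def by simp
  show "tilted_var s z w \<le> (2 * (norm w * R))\<^sup>2"
    unfolding tilted_var_def by (rule Q.integral_le_const[OF int b])
qed

text \<open>Moving from \<open>z\<close> to \<open>z + w\<close> multiplies the partition function by a moment generating function of
  the tilted measure, to which \<open>exp b \<ge> 1 + b + \<kappa> b\<^sup>2\<close> is applied for the centred variable \<open>b\<close>.\<close>

lemma log_partition_add_ge:
  assumes s: "s > 0" and \<beta>: "2 * s * R * norm w \<le> \<beta>"
  shows "log_partition s (z + w) \<ge> log_partition s z + tilted_mean s z w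
    + s * (exp (- \<beta>) / 2) / (1 + exp (- \<beta>) / 2 * \<beta>\<^sup>2) * tilted_var s z w"
proof -
  have s': "s \<ge> 0" using s by simp
  interpret Q: prob_space "tilted s z" by (rule prob_space_tilted[OF s'])
  let ?\<mu> = "tilted_mean s z w" and ?V = "tilted_var s z w"
  let ?b = "\<lambda>x. s * (w \<bullet> x - ?\<mu>)"
  define \<kappa> where "\<kappa> = exp (- \<beta>) / 2"
  have \<kappa>: "\<kappa> > 0" by (simp add: \<kappa>_def)
  have b: "AE x in tilted s z. \<bar>?b x\<bar> \<le> \<beta>"
  proof (rule AE_tilted)
    show "AE x in P. \<bar>?b x\<bar> \<le> \<beta>"
      using AE_centred_le[OF s', of w z]
    proof eventually_elim
      case (elim x)
      have "\<bar>?b x\<bar> = s * \<bar>w \<bullet> x - ?\<mu>\<bar>" using s by (simp add: abs_mult)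
      also have "\<dots> \<le> s * (2 * (norm w * R))" using elim s by (intro mult_left_mono) auto
      finally show ?case using \<beta> by (simp add: mult_ac)
    qed
  qed
  have int_exp: "integrable (tilted s z) (\<lambda>x. exp (?b x))"
    by (rule Q.integrable_AE_bounded[of _ "exp \<beta>"]) (use b in \<open>eventually_elim, simp\<close>, measurable)
  have int_w: "integrable (tilted s z) (\<lambda>x. w \<bullet> x)"
    by (rule Q.integrable_AE_bounded[OF AE_tilted[OF AE_inner_le]]) measurable
  have int_b: "integrable (tilted s z) ?b"
    by (intro integrable_mult_right Bochner_Integration.integrable_diff int_w Q.integrable_const)
  have mean_b: "(\<integral>x. ?b x \<partial>tilted s z) = 0"
    using int_w by (simp add: tilted_mean_def Q.prob_space)
  have int_b2: "integrable (tilted s z) (\<lambda>x. (?b x)\<^sup>2)"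
    using tilted_var_bounds(3)[OF s', of z w] by (simp add: power_mult_distrib)
  have var_b: "(\<integral>x. (?b x)\<^sup>2 \<partial>tilted s z) = s\<^sup>2 * ?V"
    by (simp add: power_mult_distrib tilted_var_def)
  have "1 + \<kappa> * (s\<^sup>2 * ?V) = (\<integral>x. 1 + ?b x + \<kappa> * (?b x)\<^sup>2 \<partial>tilted s z)"
  proof -
    have "(\<integral>x. 1 + b x + \<kappa> * (b x)\<^sup>2 \<partial>tilted s z) = 1 + \<kappa> * (\<integral>x. (b x)\<^sup>2 \<partial>tilted s z)"
      if "integrable (tilted s z) b" "integrable (tilted s z) (\<lambda>x. (b x)\<^sup>2)" "(\<integral>x. b x \<partial>tilted s z) = 0"
      for b :: "'a \<Rightarrow> real"
      using that by (simp add: Q.prob_space)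
    from this[OF int_b int_b2 mean_b] show ?thesis by (simp only: var_b)
  qed
  also have "\<dots> \<le> (\<integral>x. exp (?b x) \<partial>tilted s z)"
  proof (rule integral_mono_AE)
    show "AE x in tilted s z. 1 + ?b x + \<kappa> * (?b x)\<^sup>2 \<le> exp (?b x)"
      using b unfolding \<kappa>_def by eventually_elim (rule exp_ge_quadratic)
    show "integrable (tilted s z) (\<lambda>x. 1 + ?b x + \<kappa> * (?b x)\<^sup>2)"
      by (rule Bochner_Integration.integrable_add[OF
            Bochner_Integration.integrable_add[OF Q.integrable_const int_b] integrable_mult_right[OF int_b2]])
  qed (rule int_exp)
  also have "\<dots> = exp (- (s * ?\<mu>)) * (\<integral>x. exp (s * (w \<bullet> x)) \<partial>tilted s z)"
    by (subst integral_mult_right_zero[symmetric]) (simp add: algebra_simps exp_diff exp_minus field_simps)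
  finally have main: "exp (s * ?\<mu>) * (1 + \<kappa> * (s\<^sup>2 * ?V)) \<le> (\<integral>x. exp (s * (w \<bullet> x)) \<partial>tilted s z)"
    by (simp add: exp_minus field_simps)
  have V: "0 \<le> ?V" "?V \<le> (2 * (norm w * R))\<^sup>2" using tilted_var_bounds[OF s'] by blast+
  define t where "t = \<kappa> * (s\<^sup>2 * ?V)"
  have t: "t \<ge> 0" using V \<kappa> by (simp add: t_def)
  have "s\<^sup>2 * ?V \<le> s\<^sup>2 * (2 * (norm w * R))\<^sup>2" using V by (intro mult_left_mono) auto
  also have "\<dots> = (2 * s * R * norm w)\<^sup>2" by (simp add: power_mult_distrib)
  also have "\<dots> \<le> \<beta>\<^sup>2" using \<beta> s R_nonneg by (intro power_mono) auto
  finally have t_le: "t \<le> \<kappa> * \<beta>\<^sup>2" using \<kappa> by (simp add: t_def)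
  have "partition s z * (exp (s * ?\<mu>) * (1 + t)) \<le> partition s (z + w)"
    unfolding partition_add[OF s'] using main partition_pos[OF s', of z]
    by (intro mult_left_mono) (auto simp: t_def)
  then have "ln (partition s z * (exp (s * ?\<mu>) * (1 + t))) \<le> ln (partition s (z + w))"
    using partition_pos[OF s', of z] partition_pos[OF s', of "z + w"] t by (subst ln_le_cancel_iff) auto
  then have "ln (partition s z) + s * ?\<mu> + ln (1 + t) \<le> ln (partition s (z + w))"
    using partition_pos[OF s', of z] t by (simp add: ln_mult)
  \<comment> \<open>The logarithm is concave, but the bound
    \<open>t \<le> \<kappa> * \<beta>\<^sup>2\<close> allows it to be replaced by a linear function
    of the variance.\<close>
  moreover have "t / (1 + \<kappa> * \<beta>\<^sup>2) \<le> ln (1 + t)"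
  proof -
    have "t / (1 + \<kappa> * \<beta>\<^sup>2) \<le> t / (1 + t)" using t t_le by (intro divide_left_mono) auto
    also have "\<dots> \<le> ln (1 + t)" using ln_one_plus_ge[OF t] .
    finally show ?thesis .
  qed
  ultimately have "(ln (partition s z) + s * ?\<mu> + t / (1 + \<kappa> * \<beta>\<^sup>2)) / s \<le> log_partition s (z + w)"
    unfolding log_partition_def using s by (intro divide_right_mono) auto
  moreover have "(ln (partition s z) + s * ?\<mu> + t / (1 + \<kappa> * \<beta>\<^sup>2)) / s
      = log_partition s z + ?\<mu> + s * \<kappa> / (1 + \<kappa> * \<beta>\<^sup>2) * ?V"
    using s by (simp add: log_partition_def t_def power2_eq_square add_divide_distrib)
  ultimately show ?thesis unfolding \<kappa>_def by simp
qed

section \<open>The covariance form of the prior and of its tilts\<close>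

definition var :: "'a \<Rightarrow> real" where
  "var w = (\<integral>x. (w \<bullet> x - (\<integral>x. w \<bullet> x \<partial>P))\<^sup>2 \<partial>P)"

lemma integrable_inner: "integrable P (\<lambda>x. w \<bullet> x)"
  by (rule integrable_AE_bounded[OF AE_inner_le]) measurable

lemma integrable_inner_sq: "integrable P (\<lambda>x. (w \<bullet> x - c)\<^sup>2)"
proof (rule integrable_AE_bounded)
  show "AE x in P. \<bar>(w \<bullet> x - c)\<^sup>2\<bar> \<le> (norm w * R + \<bar>c\<bar>)\<^sup>2"
    using AE_inner_le[of w]
  proof eventually_elim
    case (elim x)
    then have "\<bar>w \<bullet> x - c\<bar> \<le> norm w * R + \<bar>c\<bar>" by linarith
    then have "\<bar>w \<bullet> x - c\<bar>\<^sup>2 \<le> (norm w * R + \<bar>c\<bar>)\<^sup>2" by (intro power_mono) auto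
    then show ?case by simp
  qed
qed measurable

text \<open>The mean minimises the second moment; this absorbs the difference between the mean of
  \<open>P\<close> and the tilted mean in \<open>tilted_var_ge\<close>.\<close>

lemma var_le_second_moment: "var w \<le> (\<integral>x. (w \<bullet> x - c)\<^sup>2 \<partial>P)"
proof -
  let ?\<mu> = "\<integral>x. w \<bullet> x \<partial>P"
  have "(\<integral>x. (w \<bullet> x - c)\<^sup>2 \<partial>P) = (\<integral>x. (w \<bullet> x - ?\<mu>)\<^sup>2 + (2 * (?\<mu> - c) * (w \<bullet> x) + (c\<^sup>2 - ?\<mu>\<^sup>2)) \<partial>P)"
    by (rule Bochner_Integration.integral_cong) (auto simp: power2_eq_square algebra_simps)
  also have "\<dots> = var w + (2 * (?\<mu> - c) * ?\<mu> + (c\<^sup>2 - ?\<mu>\<^sup>2))"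
    unfolding var_def using integrable_inner_sq integrable_inner
    by (subst Bochner_Integration.integral_add) (auto simp: prob_space)
  also have "\<dots> = var w + (?\<mu> - c)\<^sup>2" by (simp add: power2_eq_square algebra_simps)
  finally show ?thesis by simp
qed

text \<open>A vanishing variance would make the functional almost surely constant and put the prior
  on a hyperplane.\<close>

lemma var_pos: "w \<noteq> 0 \<Longrightarrow> var w > 0"
proof -
  assume w: "w \<noteq> 0"
  have "var w \<noteq> 0"
  proof
    assume "var w = 0"
    then have "AE x in P. (w \<bullet> x - (\<integral>x. w \<bullet> x \<partial>P))\<^sup>2 = 0"
      unfolding var_def using integral_nonneg_eq_0_iff_AE[OF integrable_inner_sq] by auto
    then show False using nondegenerate[OF w] by simp
  qed
  moreover have "var w \<ge> 0" unfolding var_def by simp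
  ultimately show ?thesis by simp
qed

lemma var_scale: "var (t *\<^sub>R w) = t\<^sup>2 * var w"
proof -
  have "((t *\<^sub>R w) \<bullet> x - (\<integral>x. (t *\<^sub>R w) \<bullet> x \<partial>P))\<^sup>2 = t\<^sup>2 * (w \<bullet> x - (\<integral>x. w \<bullet> x \<partial>P))\<^sup>2" for x
    by (simp add: power_mult_distrib flip: right_diff_distrib)
  then show ?thesis by (simp add: var_def)
qed

lemma continuous_var: "continuous_on UNIV var"
proof -
  define \<mu> where "\<mu> e = (\<integral>x. x \<bullet> e \<partial>P)" for e :: 'a
  have inte: "integrable P (\<lambda>x. x \<bullet> e)" for e using integrable_inner[of e] by (simp add: inner_commute)
  have mean: "(\<integral>x. w \<bullet> x \<partial>P) = (\<Sum>e\<in>Basis. (w \<bullet> e) * \<mu> e)" for w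
  proof -
    have "(\<integral>x. w \<bullet> x \<partial>P) = (\<integral>x. (\<Sum>e\<in>Basis. (w \<bullet> e) * (x \<bullet> e)) \<partial>P)"
      by (rule Bochner_Integration.integral_cong[OF refl euclidean_inner])
    then show ?thesis by (simp add: inte \<mu>_def)
  qed
  have int2: "integrable P (\<lambda>x. (x \<bullet> e - \<mu> e) * (x \<bullet> e' - \<mu> e'))" for e e'
  proof -
    \<comment> \<open>Polarisation expresses the mixed product by squares, whose integrability is
      known.\<close>
    have eq: "(x \<bullet> e - \<mu> e) * (x \<bullet> e' - \<mu> e') =
      (((e + e') \<bullet> x - (\<mu> e + \<mu> e'))\<^sup>2 - (e \<bullet> x - \<mu> e)\<^sup>2 - (e' \<bullet> x - \<mu> e')\<^sup>2) / 2" for x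
      by (simp add: inner_add_left inner_commute[of x e] inner_commute[of x e'] power2_eq_square field_simps)
    show ?thesis
      unfolding eq by (intro integrable_divide Bochner_Integration.integrable_diff integrable_inner_sq)
  qed
  have "var w = (\<Sum>e\<in>Basis. \<Sum>e'\<in>Basis. (w \<bullet> e) * (w \<bullet> e') * (\<integral>x. (x \<bullet> e - \<mu> e) * (x \<bullet> e' - \<mu> e') \<partial>P))" for w
  proof -
    have "w \<bullet> x - (\<integral>x. w \<bullet> x \<partial>P) = (\<Sum>e\<in>Basis. (w \<bullet> e) * (x \<bullet> e - \<mu> e))" for x
      using euclidean_inner[of w x] by (simp add: mean right_diff_distrib sum_subtractf)
    then have "(w \<bullet> x - (\<integral>x. w \<bullet> x \<partial>P))\<^sup>2 =
        (\<Sum>e\<in>Basis. \<Sum>e'\<in>Basis. ((w \<bullet> e) * (w \<bullet> e')) * ((x \<bullet> e - \<mu> e) * (x \<bullet> e' - \<mu> e')))" for x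
      by (simp add: power2_eq_square sum_product mult_ac)
    then show ?thesis unfolding var_def using int2 by simp
  qed
  then have "var = (\<lambda>w. \<Sum>e\<in>Basis. \<Sum>e'\<in>Basis. (w \<bullet> e) * (w \<bullet> e') * (\<integral>x. (x \<bullet> e - \<mu> e) * (x \<bullet> e' - \<mu> e') \<partial>P))"
    by blast
  then show ?thesis by (simp add: continuous_intros)
qed

text \<open>The constant is the smallest eigenvalue of the covariance matrix, found as the minimum
  of \<open>var\<close> on the unit sphere.\<close>

lemma var_coercive:
  obtains l where "l > 0" "\<And>w. var w \<ge> l * (norm w)\<^sup>2"
proof -
  have "\<exists>w\<in>sphere 0 1. \<forall>v\<in>sphere 0 1. var w \<le> var v"
    by (rule continuous_attains_inf) (use continuous_on_subset[OF continuous_var] in auto)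
  then obtain w where w: "norm w = 1" "\<And>v. norm v = 1 \<Longrightarrow> var w \<le> var v" by auto
  show ?thesis
  proof (rule that[of "var w"])
    show "var w > 0" using w(1) by (intro var_pos) auto
    fix v show "var w * (norm v)\<^sup>2 \<le> var v"
    proof (cases "v = 0")
      case True then show ?thesis by (simp add: var_def)
    next
      case False
      define u where "u = (1 / norm v) *\<^sub>R v"
      have "var v = (norm v)\<^sup>2 * var u" using False var_scale[of "norm v" u] by (simp add: u_def)
      then show ?thesis using w(2)[of u] False by (simp add: u_def mult.commute mult_left_mono)
    qed
  qed
qed

text \<open>The tilted density is at least \<open>exp (- 2 * (s * exponent_bound \<rho>))\<close>:
  one half of the exponent comes from \<open>tilt\<close>, the other from the partition
  function.\<close>

lemma tilted_var_ge:
  assumes "s \<ge> 0" "norm z \<le> \<rho>"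
  shows "tilted_var s z w \<ge> exp (- 2 * (s * exponent_bound \<rho>)) * var w"
proof -
  let ?\<mu> = "tilted_mean s z w" and ?U = "s * exponent_bound \<rho>"
  have pos: "partition s z > 0" using partition_pos[OF assms(1)] .
  have "exp (- ?U) * var w \<le> (\<integral>x. exp (- ?U) * (w \<bullet> x - ?\<mu>)\<^sup>2 \<partial>P)"
    using var_le_second_moment[of w ?\<mu>] by simp
  also have "\<dots> \<le> (\<integral>x. tilt s z x * (w \<bullet> x - ?\<mu>)\<^sup>2 \<partial>P)"
  proof (rule integral_mono_AE)
    show "AE x in P. exp (- ?U) * (w \<bullet> x - ?\<mu>)\<^sup>2 \<le> tilt s z x * (w \<bullet> x - ?\<mu>)\<^sup>2"
      using tilt_bounds[OF assms] by eventually_elim (intro mult_right_mono, auto)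
    show "integrable P (\<lambda>x. tilt s z x * (w \<bullet> x - ?\<mu>)\<^sup>2)"
    proof (rule integrable_AE_bounded)
      show "AE x in P. \<bar>tilt s z x * (w \<bullet> x - ?\<mu>)\<^sup>2\<bar> \<le> exp ?U * (2 * (norm w * R))\<^sup>2"
        using tilt_bounds[OF assms] AE_centred_le[OF assms(1), of w z]
      proof eventually_elim
        case (elim x)
        have "\<bar>w \<bullet> x - ?\<mu>\<bar>\<^sup>2 \<le> (2 * (norm w * R))\<^sup>2" using elim by (intro power_mono) auto
        then have "tilt s z x * (w \<bullet> x - ?\<mu>)\<^sup>2 \<le> exp ?U * (2 * (norm w * R))\<^sup>2"
          using elim by (intro mult_mono) auto
        then show ?case by (simp add: abs_mult tilt_def)
      qed
    qed measurable
  qed (intro integrable_mult_right integrable_inner_sq)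
  also have "\<dots> = partition s z * tilted_var s z w"
    unfolding tilted_var_def using pos by (subst integral_tilted[OF assms(1)]) auto
  also have "\<dots> \<le> exp ?U * tilted_var s z w"
    using partition_bounds(2)[OF assms] tilted_var_bounds(1)[OF assms(1)] by (intro mult_right_mono)
  finally have "exp (- ?U) * (exp (- ?U) * var w) \<le> exp (- ?U) * (exp ?U * tilted_var s z w)"
    by (intro mult_left_mono) auto
  then show ?thesis by (simp flip: exp_add mult.assoc)
qed

text \<open>Power means are nondecreasing in the exponent.\<close>
lemma log_partition_mono:
  assumes "0 < s" "s \<le> s'"
  shows "log_partition s z \<le> log_partition s' z"
proof -
  define r where "r = s' / s"
  have r: "r \<ge> 1" "s' = r * s" using assms by (auto simp: r_def)
  define \<mu> where "\<mu> = ln (partition s z)"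
  have Z: "partition s z > 0" "partition s' z > 0" using partition_pos assms by auto
  have int: "integrable P (tilt s z)" "integrable P (tilt s' z)"
    using assms by (auto intro: integrable_tilt)
  \<comment> \<open>Bernoulli's inequality is applied to the tilt normalised to mean 1, so that
    integration removes the first-order term.\<close>
  have pt: "1 + r * (tilt s z x / partition s z - 1) \<le> exp (- (r * \<mu>)) * tilt s' z x" for x
  proof -
    let ?w = "s * (z \<bullet> x - (norm x)\<^sup>2 / 2) - \<mu>"
    have "exp ?w = tilt s z x / partition s z"
      using Z by (simp add: tilt_def \<mu>_def exp_diff)
    moreover have "exp (r * ?w) = exp (- (r * \<mu>)) * tilt s' z x"
      unfolding tilt_def r(2) by (simp add: algebra_simps flip: exp_add)
    ultimately show ?thesis using exp_mult_ge_tangent[OF r(1), of ?w] by simp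
  qed
  have "1 = (\<integral>x. 1 + r * (tilt s z x / partition s z - 1) \<partial>P)"
    using int Z by (simp add: prob_space partition_def)
  also have "\<dots> \<le> (\<integral>x. exp (- (r * \<mu>)) * tilt s' z x \<partial>P)"
    using int pt by (intro integral_mono) auto
  also have "\<dots> = exp (- (r * \<mu>)) * partition s' z" by (simp add: partition_def)
  finally have "exp (r * \<mu>) \<le> partition s' z" by (simp add: exp_minus field_simps)
  then have "r * \<mu> \<le> ln (partition s' z)" using Z by (simp add: ln_ge_iff)
  then show ?thesis using assms by (simp add: log_partition_def \<mu>_def r_def field_simps)
qed

lemma log_partition_0_le: "s > 0 \<Longrightarrow> log_partition s 0 \<le> 0"
proof -
  assume s: "s > 0"
  have "partition s 0 \<le> 1" unfolding partition_def
    by (rule integral_le_const[OF integrable_tilt]) (use s in \<open>auto simp: tilt_def\<close>)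
  then show ?thesis
    using s partition_pos[of s 0] by (simp add: log_partition_def divide_le_0_iff)
qed

text \<open>No differentiation under the integral: by the lower bound, the log-partition function
  minus its candidate linear part has a minimum at \<open>z\<close> along the line, so its given
  derivative must vanish there.\<close>

lemma gradient_eq_tilted_mean:
  assumes s: "s > 0" and gd: "GDERIV (log_partition s) z :> v"
  shows "v \<bullet> w = tilted_mean s z w"
proof -
  define q where "q t = log_partition s (z + t *\<^sub>R w) - t * tilted_mean s z w" for t
  have "(q has_real_derivative (v \<bullet> w - tilted_mean s z w)) (at 0)"
    unfolding q_def using GDERIV_imp_along_line[where f = "log_partition s" and z = z and t = 0 and u = w and v = v] gd
    by (auto intro!: derivative_eq_intros)
  moreover have "q 0 \<le> q t" for t
  proof -
    have "tilted_mean s z (t *\<^sub>R w) = t * tilted_mean s z w" by (simp add: tilted_mean_def)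
    moreover have "s * (exp (- \<beta>) / 2) / (1 + exp (- \<beta>) / 2 * \<beta>\<^sup>2) * tilted_var s z (t *\<^sub>R w) \<ge> 0" for \<beta>
      using s tilted_var_bounds(1)[of s z "t *\<^sub>R w"]
      by (intro mult_nonneg_nonneg divide_nonneg_nonneg add_nonneg_nonneg) auto
    ultimately show ?thesis
      using log_partition_add_ge[OF s order_refl, of z "t *\<^sub>R w"] unfolding q_def
      by (smt (verit) add_0_right mult_zero_left scaleR_zero_left)
  qed
  ultimately have "v \<bullet> w - tilted_mean s z w = 0"
    by (intro DERIV_local_min[of q _ 0 1]) auto
  then show ?thesis by simp
qed

text \<open>The quadratic tangent bounds from \<open>z\<close> to \<open>w\<close> and from
  \<open>w\<close> to \<open>z\<close> add up to modulus \<open>2 * m\<close>, of which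
  \<open>m\<close> is kept.\<close>

lemma log_partition_strongly_monotone:
  assumes s: "0 < s\<^sub>0" "s\<^sub>0 \<le> s\<^sub>1" and S: "S \<subseteq> {s\<^sub>0..s\<^sub>1}"
    and gd: "\<And>s z. s \<in> S \<Longrightarrow> GDERIV (log_partition s) z :> G s z"
  shows "\<exists>m>0. \<forall>s\<in>S. \<forall>z\<in>cball 0 \<rho>. \<forall>w\<in>cball 0 \<rho>. m * (norm (z - w))\<^sup>2 \<le> (G s z - G s w) \<bullet> (z - w)"
proof (cases "\<rho> \<ge> 0")
  case True
  obtain l where l: "l > 0" "\<And>w. var w \<ge> l * (norm w)\<^sup>2" using var_coercive by blast
  define \<beta> where "\<beta> = 2 * s\<^sub>1 * R * (2 * \<rho>)"
  define \<kappa> where "\<kappa> = (exp (- \<beta>) / 2) / (1 + exp (- \<beta>) / 2 * \<beta>\<^sup>2)"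
  \<comment> \<open>Uniform over the levels: the linear factor \<open>s\<close> is smallest at
    \<open>s\<^sub>0\<close> and the decaying exponential at \<open>s\<^sub>1\<close>.\<close>
  define m where "m = s\<^sub>0 * \<kappa> * (exp (- 2 * (s\<^sub>1 * exponent_bound \<rho>)) * l)"
  have \<kappa>: "\<kappa> > 0" unfolding \<kappa>_def by (intro divide_pos_pos add_pos_nonneg) auto
  have m: "m > 0" using s \<kappa> l by (simp add: m_def)
  have rb: "exponent_bound \<rho> \<ge> 0" using True R_nonneg by (simp add: exponent_bound_def)
  have half: "log_partition s w \<ge> log_partition s z + G s z \<bullet> (w - z) + m * (norm (w - z))\<^sup>2"
    if sS: "s \<in> S" and zw: "norm z \<le> \<rho>" "norm w \<le> \<rho>" for s z w
  proof -
    have s_mem: "s \<in> {s\<^sub>0..s\<^sub>1}" using sS S by blast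
    have sp: "s > 0" using s_mem s by auto
    have "2 * s * R * norm (w - z) \<le> \<beta>"
      unfolding \<beta>_def using s_mem sp R_nonneg zw norm_triangle_ineq4[of w z]
      by (intro mult_mono) auto
    then have "log_partition s (z + (w - z)) \<ge> log_partition s z + tilted_mean s z (w - z)
        + s * (exp (- \<beta>) / 2) / (1 + exp (- \<beta>) / 2 * \<beta>\<^sup>2) * tilted_var s z (w - z)"
      by (rule log_partition_add_ge[OF sp])
    then have "log_partition s w \<ge> log_partition s z + G s z \<bullet> (w - z) + s * \<kappa> * tilted_var s z (w - z)"
      using gradient_eq_tilted_mean[OF sp gd[OF sS]] by (simp add: \<kappa>_def)
    moreover have "m * (norm (w - z))\<^sup>2 \<le> s * \<kappa> * tilted_var s z (w - z)"
    proof -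
      have "exp (- 2 * (s\<^sub>1 * exponent_bound \<rho>)) * (l * (norm (w - z))\<^sup>2)
          \<le> exp (- 2 * (s * exponent_bound \<rho>)) * var (w - z)"
        using l(2)[of "w - z"] l(1) s_mem rb by (intro mult_mono) (auto intro: mult_right_mono)
      also have "\<dots> \<le> tilted_var s z (w - z)"
        by (rule tilted_var_ge) (use sp zw in auto)
      finally have "s\<^sub>0 * \<kappa> * (exp (- 2 * (s\<^sub>1 * exponent_bound \<rho>)) * (l * (norm (w - z))\<^sup>2))
          \<le> s * \<kappa> * tilted_var s z (w - z)"
        using s_mem s \<kappa> l(1) by (intro mult_mono) auto
      then show ?thesis by (simp add: m_def mult_ac)
    qed
    ultimately show ?thesis by simp
  qed
  have "m * (norm (z - w))\<^sup>2 \<le> (G s z - G s w) \<bullet> (z - w)"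
    if "s \<in> S" "norm z \<le> \<rho>" "norm w \<le> \<rho>" for s z w
  proof -
    have "0 \<le> m * (norm (z - w))\<^sup>2" using m by simp
    then show ?thesis
      using half[OF that(1), of z w] half[OF that(1), of w z] that
      by (simp add: inner_diff_left inner_diff_right norm_minus_commute)
  qed
  then show ?thesis using m by (intro exI[of _ m]) auto
qed (use zero_less_one in \<open>auto intro!: exI[of _ 1]\<close>)

lemma gradient_norm_le:
  assumes "s > 0" "GDERIV (log_partition s) z :> v"
  shows "norm v \<le> R"
proof (cases "v = 0")
  case False
  have "norm v * norm v \<le> norm v * R"
    using tilted_mean_le[of s z v] gradient_eq_tilted_mean[OF assms, of v] assms(1)
    by (simp add: power2_norm_eq_inner[symmetric] power2_eq_square)
  then show ?thesis using False by simp
qed (simp add: R_nonneg)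

text \<open>Derived from the tangent bound without any differentiability, because it serves to show
  that the noisy density is continuous before \<open>g\<close> is identified with it.\<close>

lemma log_partition_lipschitz:
  assumes s: "s > 0"
  shows "R-lipschitz_on UNIV (log_partition s)"
proof (rule lipschitz_onI)
  have ge: "log_partition s w \<ge> log_partition s z - R * norm (w - z)" for z w
  proof -
    have "0 \<le> s * (exp (- \<beta>) / 2) / (1 + exp (- \<beta>) / 2 * \<beta>\<^sup>2) * tilted_var s z (w - z)" for \<beta>
      using s tilted_var_bounds(1)[of s z "w - z"]
      by (intro mult_nonneg_nonneg divide_nonneg_nonneg add_nonneg_nonneg) auto
    from this[of "2 * s * R * norm (w - z)"]
    show ?thesis
      using log_partition_add_ge[OF s order_refl, of z "w - z"] tilted_mean_le[of s z "w - z"] s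
      by (simp add: mult.commute[of R])
  qed
  show "dist (log_partition s z) (log_partition s w) \<le> R * dist z w" for z w
    using ge[of z w] ge[of w z] by (simp add: dist_norm norm_minus_commute[of w z] abs_le_iff)
qed (rule R_nonneg)

end

section \<open>Gaussian noise and the exact MMSE case\<close>

lemma std_gaussian_density_eq:
  "std_gaussian_density (x::'a::euclidean_space) = (1 / sqrt (2 * pi)) ^ DIM('a) * exp (- (norm x)\<^sup>2 / 2)"
proof -
  have "(\<Prod>e\<in>Basis. exp (- (x \<bullet> e)\<^sup>2 / 2)) = exp (\<Sum>e\<in>Basis. - (x \<bullet> e)\<^sup>2 / 2)"
    by (simp add: exp_sum)
  also have "(\<Sum>e\<in>Basis. - (x \<bullet> e)\<^sup>2 / 2) = - (norm x)\<^sup>2 / 2"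
    unfolding power2_norm_eq_inner
    by (subst euclidean_inner) (simp add: power2_eq_square sum_negf flip: sum_divide_distrib)
  finally show ?thesis
    unfolding std_gaussian_density_def std_normal_density_def prod.distrib by simp
qed

lemma std_gaussian_density_nonneg: "std_gaussian_density x \<ge> 0"
  by (simp add: std_gaussian_density_eq)

lemma std_gaussian_density_measurable [measurable]: "std_gaussian_density \<in> borel_measurable borel"
  unfolding std_gaussian_density_def by measurable

lemma nn_integral_std_normal: "(\<integral>\<^sup>+t. ennreal (std_normal_density t) \<partial>lborel) = 1"
  by (subst nn_integral_eq_integral) auto

lemma nn_integral_std_gaussian: "(\<integral>\<^sup>+x. ennreal (std_gaussian_density (x::'a::euclidean_space)) \<partial>lborel) = 1"
proof -
  have "(\<integral>\<^sup>+x. ennreal (std_gaussian_density (x::'a)) \<partial>lborel)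
      = (\<integral>\<^sup>+x. (\<Prod>e\<in>Basis. ennreal (std_normal_density ((x::'a) \<bullet> e))) \<partial>lborel)"
    by (simp add: std_gaussian_density_def prod_ennreal)
  also have "\<dots> = (\<Prod>e\<in>(Basis::'a set). \<integral>\<^sup>+t. ennreal (std_normal_density t) \<partial>lborel)"
    by (rule nn_integral_lborel_prod) auto
  finally show ?thesis by (simp add: nn_integral_std_normal)
qed

lemma sets_std_gaussian [measurable_cong]: "sets std_gaussian = sets borel"
  by (simp add: std_gaussian_def)

lemma prob_space_std_gaussian: "prob_space (std_gaussian :: 'a::euclidean_space measure)"
proof
  show "emeasure (std_gaussian :: 'a measure) (space std_gaussian) = 1"
    unfolding std_gaussian_def by (subst emeasure_density) (auto simp: nn_integral_std_gaussian)
qed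

text \<open>The squared norm is a sum over coordinates; for each one the integrand factors into
  one-dimensional integrals, with the square put into a single factor.\<close>

lemma nn_integral_std_gaussian_norm_sq_finite:
  "(\<integral>\<^sup>+x. ennreal (std_gaussian_density (x::'a::euclidean_space)) * ennreal ((norm x)\<^sup>2) \<partial>lborel) < \<infinity>"
proof -
  have one: "(\<integral>\<^sup>+x. ennreal (std_gaussian_density (x::'a)) * ennreal ((x \<bullet> b)\<^sup>2) \<partial>lborel) < \<infinity>" if b: "b \<in> Basis" for b
  proof -
    define q where "q e t = (if e = b then std_normal_density t * t\<^sup>2 else std_normal_density t)" for e :: 'a and t :: real
    have q_nonneg: "q e t \<ge> 0" for e t by (simp add: q_def)
    have "ennreal (std_gaussian_density x) * ennreal ((x \<bullet> b)\<^sup>2) = (\<Prod>e\<in>Basis. ennreal (q e (x \<bullet> e)))" for x :: 'a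
    proof -
      have "(\<Prod>e\<in>Basis. q e (x \<bullet> e)) = q b (x \<bullet> b) * (\<Prod>e\<in>Basis - {b}. q e (x \<bullet> e))"
        using b by (intro prod.remove) auto
      also have "(\<Prod>e\<in>Basis - {b}. q e (x \<bullet> e)) = (\<Prod>e\<in>Basis - {b}. std_normal_density (x \<bullet> e))"
        by (intro prod.cong) (auto simp: q_def)
      also have "q b (x \<bullet> b) * \<dots> = std_gaussian_density x * (x \<bullet> b)\<^sup>2"
        unfolding std_gaussian_density_def using b by (subst prod.remove[of Basis b]) (auto simp: q_def)
      finally have "(\<Prod>e\<in>Basis. ennreal (q e (x \<bullet> e))) = ennreal (std_gaussian_density x * (x \<bullet> b)\<^sup>2)"
        using q_nonneg by (simp add: prod_ennreal)
      then show ?thesis by (simp add: ennreal_mult std_gaussian_density_nonneg)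
    qed
    then have "(\<integral>\<^sup>+x. ennreal (std_gaussian_density (x::'a)) * ennreal ((x \<bullet> b)\<^sup>2) \<partial>lborel)
        = (\<integral>\<^sup>+x. (\<Prod>e\<in>Basis. ennreal (q e ((x::'a) \<bullet> e))) \<partial>lborel)" by simp
    also have "\<dots> = (\<Prod>e\<in>Basis. \<integral>\<^sup>+t. ennreal (q e t) \<partial>lborel)"
      by (rule nn_integral_lborel_prod) (auto simp: q_def)
    also have "\<dots> < \<infinity>"
    proof -
      have "(\<integral>\<^sup>+t. ennreal (q e t) \<partial>lborel) < \<infinity>" for e
      proof (cases "e = b")
        case True
        have "integrable lborel (\<lambda>t. std_normal_density t * t\<^sup>2)"
          using integrable_std_normal_moment[of 2] by simp
        moreover have "q e = (\<lambda>t. std_normal_density t * t\<^sup>2)" using True by (auto simp: q_def)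
        ultimately show ?thesis by (subst nn_integral_eq_integral) auto
      qed (simp add: q_def nn_integral_std_normal)
      then show ?thesis by (auto simp: ennreal_prod_eq_top less_top[symmetric])
    qed
    finally show ?thesis .
  qed
  have "ennreal ((norm x)\<^sup>2) = (\<Sum>b\<in>Basis. ennreal ((x \<bullet> b)\<^sup>2))" for x :: 'a
    unfolding power2_norm_eq_inner by (subst euclidean_inner) (simp add: power2_eq_square)
  then have "(\<integral>\<^sup>+x. ennreal (std_gaussian_density (x::'a)) * ennreal ((norm x)\<^sup>2) \<partial>lborel)
      = (\<integral>\<^sup>+x. (\<Sum>b\<in>Basis. ennreal (std_gaussian_density (x::'a)) * ennreal ((x \<bullet> b)\<^sup>2)) \<partial>lborel)"
    by (simp only: sum_distrib_left)
  also have "\<dots> = (\<Sum>b\<in>Basis. \<integral>\<^sup>+x. ennreal (std_gaussian_density (x::'a)) * ennreal ((x \<bullet> b)\<^sup>2) \<partial>lborel)"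
    by (rule nn_integral_sum) measurable
  also have "\<dots> < \<infinity>" using one by (simp add: less_top)
  finally show ?thesis .
qed

text \<open>By Tonelli the expected sum is the Gaussian second moment times the sum of
  \<open>(\<tau> k)\<^sup>2\<close>; a finite expectation forces an almost surely finite
  sum.\<close>

lemma AE_summable_scaled_gaussian:
  fixes Z :: "nat \<Rightarrow> 'w \<Rightarrow> 'a::euclidean_space"
  assumes Z: "\<And>k. distributed \<Omega> lborel (Z k) (\<lambda>z. ennreal (std_gaussian_density z))"
    and "summable (\<lambda>k. (\<tau> k)\<^sup>2)"
  shows "AE \<omega> in \<Omega>. summable (\<lambda>k. (norm (\<tau> k *\<^sub>R Z k \<omega>))\<^sup>2)"
proof -
  define m where "m = (\<integral>\<^sup>+x. ennreal (std_gaussian_density (x::'a)) * ennreal ((norm x)\<^sup>2) \<partial>lborel)"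
  have m: "m < \<infinity>" unfolding m_def by (rule nn_integral_std_gaussian_norm_sq_finite)
  have Z_meas [measurable]: "Z k \<in> borel_measurable \<Omega>" for k
    using distributed_measurable[OF Z, of k] by simp
  have mk: "(\<integral>\<^sup>+\<omega>. ennreal ((norm (Z k \<omega>))\<^sup>2) \<partial>\<Omega>) = m" for k
    unfolding m_def by (rule distributed_nn_integral[OF Z, symmetric]) measurable
  have "(\<integral>\<^sup>+\<omega>. (\<Sum>k. ennreal ((norm (\<tau> k *\<^sub>R Z k \<omega>))\<^sup>2)) \<partial>\<Omega>)
      = (\<Sum>k. \<integral>\<^sup>+\<omega>. ennreal ((norm (\<tau> k *\<^sub>R Z k \<omega>))\<^sup>2) \<partial>\<Omega>)"
    by (rule nn_integral_suminf) measurable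
  also have "\<dots> = (\<Sum>k. ennreal ((\<tau> k)\<^sup>2) * m)"
  proof -
    have "(\<integral>\<^sup>+\<omega>. ennreal ((norm (\<tau> k *\<^sub>R Z k \<omega>))\<^sup>2) \<partial>\<Omega>) = ennreal ((\<tau> k)\<^sup>2) * m" for k
    proof -
      have "(\<integral>\<^sup>+\<omega>. ennreal ((norm (\<tau> k *\<^sub>R Z k \<omega>))\<^sup>2) \<partial>\<Omega>)
          = (\<integral>\<^sup>+\<omega>. ennreal ((\<tau> k)\<^sup>2) * ennreal ((norm (Z k \<omega>))\<^sup>2) \<partial>\<Omega>)"
        by (intro nn_integral_cong) (simp add: power_mult_distrib flip: ennreal_mult)
      also have "\<dots> = ennreal ((\<tau> k)\<^sup>2) * (\<integral>\<^sup>+\<omega>. ennreal ((norm (Z k \<omega>))\<^sup>2) \<partial>\<Omega>)"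
        by (rule nn_integral_cmult) measurable
      finally show ?thesis by (simp only: mk)
    qed
    then show ?thesis by (simp only:)
  qed
  also have "\<dots> = (\<Sum>k. ennreal ((\<tau> k)\<^sup>2)) * m" by simp
  also have "(\<Sum>k. ennreal ((\<tau> k)\<^sup>2)) = ennreal (\<Sum>k. (\<tau> k)\<^sup>2)"
    by (rule suminf_ennreal_eq[OF _ summable_sums[OF assms(2)]]) simp
  also have "ennreal (\<Sum>k. (\<tau> k)\<^sup>2) * m < \<infinity>"
    using m by (simp add: ennreal_mult_less_top)
  finally have fin: "(\<integral>\<^sup>+\<omega>. (\<Sum>k. ennreal ((norm (\<tau> k *\<^sub>R Z k \<omega>))\<^sup>2)) \<partial>\<Omega>) \<noteq> \<infinity>" by simp
  have "AE \<omega> in \<Omega>. (\<Sum>k. ennreal ((norm (\<tau> k *\<^sub>R Z k \<omega>))\<^sup>2)) \<noteq> \<infinity>"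
    by (rule nn_integral_PInf_AE[OF _ fin]) measurable
  then show ?thesis
    by eventually_elim (rule summable_suminf_not_top, auto)
qed

lemma continuous_AE_lborel_eq:
  fixes p q :: "'a::euclidean_space \<Rightarrow> real"
  assumes "continuous_on UNIV p" "continuous_on UNIV q" and "AE x in lborel. p x = q x"
  shows "p = q"
proof -
  let ?S = "{x. p x \<noteq> q x}"
  have op: "open ?S" using assms(1,2) by (rule open_Collect_neq)
  then have "?S \<in> null_sets lborel"
    using assms(3) AE_iff_null_sets[of ?S lborel] by auto
  then have "negligible ?S"
    unfolding negligible_iff_null_sets by (rule null_sets_completionI)
  then have "?S = {}" using open_not_negligible[OF op] by blast
  then show ?thesis by auto
qed

section \<open>The law of the noisy observation\<close>

context bounded_prior
begin

text \<open>The normalising constant of the centred Gaussian density with covariance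
  \<open>\<sigma>\<^sup>2\<close> times the identity.\<close>

definition noise_norm :: "real \<Rightarrow> real" where
  "noise_norm \<sigma> = (1 / sqrt (2 * pi)) ^ DIM('a) / \<sigma> ^ DIM('a)"

definition noisy_density :: "real \<Rightarrow> 'a \<Rightarrow> real" where
  "noisy_density \<sigma> y = noise_norm \<sigma> * exp (- (norm y)\<^sup>2 / (2 * \<sigma>\<^sup>2)) * partition (1 / \<sigma>\<^sup>2) y"

lemma noise_norm_pos: "\<sigma> > 0 \<Longrightarrow> noise_norm \<sigma> > 0"
  by (simp add: noise_norm_def)

lemma continuous_noisy_density:
  assumes "\<sigma> > 0"
  shows "continuous_on UNIV (noisy_density \<sigma>)"
proof -
  let ?s = "1 / \<sigma>\<^sup>2"
  have s: "?s > 0" using assms by simp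
  have "partition ?s y = exp (?s * log_partition ?s y)" for y
    using partition_pos[of ?s y] s by (simp add: log_partition_def)
  then have "noisy_density \<sigma> = (\<lambda>y. noise_norm \<sigma> * exp (- (norm y)\<^sup>2 / (2 * \<sigma>\<^sup>2)) * exp (?s * log_partition ?s y))"
    by (auto simp: noisy_density_def)
  moreover have "continuous_on UNIV (log_partition ?s)"
    using log_partition_lipschitz[OF s] by (rule lipschitz_on_continuous_on)
  ultimately show ?thesis using assms by (auto intro!: continuous_intros)
qed

lemma noise_kernel:
  assumes "\<sigma> > 0"
  shows "std_gaussian_density ((1 / \<sigma>) *\<^sub>R (y - x)) / \<sigma> ^ DIM('a) =
    noise_norm \<sigma> * exp (- (norm y)\<^sup>2 / (2 * \<sigma>\<^sup>2)) * tilt (1 / \<sigma>\<^sup>2) y x"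
proof -
  have "- (norm ((1 / \<sigma>) *\<^sub>R (y - x)))\<^sup>2 / 2 = - (norm y)\<^sup>2 / (2 * \<sigma>\<^sup>2) + 1 / \<sigma>\<^sup>2 * (y \<bullet> x - (norm x)\<^sup>2 / 2)"
    using assms unfolding power2_norm_eq_inner
    by (simp add: inner_diff_left inner_diff_right inner_commute field_simps power2_eq_square)
  then show ?thesis
    unfolding std_gaussian_density_eq tilt_def noise_norm_def by (simp only: exp_add) simp
qed

text \<open>For fixed signal \<open>x\<close> an affine substitution turns the noise density into
  the kernel \<open>?k x\<close>; Tonelli then moves the integral over the prior inside, where
  \<open>noise_kernel\<close> evaluates it.\<close>

lemma distr_observation:
  assumes "\<sigma> > 0"
  shows "distr (joint_space P) lborel (observation \<sigma>) = density lborel (\<lambda>y. ennreal (noisy_density \<sigma> y))"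
proof (rule measure_eqI)
  interpret G: prob_space "std_gaussian :: 'a measure" by (rule prob_space_std_gaussian)
  interpret PL: pair_sigma_finite P "lborel :: 'a measure"
    by unfold_locales
  let ?k = "\<lambda>x y. std_gaussian_density ((1 / \<sigma>) *\<^sub>R (y - x)) / \<sigma> ^ DIM('a)"
  have obs' [measurable]: "observation \<sigma> \<in> P \<Otimes>\<^sub>M std_gaussian \<rightarrow>\<^sub>M borel"
    unfolding observation_def by measurable
  then have obs [measurable]: "observation \<sigma> \<in> joint_space P \<rightarrow>\<^sub>M borel"
    by (simp only: joint_space_def)
  fix A assume "A \<in> sets (distr (joint_space P) lborel (observation \<sigma>))"
  then have A [measurable]: "A \<in> sets borel" by simp
  have nd [measurable]: "noisy_density \<sigma> \<in> borel_measurable borel"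
    using continuous_noisy_density[OF assms] by (rule borel_measurable_continuous_onI)
  have inner: "(\<integral>\<^sup>+z. indicator A (observation \<sigma> (x, z)) \<partial>std_gaussian)
      = (\<integral>\<^sup>+y. ennreal (?k x y) * indicator A y \<partial>lborel)" for x
  proof -
    have "(\<integral>\<^sup>+z. indicator A (observation \<sigma> (x, z)) \<partial>std_gaussian)
        = (\<integral>\<^sup>+z. ennreal (std_gaussian_density z) * indicator A (x + \<sigma> *\<^sub>R z) \<partial>lborel)"
      unfolding std_gaussian_def observation_def by (subst nn_integral_density) auto
    also have "\<dots> = (\<integral>\<^sup>+z. ennreal (\<bar>\<sigma>\<bar> ^ DIM('a)) * (ennreal (?k x (x + \<sigma> *\<^sub>R z)) * indicator A (x + \<sigma> *\<^sub>R z)) \<partial>lborel)"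
    proof (rule nn_integral_cong)
      fix z
      have "ennreal (\<bar>\<sigma>\<bar> ^ DIM('a)) * ennreal (?k x (x + \<sigma> *\<^sub>R z)) = ennreal (std_gaussian_density z)"
        using assms by (subst ennreal_mult[symmetric]) (auto simp: std_gaussian_density_nonneg)
      then show "ennreal (std_gaussian_density z) * indicator A (x + \<sigma> *\<^sub>R z) =
          ennreal (\<bar>\<sigma>\<bar> ^ DIM('a)) * (ennreal (?k x (x + \<sigma> *\<^sub>R z)) * indicator A (x + \<sigma> *\<^sub>R z))"
        by (simp add: mult.assoc[symmetric])
    qed
    also have "\<dots> = (\<integral>\<^sup>+y. ennreal (?k x y) * indicator A y
        \<partial>density (distr lborel borel (\<lambda>z. x + \<sigma> *\<^sub>R z)) (\<lambda>_. \<bar>\<sigma>\<bar> ^ DIM('a)))"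
      by (simp add: nn_integral_density nn_integral_distr)
    also have "\<dots> = (\<integral>\<^sup>+y. ennreal (?k x y) * indicator A y \<partial>lborel)"
      using assms by (subst lborel_affine[of \<sigma> x, symmetric]) auto
    finally show ?thesis .
  qed
  have outer: "(\<integral>\<^sup>+x. ennreal (?k x y) \<partial>P) = ennreal (noisy_density \<sigma> y)" for y
  proof -
    have "(\<integral>\<^sup>+x. ennreal (?k x y) \<partial>P) = ennreal (\<integral>x. ?k x y \<partial>P)"
      unfolding noise_kernel[OF assms]
    proof (rule nn_integral_eq_integral)
      show "integrable P (\<lambda>x. noise_norm \<sigma> * exp (- (norm y)\<^sup>2 / (2 * \<sigma>\<^sup>2)) * tilt (1 / \<sigma>\<^sup>2) y x)"
        by (intro integrable_mult_right integrable_tilt) simp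
      show "AE x in P. 0 \<le> noise_norm \<sigma> * exp (- (norm y)\<^sup>2 / (2 * \<sigma>\<^sup>2)) * tilt (1 / \<sigma>\<^sup>2) y x"
        using noise_norm_pos[OF assms] by (simp add: tilt_def)
    qed
    also have "(\<integral>x. ?k x y \<partial>P) = noisy_density \<sigma> y"
      unfolding noise_kernel[OF assms] noisy_density_def partition_def by simp
    finally show ?thesis .
  qed
  have "emeasure (distr (joint_space P) lborel (observation \<sigma>)) A
      = (\<integral>\<^sup>+w. indicator A (observation \<sigma> w) \<partial>joint_space P)"
  proof -
    have "emeasure (distr (joint_space P) lborel (observation \<sigma>)) A
        = (\<integral>\<^sup>+y. indicator A y \<partial>distr (joint_space P) lborel (observation \<sigma>))" by simp
    also have "\<dots> = (\<integral>\<^sup>+w. indicator A (observation \<sigma> w) \<partial>joint_space P)"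
      by (rule nn_integral_distr) (use obs in simp_all)
    finally show ?thesis .
  qed
  also have "\<dots> = (\<integral>\<^sup>+x. \<integral>\<^sup>+z. indicator A (observation \<sigma> (x, z)) \<partial>std_gaussian \<partial>P)"
    unfolding joint_space_def
    by (rule G.nn_integral_fst[symmetric]) measurable
  also have "\<dots> = (\<integral>\<^sup>+x. \<integral>\<^sup>+y. ennreal (?k x y) * indicator A y \<partial>lborel \<partial>P)"
    by (simp add: inner)
  also have "\<dots> = (\<integral>\<^sup>+y. \<integral>\<^sup>+x. ennreal (?k x y) * indicator A y \<partial>P \<partial>lborel)"
    by (rule PL.Fubini'[symmetric]) measurable
  also have "\<dots> = (\<integral>\<^sup>+y. (\<integral>\<^sup>+x. ennreal (?k x y) \<partial>P) * indicator A y \<partial>lborel)"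
    by (intro nn_integral_cong nn_integral_multc) measurable
  also have "\<dots> = (\<integral>\<^sup>+y. ennreal (noisy_density \<sigma> y) * indicator A y \<partial>lborel)"
    by (simp add: outer)
  also have "\<dots> = emeasure (density lborel (\<lambda>y. ennreal (noisy_density \<sigma> y))) A"
    by (subst emeasure_density) auto
  finally show "emeasure (distr (joint_space P) lborel (observation \<sigma>)) A
      = emeasure (density lborel (\<lambda>y. ennreal (noisy_density \<sigma> y))) A" .
qed simp

text \<open>Densities of one law agree almost everywhere; continuity makes this pointwise, so the
  hypothesis on \<open>g\<close> becomes an explicit formula at every point.\<close>

lemma noisy_density_unique:
  assumes "\<sigma> > 0" and p: "is_noisy_density P \<sigma> p"
  shows "p = noisy_density \<sigma>"
proof (rule continuous_AE_lborel_eq)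
  interpret G: prob_space "std_gaussian :: 'a measure" by (rule prob_space_std_gaussian)
  interpret J: pair_prob_space P "std_gaussian :: 'a measure" ..
  show cp: "continuous_on UNIV p" and cn: "continuous_on UNIV (noisy_density \<sigma>)"
    using p continuous_noisy_density[OF assms(1)] by (auto simp: is_noisy_density_def)
  have [measurable]: "p \<in> borel_measurable borel" "noisy_density \<sigma> \<in> borel_measurable borel"
    using cp cn by (auto intro: borel_measurable_continuous_onI)
  have eq: "distr (joint_space P) lborel (observation \<sigma>) = density lborel (\<lambda>x. ennreal (p x))"
    using p by (simp add: is_noisy_density_def distributed_def)
  have "prob_space (distr (joint_space P) lborel (observation \<sigma>))"
    unfolding joint_space_def
    by (rule J.prob_space_distr) (simp add: observation_def[abs_def])
  then have "sigma_finite_measure (density lborel (\<lambda>x. ennreal (p x)))"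
    unfolding eq by (simp add: prob_space_imp_sigma_finite)
  then have "AE x in lborel. ennreal (p x) = ennreal (noisy_density \<sigma> x)"
    using eq distr_observation[OF assms(1)]
    by (subst sigma_finite_density_unique[symmetric]) auto
  then show "AE x in lborel. p x = noisy_density \<sigma> x"
  proof eventually_elim
    case (elim x)
    have "p x \<ge> 0" using p by (auto simp: is_noisy_density_def less_imp_le)
    moreover have "noisy_density \<sigma> x \<ge> 0"
      using noise_norm_pos[OF assms(1)] partition_pos[of "1 / \<sigma>\<^sup>2" x]
      unfolding noisy_density_def by (simp add: less_imp_le)
    ultimately show ?case using elim by simp
  qed
qed

lemma neg_log_noisy_density:
  assumes "\<sigma> > 0"
  shows "- \<sigma>\<^sup>2 * ln (noisy_density \<sigma> y) = (norm y)\<^sup>2 / 2 - log_partition (1 / \<sigma>\<^sup>2) y - \<sigma>\<^sup>2 * ln (noise_norm \<sigma>)"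
  using assms noise_norm_pos[OF assms] partition_pos[of "1 / \<sigma>\<^sup>2" y]
  unfolding noisy_density_def log_partition_def
  by (simp add: ln_mult field_simps)

end

text \<open>A countable base covers the complement of the support by countably many open null
  sets.\<close>

lemma AE_measure_support:
  fixes P :: "'a::euclidean_space measure"
  assumes "sets P = sets borel"
  shows "AE x in P. x \<in> measure_support P"
proof -
  obtain \<B> :: "'a set set" where B: "countable \<B>" "topological_basis \<B>"
    using ex_countable_basis by blast
  define N where "N = {B \<in> \<B>. emeasure P B = 0}"
  have op: "open B" if "B \<in> \<B>" for B using B(2) that topological_basis_open by blast
  have "\<Union>N \<in> null_sets P"
  proof -
    have "(\<Union>B\<in>N. B) \<in> null_sets P"
      by (rule null_sets_UN') (use B op assms in \<open>auto simp: N_def intro: countable_subset\<close>)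
    then show ?thesis by simp
  qed
  moreover have "{x \<in> space P. x \<notin> measure_support P} \<subseteq> \<Union>N"
  proof safe
    fix x assume "x \<notin> measure_support P"
    then obtain V where V: "open V" "x \<in> V" "emeasure P V = 0"
      by (auto simp: measure_support_def)
    obtain W where W: "W \<in> \<B>" "x \<in> W" "W \<subseteq> V" using topological_basisE[OF B(2) V(1,2)] by metis
    have "emeasure P W \<le> emeasure P V" using W(3) V(1) assms by (intro emeasure_mono) auto
    then have "W \<in> N" using W V by (simp add: N_def)
    then show "x \<in> \<Union>N" using W(2) by blast
  qed
  ultimately show ?thesis by (rule AE_I')
qed

text \<open>If the prior gave full mass to a hyperplane, the complement would be an open null set
  and could not meet the support.\<close>

lemma bounded_prior_of_nondegenerate:
  assumes "nondegenerate_compact_prior P"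
  obtains R where "bounded_prior P R"
proof -
  have P: "prob_space P" "sets P = sets borel" "compact (measure_support P)"
    "\<not> (\<exists>a b. a \<noteq> 0 \<and> measure_support P \<subseteq> {x. a \<bullet> x = b})"
    using assms by (auto simp: nondegenerate_compact_prior_def)
  obtain R where R: "\<And>x. x \<in> measure_support P \<Longrightarrow> norm x \<le> R"
    using compact_imp_bounded[OF P(3)] by (auto simp: bounded_iff)
  interpret prob_space P by fact
  have "bounded_prior P R"
  proof
    show "sets P = sets borel" by fact
    show "AE x in P. norm x \<le> R"
      using AE_measure_support[OF P(2)] by eventually_elim (rule R)
    fix a b assume a: "a \<noteq> (0::'a)"
    show "\<not> (AE x in P. a \<bullet> x = b)"
    proof
      assume ae: "AE x in P. a \<bullet> x = b"
      have "measure_support P \<subseteq> {x. a \<bullet> x = b}"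
      proof
        fix x assume x: "x \<in> measure_support P"
        let ?V = "{x. a \<bullet> x \<noteq> b}"
        have V: "open ?V" by (intro open_Collect_neq continuous_intros)
        then have "?V \<in> null_sets P"
          using ae P(2) AE_iff_null_sets[of ?V P] by auto
        then have "\<not> emeasure P ?V > 0" by auto
        then show "x \<in> {x. a \<bullet> x = b}" using x V unfolding measure_support_def by blast
      qed
      then show False using P(4) a by blast
    qed
  qed
  then show ?thesis by (rule that)
qed

lemma annealed_denoisers_of_mmse:
  fixes g :: "real \<Rightarrow> 'a::euclidean_space \<Rightarrow> real"
  assumes C2: "C2_on (UNIV \<times> {0<..}) (\<lambda>(x, \<sigma>). g \<sigma> x)"
    and eps: "0 < \<epsilon>" "\<epsilon> \<le> \<sigma>\<^sub>0"
    and mmse: "exact_mmse_case P {\<epsilon>..\<sigma>\<^sub>0} g"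
  shows "\<exists>c A. annealed_denoisers g \<epsilon> \<sigma>\<^sub>0 c A"
proof -
  obtain R where "bounded_prior P R"
    using bounded_prior_of_nondegenerate mmse unfolding exact_mmse_case_def by blast
  then interpret bounded_prior P R .
  let ?D = "denoiser g" and ?K = "\<lambda>\<sigma>. log_partition (1 / \<sigma>\<^sup>2)"
  \<comment> \<open>Adding \<open>c \<sigma>\<close> back to the potential leaves the conjugate of
    \<open>log_partition\<close> minus the half square, which is monotone in the level.\<close>
  define c where "c \<sigma> = \<sigma>\<^sup>2 * ln (noise_norm \<sigma>)" for \<sigma>
  have p: "\<sigma> > 0" if "\<sigma> \<in> {\<epsilon>..\<sigma>\<^sub>0}" for \<sigma> using that eps by auto
  have g_eq: "g \<sigma> z = (norm z)\<^sup>2 / 2 - ?K \<sigma> z - c \<sigma>" if s: "\<sigma> \<in> {\<epsilon>..\<sigma>\<^sub>0}" for \<sigma> z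
  proof -
    obtain d where "is_noisy_density P \<sigma> d" "\<forall>x. g \<sigma> x = - \<sigma>\<^sup>2 * ln (d x)"
      using mmse s unfolding exact_mmse_case_def by blast
    then show ?thesis
      using noisy_density_unique[OF p[OF s]] neg_log_noisy_density[OF p[OF s], of z] by (simp add: c_def)
  qed
  have gd: "GDERIV (\<lambda>z. (norm z)\<^sup>2 / 2 - g \<sigma> z) z :> ?D \<sigma> z" if "\<sigma> \<in> {\<epsilon>..\<sigma>\<^sub>0}" for \<sigma> z
    by (rule denoiser_GDERIV C2_family_GDERIV[OF C2 p[OF that]])+
  have h_eq: "(norm z)\<^sup>2 / 2 - g \<sigma> z = ?K \<sigma> z + c \<sigma>" if "\<sigma> \<in> {\<epsilon>..\<sigma>\<^sub>0}" for \<sigma> z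
    using g_eq[OF that, of z] by simp
  have gK: "GDERIV (?K \<sigma>) z :> ?D \<sigma> z" if "\<sigma> \<in> {\<epsilon>..\<sigma>\<^sub>0}" for \<sigma> z
    using GDERIV_diff[OF gd[OF that, of z] GDERIV_const[of "c \<sigma>"]] by (simp add: h_eq[OF that])
  have cont: "continuous_on UNIV (?D \<sigma>)" if "\<sigma> \<in> {\<epsilon>..\<sigma>\<^sub>0}" for \<sigma>
    unfolding denoiser_def by (intro continuous_intros C2_family_continuous_grad[OF C2 p[OF that]])
  have umono: "\<exists>m>0. \<forall>\<sigma>\<in>{\<epsilon>..\<sigma>\<^sub>0}. \<forall>z\<in>cball 0 \<rho>. \<forall>w\<in>cball 0 \<rho>.
      m * (norm (z - w))\<^sup>2 \<le> (?D \<sigma> z - ?D \<sigma> w) \<bullet> (z - w)" for \<rho>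
  proof -
    let ?S = "(\<lambda>\<sigma>. 1 / \<sigma>\<^sup>2) ` {\<epsilon>..\<sigma>\<^sub>0}"
    have "\<exists>m>0. \<forall>s\<in>?S. \<forall>z\<in>cball 0 \<rho>. \<forall>w\<in>cball 0 \<rho>.
        m * (norm (z - w))\<^sup>2 \<le> (grad (log_partition s) z - grad (log_partition s) w) \<bullet> (z - w)"
    proof (rule log_partition_strongly_monotone[of "1 / \<sigma>\<^sub>0\<^sup>2" "1 / \<epsilon>\<^sup>2"])
      show "?S \<subseteq> {1 / \<sigma>\<^sub>0\<^sup>2..1 / \<epsilon>\<^sup>2}"
        using eps by (auto intro!: divide_left_mono power_mono)
      show "1 / \<sigma>\<^sub>0\<^sup>2 \<le> 1 / \<epsilon>\<^sup>2" using eps by (intro divide_left_mono power_mono) auto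
      show "GDERIV (log_partition s) z :> grad (log_partition s) z" if sS: "s \<in> ?S" for s z
      proof -
        obtain \<sigma> where \<sigma>: "\<sigma> \<in> {\<epsilon>..\<sigma>\<^sub>0}" "s = 1 / \<sigma>\<^sup>2" using sS by blast
        show ?thesis using gK[OF \<sigma>(1), of z] grad_eq[OF gK[OF \<sigma>(1), of z]] by (simp add: \<sigma>(2))
      qed
    qed (use eps in simp)
    moreover have "grad (?K \<sigma>) z = ?D \<sigma> z" if "\<sigma> \<in> {\<epsilon>..\<sigma>\<^sub>0}" for \<sigma> z
      using grad_eq gK[OF that] by blast
    ultimately show ?thesis by auto
  qed
  have lsig: "\<exists>C\<ge>0. \<forall>\<sigma>\<in>{\<epsilon>..\<sigma>\<^sub>0}. \<forall>\<sigma>'\<in>{\<epsilon>..\<sigma>\<^sub>0}. \<forall>z\<in>cball 0 \<rho>.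
      norm (?D \<sigma> z - ?D \<sigma>' z) \<le> C * \<bar>\<sigma> - \<sigma>'\<bar>" for \<rho>
  proof -
    have "norm (?D \<sigma> z - ?D \<sigma>' z) = norm (grad (g \<sigma>) z - grad (g \<sigma>') z)" for \<sigma> \<sigma>' z
      by (simp add: denoiser_def norm_minus_commute)
    then show ?thesis using C2_family_lipschitz[OF C2 eps(1), of \<sigma>\<^sub>0 \<rho>] by simp
  qed
  have prox: "proximal_denoiser g \<sigma>" if s: "\<sigma> \<in> {\<epsilon>..\<sigma>\<^sub>0}" for \<sigma>
    by unfold_locales (use gd[OF s] cont[OF s] umono s in \<open>meson\<close>)+
  have K_mono: "?K \<sigma> z \<le> ?K \<sigma>' z" if "\<epsilon> \<le> \<sigma>'" "\<sigma>' \<le> \<sigma>" "\<sigma> \<le> \<sigma>\<^sub>0" for \<sigma> \<sigma>' z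
    using that eps by (intro log_partition_mono divide_left_mono power_mono) auto
  have rmono: "range (?D \<sigma>) \<subseteq> range (?D \<sigma>')" if s: "\<epsilon> \<le> \<sigma>'" "\<sigma>' \<le> \<sigma>" "\<sigma> \<le> \<sigma>\<^sub>0" for \<sigma> \<sigma>'
  proof -
    have mem: "\<sigma> \<in> {\<epsilon>..\<sigma>\<^sub>0}" "\<sigma>' \<in> {\<epsilon>..\<sigma>\<^sub>0}" using s by auto
    interpret proximal_denoiser g \<sigma> using prox[OF mem(1)] .
    show ?thesis
      by (rule range_D_subset[where b = "c \<sigma> - c \<sigma>'", OF gd[OF mem(2)]])
        (use K_mono[OF s] h_eq[OF mem(1)] h_eq[OF mem(2)] in simp)
  qed
  have normD: "norm x \<le> R" if "\<sigma> \<in> {\<epsilon>..\<sigma>\<^sub>0}" "x \<in> range (?D \<sigma>)" for \<sigma> x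
    using gradient_norm_le[OF _ gK[OF that(1)]] that(2) p[OF that(1)] by auto
  have nonneg: "0 \<le> pot g \<sigma> x + (c \<sigma> + R\<^sup>2 / 2)" if s: "\<sigma> \<in> {\<epsilon>..\<sigma>\<^sub>0}" and x: "x \<in> range (?D \<sigma>)" for \<sigma> x
  proof -
    \<comment> \<open>The test point 0 gives the lower bound
      \<open>- c \<sigma> - R\<^sup>2 / 2\<close>; this is why the shift contains
      \<open>R\<^sup>2 / 2\<close>.\<close>
    have "pot g \<sigma> x \<ge> g \<sigma> 0 - (norm (x - 0))\<^sup>2 / 2"
      by (rule proximal_denoiser.pot_ge[OF prox[OF s] x])
    moreover have "(norm x)\<^sup>2 \<le> R\<^sup>2" using normD[OF s x] by (intro power_mono) auto
    moreover have "?K \<sigma> 0 \<le> 0" using log_partition_0_le p[OF s] by simp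
    ultimately show ?thesis using g_eq[OF s, of 0] by simp
  qed
  have change: "(1 - 0 * (\<sigma> - \<sigma>')) * (pot g \<sigma>' x + (c \<sigma>' + R\<^sup>2 / 2)) \<le> pot g \<sigma> x + (c \<sigma> + R\<^sup>2 / 2)"
    if s: "\<epsilon> \<le> \<sigma>'" "\<sigma>' \<le> \<sigma>" "\<sigma> \<le> \<sigma>\<^sub>0" and x: "x \<in> range (?D \<sigma>)" for \<sigma> \<sigma>' x
  proof -
    have mem: "\<sigma> \<in> {\<epsilon>..\<sigma>\<^sub>0}" "\<sigma>' \<in> {\<epsilon>..\<sigma>\<^sub>0}" using s by auto
    \<comment> \<open>The preimage at the smaller level reduces the comparison of potentials to that
      of log-partition functions at the same point; hence the constant \<open>A = 0\<close>.\<close>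
    obtain z where z: "x = ?D \<sigma>' z" using rmono[OF s] x by blast
    have "pot g \<sigma>' x = g \<sigma>' z - (norm (x - z))\<^sup>2 / 2"
      unfolding z by (rule proximal_denoiser.pot_denoiser[OF prox[OF mem(2)]])
    moreover have "pot g \<sigma> x \<ge> g \<sigma> z - (norm (x - z))\<^sup>2 / 2"
      by (rule proximal_denoiser.pot_ge[OF prox[OF mem(1)] x])
    ultimately show ?thesis
      using K_mono[OF s, of z] g_eq[OF mem(1), of z] g_eq[OF mem(2), of z] by simp
  qed
  have "annealed_denoisers g \<epsilon> \<sigma>\<^sub>0 (\<lambda>\<sigma>. c \<sigma> + R\<^sup>2 / 2) 0"
  proof
    show "\<exists>R. \<forall>\<sigma>\<in>{\<epsilon>..\<sigma>\<^sub>0}. \<forall>x\<in>range (?D \<sigma>). pot g \<sigma> x + (c \<sigma> + R'\<^sup>2 / 2) \<le> B \<longrightarrow> norm x \<le> R" for B R'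
      using normD by blast
  qed (fact gd cont umono lsig rmono nonneg change order_refl)+
  then show ?thesis by blast
qed

theorem theoremB2:
  fixes f :: "'a::euclidean_space \<Rightarrow> real"
    and g :: "real \<Rightarrow> 'a \<Rightarrow> real"
    and s \<tau> :: "nat \<Rightarrow> real"
    and \<epsilon> \<gamma> L\<^sub>f L\<^sub>g c\<^sub>0 C\<^sub>0 M\<^sub>g :: real
    and \<Omega> :: "'w measure"
    and Z X :: "nat \<Rightarrow> 'w \<Rightarrow> 'a"
    and x\<^sub>0 :: 'a
  assumes f_C1: "C1_on UNIV f"
    and f_bounded_below: "bdd_below (range f)"
    and f_subanalytic: "subanalytic_on UNIV f"
    and f_Lipschitz: "L\<^sub>f-lipschitz_on UNIV (grad f)"
    and s_decreasing: "\<And>k. s (Suc k) \<le> s k"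
    and s_limit: "s \<longlonglongrightarrow> \<epsilon>"
    and eps_pos: "\<epsilon> > 0"
    and g_C2: "C2_on (UNIV \<times> {0<..}) (\<lambda>(x, \<sigma>). g \<sigma> x)"
    and g_subanalytic: "subanalytic_on (UNIV \<times> {0<..}) (\<lambda>(x, \<sigma>). g \<sigma> x)"
    and g_Lipschitz: "\<And>\<sigma>. \<sigma> \<in> {\<epsilon>..s 0} \<Longrightarrow> L\<^sub>g-lipschitz_on UNIV (grad (g \<sigma>))"
    and constants_pos: "c\<^sub>0 > 0" "C\<^sub>0 > 0" "M\<^sub>g > 0"
    and g_coercive: "\<And>x \<sigma>. \<sigma> \<in> {\<epsilon>..s 0} \<Longrightarrow> g \<sigma> x \<ge> c\<^sub>0 * (norm x)\<^sup>2 - C\<^sub>0"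
    and g_deriv_sigma:
      "\<And>x \<sigma>. \<sigma> \<in> {\<epsilon>..s 0} \<Longrightarrow> \<bar>deriv (\<lambda>t. g t x) \<sigma>\<bar> \<le> M\<^sub>g * (1 + (norm x)\<^sup>2)"
    and cases_a_b:
      "(\<exists>\<rho><1. \<forall>\<sigma>\<in>{\<epsilon>..s 0}. \<rho>-lipschitz_on UNIV (grad (g \<sigma>))) \<or>
       (\<exists>P. exact_mmse_case P {\<epsilon>..s 0} g)"
    and gamma: "\<gamma> > 0" "\<gamma> * L\<^sub>f < 1"
    and tau_nonneg: "\<And>k. \<tau> k \<ge> 0"
    and tau_summable: "summable (\<lambda>k. (\<tau> k)\<^sup>2)"
    and prob: "prob_space \<Omega>"
    and Z_gaussian:
      "\<And>k. distributed \<Omega> lborel (Z (Suc k)) (\<lambda>z. ennreal (std_gaussian_density z))"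
    and X_0: "\<And>\<omega>. X 0 \<omega> = x\<^sub>0"
    and X_Suc: "\<And>k \<omega>. X (Suc k) \<omega> =
      denoiser g (s k) (X k \<omega> - \<gamma> *\<^sub>R grad f (X k \<omega>) + \<tau> k *\<^sub>R Z (Suc k) \<omega>)"
  defines "F \<equiv> objective f g \<gamma>"
  shows "AE \<omega> in \<Omega>.
      (\<forall>k\<ge>1. X k \<omega> \<in> int_dom (potential g \<epsilon>) \<and>
              finite_part (F \<epsilon>) differentiable (at (X k \<omega>)) \<and>
              X k \<omega> \<in> int_dom (potential g (s k)) \<and>
              finite_part (F (s k)) differentiable (at (X k \<omega>))) \<and>
      (\<lambda>k. norm (grad (finite_part (F \<epsilon>)) (X k \<omega>))) \<longlonglongrightarrow> 0 \<and>
      (\<lambda>k. norm (X (Suc k) \<omega> - X k \<omega>)) \<longlonglongrightarrow> 0 \<and>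
      (\<forall>y. (\<exists>r. strict_mono r \<and> (\<lambda>n. X (r n) \<omega>) \<longlonglongrightarrow> y) \<longrightarrow> y \<in> crit (F \<epsilon>)) \<and>
      crit (F \<epsilon>) \<noteq> {} \<and> (\<lambda>k. infdist (X k \<omega>) (crit (F \<epsilon>))) \<longlonglongrightarrow> 0 \<and>
      (\<exists>C. \<forall>K\<ge>1.
        Min ((\<lambda>k. (norm (grad (finite_part (F (s k))) (X k \<omega>)))\<^sup>2) ` {1..K}) \<le> C / real K)"
proof -
  have gf: "GDERIV f x :> grad f x" for x
  proof -
    obtain G where G: "\<forall>x\<in>UNIV. GDERIV f x :> G x" using f_C1 unfolding C1_on_def by blast
    then have "GDERIV f x :> G x" by blast
    then show ?thesis using grad_eq by metis
  qed
  have s_ge: "\<epsilon> \<le> s k" for k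
    using decseq_ge[OF _ s_limit] s_decreasing by (simp add: decseq_Suc_iff)
  obtain c A where "annealed_denoisers g \<epsilon> (s 0) c A"
    using cases_a_b
  proof (elim disjE exE conjE)
    fix \<rho> assume "\<rho> < 1" "\<forall>\<sigma>\<in>{\<epsilon>..s 0}. \<rho>-lipschitz_on UNIV (grad (g \<sigma>))"
    then show ?thesis
      using that annealed_denoisers_of_contractive[OF g_C2 eps_pos s_ge constants_pos(1,3) g_coercive g_deriv_sigma]
      by blast
  next
    fix P assume "exact_mmse_case P {\<epsilon>..s 0} g"
    then show ?thesis
      using that annealed_denoisers_of_mmse[OF g_C2 eps_pos s_ge] by blast
  qed
  then interpret annealed_denoisers g \<epsilon> "s 0" c A .
  \<comment> \<open>This is the only almost sure event used; on it \<open>annealed_run\<close>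
    applies to the path of \<open>\<omega>\<close>.\<close>
  have "AE \<omega> in \<Omega>. summable (\<lambda>k. (norm (\<tau> k *\<^sub>R Z (Suc k) \<omega>))\<^sup>2)"
    using Z_gaussian tau_summable by (rule AE_summable_scaled_gaussian)
  then show ?thesis
  proof eventually_elim
    case (elim \<omega>)
    interpret annealed_run g \<epsilon> "s 0" c A f "grad f" s \<gamma> L\<^sub>f "\<lambda>k. X k \<omega>" "\<lambda>k. \<tau> k *\<^sub>R Z (Suc k) \<omega>"
      by unfold_locales (use gf f_Lipschitz f_bounded_below s_decreasing s_limit gamma elim X_Suc in auto)
    have reg: "X k \<omega> \<in> int_dom (potential g \<epsilon>) \<and>
        finite_part (F \<epsilon>) differentiable (at (X k \<omega>)) \<and>
        X k \<omega> \<in> int_dom (potential g (s k)) \<and>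
        finite_part (F (s k)) differentiable (at (X k \<omega>))" if k1: "k \<ge> 1" for k
    proof -
      obtain j where k: "k = Suc j" using k1 by (cases k) auto
      show ?thesis
        unfolding k F_def
        using iterate_regular[OF order_refl s_ge] iterate_regular[OF s_ge s_decreasing] by blast
    qed
    show ?case
      using reg gradient_tendsto_0 increments_tendsto_0 cluster_point_critical crit_nonempty_infdist
        gradient_rate
      unfolding F_def grad_at_def by blast
  qed
qed

end
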